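(* For any $q>0$, the distribution of $V_q$ is infinitely divisible and its Laplace exponent $l_q(\lambda):=-\ln\mathrm{E}[e^{-\lambda V_q}]$ is given by $$l_q(\lambda)=\int_{\varphi(q)}^{\lambda+\varphi(q)}\frac{\psi'(s)-\alpha}{\psi(s)}\,\mathrm{d}s,\qquad\lambda>0.$$ Moreover, $l_q(\lambda)$ has the Lévy--Khintchine decomposition $$l_q(\lambda)=b_q\lambda+\int_0^{+\infty}\left(1-e^{-\lambda x}\right)\frac{v_q(x)}{x}\,\mathrm{d}x,$$ where $b_q=0$, $$v_q(x)=e^{-\varphi(q)x}\left[\sigma^2W'(x)+\int_{(0,+\infty)}\left(W(x)-W(x-r)\right)r\,\pi(\mathrm{d}r)\right],\qquad x>0,$$ and $W'(x)$ denotes the derivative of $W(x)$.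
   Context: Branching mechanism: $\psi(\lambda)=\alpha\lambda+\frac12\sigma^2\lambda^2+\int_0^{+\infty}(e^{-\lambda r}-1+\lambda r)\,\pi(\mathrm{d}r)$, $\lambda\ge 0$, where $\alpha\ge 0$, $\sigma\ge 0$ and $\pi$ is a positive Radon measure on $(0,+\infty)$ with $\int_0^{+\infty}(r\wedge r^2)\,\pi(\mathrm{d}r)<+\infty$. It is assumed that $\psi(+\infty)=+\infty$ and $\int^{+\infty}\frac{1}{\psi(\lambda)}\,\mathrm{d}\lambda<+\infty$ (integrability at $+\infty$). $\phi(\lambda):=\int_\lambda^{+\infty}\frac{1}{\psi(u)}\,\mathrm{d}u$ for $\lambda>0$, which is a strictly decreasing bijection of $(0,+\infty)$, and $\varphi:(0,+\infty)\to(0,+\infty)$ is its inverse function. Scale function: $W$ is the unique strictly increasing, nonnegative, continuous function on $[0,+\infty)$ with $\int_0^{+\infty}e^{-\lambda x}W(x)\,\mathrm{d}x=\frac1{\psi(\lambda)}$ for all $\lambda>0$; $W(x):=0$ for $x<0$. Under the present assumptions $W(0)=0$ and $W$ is continuously differentiable on $(0,+\infty)$. For $q>0$, $V_q$ is the positive random variable whose law is determined by $$\mathrm{E}\left[e^{-\lambda V_q}\right]=e^{-\alpha(\phi(\lambda+\varphi(q))-q)}\,\frac{\psi(\varphi(q))}{\psi(\lambda+\varphi(q))},\qquad\lambda>0.$$ (It is the limit law as $t\to+\infty$ of $Z_{t-q}$ conditioned on extinction at time $t$, for the continuous-state branching process $Z$ with branching mechanism $\psi$.) *)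

theory Defs
  imports "HOL-Probability.Probability"
begin

text \<open>The measure \<open>\<pi>\<close> lives on the Borel sets of the open half-line, that is
  \<open>sets \<pi> = sets (restrict_space borel {0<..})\<close>, so that integrals with respect to \<open>\<pi>\<close> are
  integrals over the open half-line. Only the values of \<open>branching_mechanism\<close> at
  \<open>\<theta> \<ge> 0\<close> are meaningful.\<close>

definition branching_mechanism :: "real \<Rightarrow> real \<Rightarrow> real measure \<Rightarrow> real \<Rightarrow> real" where
  "branching_mechanism \<alpha> \<sigma> \<pi> \<theta> =
     \<alpha> * \<theta> + 1 / 2 * \<sigma>\<^sup>2 * \<theta>\<^sup>2 + (LINT r|\<pi>. exp (- \<theta> * r) - 1 + \<theta> * r)"

text \<open>A measure on the open half-line that integrates \<open>min r (r\<^sup>2)\<close> is finite on compact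
  subsets, so the Radon property needs no clause of its own.\<close>

definition admissible :: "real \<Rightarrow> real \<Rightarrow> real measure \<Rightarrow> bool" where
  "admissible \<alpha> \<sigma> \<pi> \<longleftrightarrow>
     0 \<le> \<alpha> \<and> 0 \<le> \<sigma> \<and>
     sets \<pi> = sets (restrict_space borel {0<..}) \<and>
     integrable \<pi> (\<lambda>r. min r (r\<^sup>2)) \<and>
     filterlim (branching_mechanism \<alpha> \<sigma> \<pi>) at_top at_top \<and>
     (\<exists>a>0. set_integrable lborel {a..} (\<lambda>u. 1 / branching_mechanism \<alpha> \<sigma> \<pi> u))"

definition tail_integral :: "(real \<Rightarrow> real) \<Rightarrow> real \<Rightarrow> real" where
  "tail_integral \<psi> \<theta> = (LINT u:{\<theta>..}|lborel. 1 / \<psi> u)"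

definition tail_integral_inv :: "(real \<Rightarrow> real) \<Rightarrow> real \<Rightarrow> real" where
  "tail_integral_inv \<psi> = the_inv_into {0<..} (tail_integral \<psi>)"

text \<open>In the Laplace transform condition below, \<open>1 / \<psi> \<theta>\<close> is nonzero, so the equation
  includes the convergence of the integral.\<close>

definition scale_function :: "(real \<Rightarrow> real) \<Rightarrow> (real \<Rightarrow> real) \<Rightarrow> bool" where
  "scale_function \<psi> W \<longleftrightarrow>
     strict_mono_on {0..} W \<and> (\<forall>x\<ge>0. 0 \<le> W x) \<and> continuous_on {0..} W \<and>
     (\<forall>x<0. W x = 0) \<and>
     (\<forall>\<theta>>0. (LINT x:{0..}|lborel. exp (- \<theta> * x) * W x) = 1 / \<psi> \<theta>)"

definition laplace_exponent :: "'a measure \<Rightarrow> ('a \<Rightarrow> real) \<Rightarrow> real \<Rightarrow> real" where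
  "laplace_exponent M X \<theta> = - ln (LINT \<omega>|M. exp (- \<theta> * X \<omega>))"

text \<open>For every \<open>n \<ge> 1\<close>, \<open>\<mu>\<close> is the law of a sum of \<open>n\<close> independent random variables with a
  common law \<open>\<nu>\<close>.\<close>

definition infinitely_divisible :: "real measure \<Rightarrow> bool" where
  "infinitely_divisible \<mu> \<longleftrightarrow>
     real_distribution \<mu> \<and>
     (\<forall>n::nat\<ge>1. \<exists>\<nu>. real_distribution \<nu> \<and>
        \<mu> = distr (Pi\<^sub>M {..<n} (\<lambda>_. \<nu>)) borel (\<lambda>x. \<Sum>i<n. x i))"

text \<open>\<open>l\<close> is the Laplace exponent with drift \<open>b\<close> and Levy measure \<open>v x / x dx\<close> on the open
  half-line; the integrability clause is the usual condition on the Levy measure of a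
  nonnegative infinitely divisible law.\<close>

definition levy_khintchine :: "(real \<Rightarrow> real) \<Rightarrow> real \<Rightarrow> (real \<Rightarrow> real) \<Rightarrow> bool" where
  "levy_khintchine l b v \<longleftrightarrow>
     0 \<le> b \<and> (\<forall>x>0. 0 \<le> v x) \<and>
     set_integrable lborel {0<..} (\<lambda>x. min 1 x * (v x / x)) \<and>
     (\<forall>\<theta>>0. l \<theta> = b * \<theta> + (LINT x:{0<..}|lborel. (1 - exp (- \<theta> * x)) * (v x / x)))"

definition levy_density ::
    "real \<Rightarrow> real measure \<Rightarrow> (real \<Rightarrow> real) \<Rightarrow> real \<Rightarrow> real \<Rightarrow> real" where
  "levy_density \<sigma> \<pi> W c x =
     exp (- c * x) * (\<sigma>\<^sup>2 * deriv W x + (LINT r|\<pi>. (W x - W (x - r)) * r))"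

end

theory Submission
  imports Defs
begin

text \<open>
  Put \<open>c = \<phi>inv q\<close>, so that \<open>\<phi> c = q\<close>. Because \<open>\<phi>\<close> is the tail integral of \<open>1 / \<psi>\<close>, minus the
  logarithm of the given transform is the integral of \<open>(\<psi>' - \<alpha>) / \<psi>\<close> over \<open>[c, \<theta> + c]\<close>
  (\<open>log_psi_increment\<close>). The Levy measure can be read off from this integrand. Indeed
  \<open>\<psi>' s - \<alpha> = \<sigma>\<^sup>2 s + \<integral> r (1 - exp (- s r)) \<pi>(dr)\<close>, and \<open>1 / \<psi>\<close> is the Laplace transform
  of \<open>W\<close>; multiplication of a transform by \<open>exp (- s r)\<close> translates the function by \<open>r\<close>, and
  multiplication by \<open>s\<close> differentiates it, as \<open>W\<close> vanishes at the origin. Hence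
  \<open>(\<psi>' - \<alpha>) / \<psi>\<close> is the transform of the nonnegative function
  \<open>\<sigma>\<^sup>2 W' x + \<integral> (W x - W (x - r)) r \<pi>(dr)\<close>. The factor \<open>exp (- c x)\<close> moves the argument of the
  transform from \<open>s\<close> to \<open>s + c\<close> (\<open>nn_laplace_levy_density\<close>), and integration over
  \<open>0 \<le> s \<le> \<theta>\<close> turns \<open>exp (- s x)\<close> into \<open>(1 - exp (- \<theta> x)) / x\<close> (\<open>nn_levy_khintchine\<close>).
  All integrands are nonnegative, so Tonelli's theorem justifies every exchange.

  Two points are less routine. The first is that \<open>W'\<close> exists at every positive point when
  \<open>\<sigma> > 0\<close>; this also gives \<open>W' \<ge> 0\<close>, hence a nonnegative density. Write
  \<open>\<psi> s / s\<^sup>2 = \<sigma>\<^sup>2 / 2 + K s\<close>, where \<open>K\<close> is the Laplace transform of the decreasing function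
  \<open>k r = \<alpha> + \<integral> max 0 (y - r) \<pi>(dy)\<close>. Uniqueness of Laplace transforms converts
  \<open>(\<sigma>\<^sup>2 / 2 + K s) / \<psi> s = 1 / s\<^sup>2\<close> into the Volterra equation
  \<open>\<sigma>\<^sup>2 / 2 * W x + (k * W) x = x\<close>. As \<open>W\<close> is increasing, both terms on the left are, so \<open>W\<close> is
  Lipschitz. Its difference quotients satisfy the same equation up to a boundary term that is
  small with the step, and the equation is stable in a norm with weight \<open>exp (- a x)\<close> for large
  \<open>a\<close>. So the quotients converge locally uniformly (\<open>D_uniformly_cauchy\<close>), and their
  limit is the derivative of \<open>W\<close> (\<open>solution_differentiable\<close>).

  The second point is infinite divisibility. The function \<open>v\<close> in the Levy measure \<open>v x / x dx\<close> is
  integrable, with total mass \<open>(\<psi>' c - \<alpha>) / \<psi> c\<close>. For any such function a law with exponent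
  \<open>\<integral> (1 - exp (- \<theta> x)) v x / x dx\<close> is a weak limit of sums of independent variables whose
  jumps are rare (\<open>subordinator_law_exists\<close>). Applied to \<open>v / n\<close>, this gives an \<open>n\<close>-th
  convolution root, and uniqueness of Laplace transforms identifies its \<open>n\<close>-fold convolution
  with the law of \<open>V\<close>.
\<close>

section \<open>Laplace transforms determine measures on the half-line\<close>

lemma laplace_transform_determines_polynomial_integrals:
  fixes M N :: "real measure" and a :: "nat \<Rightarrow> real"
  assumes "finite_borel_measure M" "finite_borel_measure N"
    and "AE x in M. 0 \<le> x" "AE x in N. 0 \<le> x"
    and eq: "\<And>k::nat. (LINT x|M. exp (- real k * x)) = (LINT x|N. exp (- real k * x))"
  shows "(LINT x|M. (\<Sum>i\<le>n. a i * exp (- x) ^ i)) = (LINT x|N. (\<Sum>i\<le>n. a i * exp (- x) ^ i))"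
proof -
  have pow: "exp (- x) ^ i = exp (- real i * x)" for x :: real and i
    by (simp add: exp_of_nat_mult [symmetric])
  have int: "integrable P (\<lambda>x. exp (- real i * x))"
    if "finite_borel_measure P" "AE x in P. 0 \<le> x" for P :: "real measure" and i :: nat
  proof -
    interpret finite_borel_measure P by fact
    note [measurable_cong] = M_is_borel
    show ?thesis
      by (rule integrable_const_bound [where B = 1]) (use that in auto)
  qed
  show ?thesis
    unfolding pow using int assms by simp
qed

text \<open>After the substitution \<open>u = exp (- x)\<close>, the values of the transform at the natural numbers are the
moments of a measure on \<open>(0, 1]\<close>, so integrals of polynomials in \<open>u\<close> agree and, by the Weierstrass
theorem, integrals of continuous functions on \<open>[0, 1]\<close> agree. Piecewise linear functions that
decrease to the indicator of \<open>u \<ge> exp (- a)\<close>, that is of \<open>x \<le> a\<close>, show that the distribution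
functions agree.\<close>

lemma finite_measure_eqI_laplace:
  fixes M N :: "real measure"
  assumes M: "finite_borel_measure M" "AE x in M. 0 \<le> x"
    and N: "finite_borel_measure N" "AE x in N. 0 \<le> x"
    and eq: "\<And>k::nat. (LINT x|M. exp (- real k * x)) = (LINT x|N. exp (- real k * x))"
  shows "M = N"
proof (rule cdf_unique' [OF M(1) N(1)], rule ext)
  fix a :: real
  interpret M: finite_borel_measure M by fact
  interpret N: finite_borel_measure N by fact
  \<comment> \<open>The threshold \<open>exp (- a)\<close> corresponds to \<open>x = a\<close>, and larger \<open>u\<close> means smaller \<open>x\<close>.\<close>
  define ramp where "ramp j u = max 0 (min 1 (1 + real j * (u - exp (- a))))" for j :: nat and u :: real
  have ramp_bound: "\<bar>ramp j u\<bar> \<le> 1" for j u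
    by (simp add: ramp_def)
  have ramp_meas [measurable]: "ramp j \<in> borel_measurable borel" for j
    unfolding ramp_def by measurable
  have ramp_int: "integrable P (\<lambda>x. ramp j (exp (- x)))" if "finite_borel_measure P" for P j
  proof -
    interpret finite_borel_measure P by fact
    note [measurable_cong] = M_is_borel
    show ?thesis by (rule integrable_const_bound [where B = 1]) (auto simp: ramp_bound)
  qed
  have ramp_eq: "(LINT x|M. ramp j (exp (- x))) = (LINT x|N. ramp j (exp (- x)))" for j
  proof -
    define C where "C = measure M (space M) + measure N (space N) + 1"
    have C: "0 < C" by (simp add: C_def add_nonneg_pos)
    have close: "\<bar>(LINT x|M. ramp j (exp (- x))) - (LINT x|N. ramp j (exp (- x)))\<bar> \<le> e"
      if "0 < e" for e
    proof -
      define \<delta> where "\<delta> = e / C"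
      have \<delta>: "0 < \<delta>" using that C by (simp add: \<delta>_def)
      obtain p where p: "real_polynomial_function p"
        and approx: "\<And>u. u \<in> {0..1} \<Longrightarrow> \<bar>ramp j u - p u\<bar> < \<delta>"
        by (rule Stone_Weierstrass_real_polynomial_function [of "{0..1::real}" "ramp j" \<delta>])
          (auto simp: ramp_def \<delta> intro!: continuous_intros)
      obtain b n where p_sum: "p = (\<lambda>u. \<Sum>i\<le>n. b i * u ^ i)"
        using p unfolding real_polynomial_function_iff_sum by blast
      have bound: "\<bar>(LINT x|P. ramp j (exp (- x))) - (LINT x|P. p (exp (- x)))\<bar>
          \<le> \<delta> * measure P (space P)"
        if P: "finite_borel_measure P" "AE x in P. 0 \<le> x" for P
      proof -
        interpret P: finite_borel_measure P by fact
        note [measurable_cong] = P.M_is_borel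
        have p_int: "integrable P (\<lambda>x. p (exp (- x)))"
        proof (rule P.integrable_const_bound [where B = "1 + \<delta>"])
          show "AE x in P. norm (p (exp (- x))) \<le> 1 + \<delta>"
            using P(2)
          proof eventually_elim
            case (elim x)
            then show ?case using approx [of "exp (- x)"] ramp_bound [of j "exp (- x)"] by simp
          qed
        qed (simp add: p_sum)
        have "\<bar>(LINT x|P. ramp j (exp (- x))) - (LINT x|P. p (exp (- x)))\<bar>
            = \<bar>LINT x|P. ramp j (exp (- x)) - p (exp (- x))\<bar>"
          using ramp_int [OF P(1)] p_int by simp
        also have "\<dots> \<le> (LINT x|P. \<bar>ramp j (exp (- x)) - p (exp (- x))\<bar>)"
          by (rule integral_abs_bound)
        also have "\<dots> \<le> (LINT x|P. \<delta>)"
        proof (rule integral_mono_AE)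
          show "AE x in P. \<bar>ramp j (exp (- x)) - p (exp (- x))\<bar> \<le> \<delta>"
            using P(2)
          proof eventually_elim
            case (elim x)
            then show ?case using approx [of "exp (- x)"] by simp
          qed
        qed (use ramp_int [OF P(1)] p_int in auto)
        finally show ?thesis by (simp add: mult.commute)
      qed
      have "(LINT x|M. p (exp (- x))) = (LINT x|N. p (exp (- x)))"
        unfolding p_sum
        by (rule laplace_transform_determines_polynomial_integrals) (use M N eq in auto)
      then have "\<bar>(LINT x|M. ramp j (exp (- x))) - (LINT x|N. ramp j (exp (- x)))\<bar>
          \<le> \<delta> * measure M (space M) + \<delta> * measure N (space N)"
        using bound [OF M] bound [OF N] by linarith
      also have "\<dots> \<le> \<delta> * C"
        using \<delta> by (simp add: C_def algebra_simps)
      also have "\<dots> = e" using C by (simp add: \<delta>_def)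
      finally show ?thesis .
    qed
    have "\<bar>(LINT x|M. ramp j (exp (- x))) - (LINT x|N. ramp j (exp (- x)))\<bar> \<le> 0"
      by (rule field_le_epsilon) (use close in auto)
    then show ?thesis by simp
  qed
  have lim: "(\<lambda>j. LINT x|P. ramp j (exp (- x))) \<longlonglongrightarrow> cdf P a"
    if P: "finite_borel_measure P" for P
  proof -
    interpret P: finite_borel_measure P by fact
    note [measurable_cong] = P.M_is_borel
    have "(\<lambda>j. LINT x|P. ramp j (exp (- x))) \<longlonglongrightarrow> (LINT x|P. indicator {..a} x)"
    proof (rule integral_dominated_convergence [where w = "\<lambda>_. 1"])
      show "AE x in P. (\<lambda>j. ramp j (exp (- x))) \<longlonglongrightarrow> indicator {..a} x"
      proof (rule AE_I2)
        fix x :: real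
        show "(\<lambda>j. ramp j (exp (- x))) \<longlonglongrightarrow> indicator {..a} x"
        proof (cases "x \<le> a")
          case True
          then have "ramp j (exp (- x)) = 1" for j by (simp add: ramp_def)
          then show ?thesis using True by simp
        next
          case False
          then have pos: "0 < exp (- a) - exp (- x)" by simp
          have "ramp j (exp (- x)) = 0" if "1 / (exp (- a) - exp (- x)) \<le> real j" for j
          proof -
            have "1 \<le> real j * (exp (- a) - exp (- x))"
              using that pos by (simp add: field_simps)
            then show ?thesis by (simp add: ramp_def algebra_simps)
          qed
          then have "eventually (\<lambda>j. ramp j (exp (- x)) = 0) sequentially"
            using eventually_ge_at_top [of "nat \<lceil>1 / (exp (- a) - exp (- x))\<rceil>"]
            by (auto elim!: eventually_mono simp: nat_ceiling_le_eq)
          then show ?thesis using False by (simp add: tendsto_eventually)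
        qed
      qed
    qed (auto simp: ramp_bound)
    then show ?thesis by (simp add: cdf_def)
  qed
  show "cdf M a = cdf N a"
    using lim [OF M(1)] lim [OF N(1)] unfolding ramp_eq by (rule LIMSEQ_unique)
qed

text \<open>The density \<open>exp (- x) f x\<close> has finite mass even if \<open>f\<close> has not, and its transform at \<open>k\<close> is that
of \<open>f\<close> at \<open>1 + k\<close>.\<close>

lemma nn_laplace_transform_unique:
  fixes f g :: "real \<Rightarrow> ennreal"
  assumes [measurable]: "f \<in> borel_measurable borel" "g \<in> borel_measurable borel"
    and eq: "\<And>\<theta>. \<theta> > 0 \<Longrightarrow>
      (\<integral>\<^sup>+x. ennreal (exp (- \<theta> * x)) * f x * indicator {0..} x \<partial>lborel) =
      (\<integral>\<^sup>+x. ennreal (exp (- \<theta> * x)) * g x * indicator {0..} x \<partial>lborel)"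
    and fin: "\<And>\<theta>. \<theta> > 0 \<Longrightarrow>
      (\<integral>\<^sup>+x. ennreal (exp (- \<theta> * x)) * g x * indicator {0..} x \<partial>lborel) < \<infinity>"
  shows "AE x in lborel. 0 \<le> x \<longrightarrow> f x = g x"
proof -
  define D where "D h = density lborel (\<lambda>x. ennreal (exp (- x)) * h x * indicator {0..} x)"
    for h :: "real \<Rightarrow> ennreal"
  have D_exp: "(\<integral>\<^sup>+x. ennreal (exp (- real k * x)) \<partial>D h) =
      (\<integral>\<^sup>+x. ennreal (exp (- (1 + real k) * x)) * h x * indicator {0..} x \<partial>lborel)"
    if [measurable]: "h \<in> borel_measurable borel" for k :: nat and h
  proof -
    have "ennreal (exp (- (1 + real k) * x)) = ennreal (exp (- x)) * ennreal (exp (- real k * x))" for x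
      by (simp add: ennreal_mult' [symmetric] exp_add [symmetric] algebra_simps)
    then show ?thesis
      unfolding D_def by (subst nn_integral_density) (auto intro!: nn_integral_cong simp: mult_ac)
  qed
  have D_meas: "(\<lambda>x. exp (- (real k * x))) \<in> borel_measurable (D h)" for k :: nat and h
    unfolding D_def by simp
  have D: "finite_borel_measure (D h)" "AE x in D h. 0 \<le> x"
    if [measurable]: "h \<in> borel_measurable borel" and "h = f \<or> h = g" for h
  proof -
    have "emeasure (D h) (space (D h)) = (\<integral>\<^sup>+x. ennreal (exp (- real 0 * x)) \<partial>D h)"
      by simp
    also have "\<dots> < \<infinity>"
      using fin [of 1] eq [of 1] that(2) by (subst D_exp) auto
    finally have "finite_measure (D h)"
      by (intro finite_measureI) auto
    then show "finite_borel_measure (D h)"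
      by (auto simp: finite_borel_measure_def finite_borel_measure_axioms_def D_def)
    show "AE x in D h. 0 \<le> x"
      unfolding D_def by (subst AE_density) (auto simp: indicator_def)
  qed
  have "D f = D g"
  proof (rule finite_measure_eqI_laplace)
    fix k :: nat
    show "(LINT x|D f. exp (- real k * x)) = (LINT x|D g. exp (- real k * x))"
      using eq [of "1 + real k"] D_exp [of f k] D_exp [of g k]
      by (subst (1 2) integral_eq_nn_integral) (simp_all add: D_meas)
  qed (use D in auto)
  then have "AE x in lborel. ennreal (exp (- x)) * f x * indicator {0..} x
      = ennreal (exp (- x)) * g x * indicator {0..} x"
    unfolding D_def by (subst (asm) sigma_finite_measure.density_unique_iff [OF sigma_finite_lborel]) auto
  then show ?thesis
    by eventually_elim (auto simp: indicator_def ennreal_mult_cancel_left)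
qed

section \<open>Infinitely divisible laws on the half-line\<close>

text \<open>Markov's inequality for \<open>1 - exp (- x / b)\<close>, which exceeds \<open>1 / 2\<close> on the tail.\<close>

lemma measure_tail_le_laplace:
  fixes \<mu> :: "real measure"
  assumes "real_distribution \<mu>" "AE x in \<mu>. 0 \<le> x" "0 < b"
  shows "measure \<mu> {b<..} \<le> 2 * (1 - (LINT x|\<mu>. exp (- x / b)))"
proof -
  interpret real_distribution \<mu> by fact
  note [measurable_cong] = M_is_borel
  have int: "integrable \<mu> (\<lambda>x. exp (- x / b))"
  proof (rule integrable_const_bound [where B = 1])
    show "AE x in \<mu>. norm (exp (- x / b)) \<le> 1"
      using assms(2) by eventually_elim (use assms(3) in auto)
  qed simp
  have int': "integrable \<mu> (\<lambda>x. (1 / 2) * indicator {b<..} x :: real)"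
    by (rule integrable_const_bound [where B = 1]) (simp_all add: indicator_def)
  have "(1 / 2) * measure \<mu> {b<..} = (LINT x|\<mu>. (1 / 2) * indicator {b<..} x)"
    by simp
  also have "\<dots> \<le> (LINT x|\<mu>. 1 - exp (- x / b))"
  proof (rule integral_mono_AE)
    show "AE x in \<mu>. (1 / 2) * indicator {b<..} x \<le> 1 - exp (- x / b)"
      using assms(2)
    proof eventually_elim
      case (elim x)
      show ?case
      proof (cases "b < x")
        case True
        then have "exp (- x / b) \<le> exp (- 1)" using assms(3) by (simp add: field_simps)
        also have "exp (- 1) \<le> (1 / 2 :: real)"
          using exp_ge_add_one_self [of 1] by (simp add: exp_minus field_simps)
        finally show ?thesis using True by simp
      next
        case False
        then show ?thesis using elim assms(3) by simp
      qed
    qed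
  qed (rule int', use int in simp)
  also have "\<dots> = 1 - (LINT x|\<mu>. exp (- x / b))"
    using int prob_space by simp
  finally show ?thesis by simp
qed

text \<open>The linear bound controls the transforms near the origin uniformly in \<open>n\<close>. This is tightness, and
Helly's theorem gives a limit along a subsequence. The transform of the limit does not depend on the
subsequence, as \<open>exp (- \<theta> x)\<close>, cut off to the left of the origin, is a bounded continuous function.\<close>

theorem laplace_continuity:
  fixes \<mu> :: "nat \<Rightarrow> real measure" and L :: "real \<Rightarrow> real"
  assumes \<mu>: "\<And>n. real_distribution (\<mu> n)" "\<And>n. AE x in \<mu> n. 0 \<le> x"
    and lim: "\<And>\<theta>. \<theta> > 0 \<Longrightarrow> (\<lambda>n. LINT x|\<mu> n. exp (- \<theta> * x)) \<longlonglongrightarrow> L \<theta>"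
    and bound: "\<And>\<theta> n. \<theta> > 0 \<Longrightarrow> 1 - (LINT x|\<mu> n. exp (- \<theta> * x)) \<le> C * \<theta>"
  obtains \<nu> where "real_distribution \<nu>" "AE x in \<nu>. 0 \<le> x"
    "\<And>\<theta>. \<theta> > 0 \<Longrightarrow> (LINT x|\<nu>. exp (- \<theta> * x)) = L \<theta>"
proof -
  interpret \<mu>: real_distribution "\<mu> n" for n by fact
  note [measurable_cong] = \<mu>.M_is_borel
  have "tight \<mu>"
    unfolding tight_def
  proof (intro conjI allI impI)
    fix \<epsilon> :: real assume "\<epsilon> > 0"
    \<comment> \<open>Large enough for the tail bound \<open>2 C / b\<close> to fall below \<open>\<epsilon>\<close>; the added one keeps it positive.\<close>
    define b where "b = 2 * (\<bar>C\<bar> + 1) / \<epsilon> + 1"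
    have b: "b > 0" using \<open>\<epsilon> > 0\<close> by (simp add: b_def add_nonneg_pos)
    have "1 - \<epsilon> < measure (\<mu> n) {-1<..b}" for n
    proof -
      have "AE x in \<mu> n. x \<notin> {..-1}" using \<mu>(2) [of n] by eventually_elim auto
      then have "measure (\<mu> n) {..-1} = 0"
        by (subst \<mu>.prob_eq_0) auto
      moreover have "measure (\<mu> n) ({..-1} \<union> {-1<..b} \<union> {b<..})
          \<le> measure (\<mu> n) ({..-1} \<union> {-1<..b}) + measure (\<mu> n) {b<..}"
        by (rule measure_Un_le) auto
      moreover have "measure (\<mu> n) ({..-1} \<union> {-1<..b})
          \<le> measure (\<mu> n) {..-1} + measure (\<mu> n) {-1<..b}"
        by (rule measure_Un_le) auto
      moreover have "measure (\<mu> n) ({..-1} \<union> {-1<..b} \<union> {b<..}) = 1"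
      proof -
        have "{..-1} \<union> {-1<..b} \<union> {b<..} = space (\<mu> n)"
          using b by auto
        then show ?thesis using \<mu>.prob_space by metis
      qed
      moreover have "measure (\<mu> n) {b<..} \<le> 2 * (C * (1 / b))"
        using measure_tail_le_laplace [OF \<mu>(1) \<mu>(2) b, of n] bound [of "1 / b" n] b by simp
      moreover have "2 * (C * (1 / b)) < \<epsilon>"
      proof -
        have "2 * C \<le> 2 * (\<bar>C\<bar> + 1)" by simp
        also have "\<dots> < \<epsilon> * b" using \<open>\<epsilon> > 0\<close> by (simp add: b_def field_simps)
        finally show ?thesis using b by (simp add: field_simps)
      qed
      ultimately show ?thesis by linarith
    qed
    then show "\<exists>a b. a < b \<and> (\<forall>n. 1 - \<epsilon> < measure (\<mu> n) {a<..b})"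
      using b by (intro exI [of _ "-1"] exI [of _ b]) auto
  qed (rule \<mu>)
  from tight_imp_convergent_subsubsequence [OF this, of id]
  obtain r \<nu> where r: "strict_mono (r :: nat \<Rightarrow> nat)" and \<nu>: "real_distribution \<nu>"
    and conv: "weak_conv_m (\<lambda>n. \<mu> (r n)) \<nu>"
    by (auto simp: strict_mono_def comp_def id_def)
  interpret \<nu>: real_distribution \<nu> by fact
  note [measurable_cong] = \<nu>.M_is_borel
  have test: "(\<lambda>n. LINT x|\<mu> (r n). f x) \<longlonglongrightarrow> (LINT x|\<nu>. f x)"
    if "\<And>x. isCont f x" "\<And>x. norm (f x) \<le> 1" for f :: "real \<Rightarrow> real"
    by (rule weak_conv_imp_integral_bdd_continuous_conv [OF _ \<nu> conv that(1) that(2)]) (rule \<mu>)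
  \<comment> \<open>The negative part, truncated to be a test function, has integral zero in the limit.\<close>
  have "(\<lambda>n. LINT x|\<mu> (r n). min 1 (max 0 (- x))) \<longlonglongrightarrow> (LINT x|\<nu>. min 1 (max 0 (- x)))"
    by (rule test) (auto intro!: continuous_intros)
  moreover have "(LINT x|\<mu> (r n). min 1 (max 0 (- x))) = 0" for n
  proof (rule integral_eq_zero_AE)
    show "AE x in \<mu> (r n). min 1 (max 0 (- x)) = 0"
      using \<mu>(2) [of "r n"] by eventually_elim (simp add: max_def)
  qed
  ultimately have "(\<lambda>n::nat. 0) \<longlonglongrightarrow> (LINT x|\<nu>. min 1 (max 0 (- x)))"
    by (simp only:)
  then have "(LINT x|\<nu>. min 1 (max 0 (- x))) = 0"
    by (simp add: LIMSEQ_const_iff)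
  moreover have "integrable \<nu> (\<lambda>x. min 1 (max 0 (- x)))"
    by (rule \<nu>.integrable_const_bound [where B = 1]) auto
  ultimately have "AE x in \<nu>. min 1 (max 0 (- x)) = 0"
    by (subst (asm) integral_nonneg_eq_0_iff_AE) auto
  then have pos: "AE x in \<nu>. 0 \<le> x"
    by eventually_elim (auto simp: min_def max_def split: if_splits)
  have "(LINT x|\<nu>. exp (- \<theta> * x)) = L \<theta>" if "\<theta> > 0" for \<theta>
  proof -
    have cut: "(LINT x|P. exp (- \<theta> * max 0 x)) = (LINT x|P. exp (- \<theta> * x))"
      if "AE x in P. 0 \<le> x" "sets P = sets borel" for P
    proof (rule integral_cong_AE)
      show "AE x in P. exp (- \<theta> * max 0 x) = exp (- \<theta> * x)"
        using that(1) by eventually_elim simp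
    qed (use that(2) in \<open>simp_all cong: measurable_cong_sets\<close>)
    have "(\<lambda>n. LINT x|\<mu> (r n). exp (- \<theta> * max 0 x)) \<longlonglongrightarrow> (LINT x|\<nu>. exp (- \<theta> * max 0 x))"
      by (rule test) (use that in \<open>auto intro!: continuous_intros\<close>)
    then have "(\<lambda>n. LINT x|\<mu> (r n). exp (- \<theta> * x)) \<longlonglongrightarrow> (LINT x|\<nu>. exp (- \<theta> * x))"
      using cut pos \<mu>(2) by simp
    moreover have "(\<lambda>n. LINT x|\<mu> (r n). exp (- \<theta> * x)) \<longlonglongrightarrow> L \<theta>"
      using LIMSEQ_subseq_LIMSEQ [OF lim [OF that] r] by (simp add: comp_def)
    ultimately show ?thesis by (rule LIMSEQ_unique)
  qed
  with \<nu> pos show thesis by (rule that)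
qed

definition iid_sum :: "real measure \<Rightarrow> nat \<Rightarrow> real measure" where
  "iid_sum \<nu> n = distr (Pi\<^sub>M {..<n} (\<lambda>_. \<nu>)) borel (\<lambda>x. \<Sum>i<n. x i)"

lemma
  fixes \<nu> :: "real measure"
  assumes \<nu>: "real_distribution \<nu>" "AE x in \<nu>. 0 \<le> x"
  shows real_distribution_iid_sum: "real_distribution (iid_sum \<nu> n)"
    and iid_sum_nonneg: "AE x in iid_sum \<nu> n. 0 \<le> x"
    and laplace_iid_sum: "\<theta> > 0 \<Longrightarrow>
      (LINT x|iid_sum \<nu> n. exp (- \<theta> * x)) = (LINT x|\<nu>. exp (- \<theta> * x)) ^ n"
proof -
  interpret \<nu>: real_distribution \<nu> by fact
  note [measurable_cong] = \<nu>.M_is_borel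
  interpret P: product_prob_space "\<lambda>_. \<nu>" "{..<n}" by unfold_locales
  have [measurable]: "(\<lambda>x. \<Sum>i<n. x i) \<in> borel_measurable (Pi\<^sub>M {..<n} (\<lambda>_. \<nu>))"
    by measurable
  show "real_distribution (iid_sum \<nu> n)"
    unfolding iid_sum_def by (rule P.real_distribution_distr) simp
  have "AE x in Pi\<^sub>M {..<n} (\<lambda>_. \<nu>). \<forall>i\<in>{..<n}. 0 \<le> x i"
    by (rule eventually_ball_finite, simp, rule ballI, rule AE_PiM_component)
      (use \<nu>(2) \<nu>.prob_space_axioms in auto)
  then have "AE x in Pi\<^sub>M {..<n} (\<lambda>_. \<nu>). 0 \<le> (\<Sum>i<n. x i)"
    by eventually_elim (auto intro: sum_nonneg)
  then show "AE x in iid_sum \<nu> n. 0 \<le> x"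
    unfolding iid_sum_def by (subst AE_distr_iff) auto
  assume \<theta>: "\<theta> > 0"
  have int: "integrable \<nu> (\<lambda>x. exp (- \<theta> * x))"
  proof (rule \<nu>.integrable_const_bound [where B = 1])
    show "AE x in \<nu>. norm (exp (- \<theta> * x)) \<le> 1"
      using \<nu>(2) by eventually_elim (use \<theta> in auto)
  qed simp
  have "(LINT x|iid_sum \<nu> n. exp (- \<theta> * x)) =
      (LINT x|Pi\<^sub>M {..<n} (\<lambda>_. \<nu>). (\<Prod>i<n. exp (- \<theta> * x i)))"
    unfolding iid_sum_def
    by (subst integral_distr) (simp_all add: exp_sum [symmetric] sum_distrib_left)
  also have "\<dots> = (\<Prod>i<n. LINT x|\<nu>. exp (- \<theta> * x))"
    by (rule P.product_integral_prod) (use int in auto)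
  finally show "(LINT x|iid_sum \<nu> n. exp (- \<theta> * x)) = (LINT x|\<nu>. exp (- \<theta> * x)) ^ n"
    by simp
qed

text \<open>\<open>Q\<close> is the law of a variable that equals \<open>X\<close> with conditional probability \<open>p X\<close> and \<open>0\<close>
otherwise, where \<open>X\<close> has law \<open>K\<close>.\<close>

lemma thinning_exists:
  fixes K :: "real measure" and p :: "real \<Rightarrow> real"
  assumes K: "real_distribution K"
    and [measurable]: "p \<in> borel_measurable borel" and p: "\<And>x. 0 \<le> p x" "\<And>x. p x \<le> 1"
  obtains Q where "real_distribution Q"
    "\<And>f. f \<in> borel_measurable borel \<Longrightarrow>
      (\<integral>\<^sup>+x. f x \<partial>Q) = (\<integral>\<^sup>+x. ennreal (p x) * f x + ennreal (1 - p x) * f 0 \<partial>K)"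
proof -
  interpret K: real_distribution K by fact
  note [measurable_cong] = K.M_is_borel
  \<comment> \<open>The Boolean coordinate records whether the value is kept.\<close>
  define w :: "bool \<times> real \<Rightarrow> ennreal" where "w = (\<lambda>(b, x). if b then ennreal (p x) else ennreal (1 - p x))"
  define y :: "bool \<times> real \<Rightarrow> real" where "y = (\<lambda>(b, x). if b then x else 0)"
  define B where "B = count_space (UNIV :: bool set) \<Otimes>\<^sub>M K"
  define Q where "Q = distr (density B w) borel y"
  have [measurable]: "w \<in> borel_measurable B" "y \<in> borel_measurable B"
    unfolding w_def y_def B_def by measurable
  interpret B: sigma_finite_measure "count_space (UNIV :: bool set)"
    by (rule sigma_finite_measure_count_space_finite) simp
  interpret B: pair_sigma_finite "count_space (UNIV :: bool set)" K ..
  have Q: "(\<integral>\<^sup>+x. f x \<partial>Q) = (\<integral>\<^sup>+x. ennreal (p x) * f x + ennreal (1 - p x) * f 0 \<partial>K)"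
    if [measurable]: "f \<in> borel_measurable borel" for f
  proof -
    have [measurable]: "(\<lambda>z. w z * f (y z)) \<in> borel_measurable (count_space (UNIV :: bool set) \<Otimes>\<^sub>M K)"
      unfolding B_def [symmetric] by measurable
    have "(\<integral>\<^sup>+x. f x \<partial>Q) = (\<integral>\<^sup>+z. w z * f (y z) \<partial>B)"
      unfolding Q_def by (simp add: nn_integral_distr nn_integral_density)
    also have "\<dots> = (\<integral>\<^sup>+b. \<integral>\<^sup>+x. w (b, x) * f (y (b, x)) \<partial>K \<partial>count_space UNIV)"
      unfolding B_def by (rule K.nn_integral_fst [symmetric]) simp
    also have "\<dots> = (\<integral>\<^sup>+x. ennreal (p x) * f x \<partial>K) + (\<integral>\<^sup>+x. ennreal (1 - p x) * f 0 \<partial>K)"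
      by (simp add: nn_integral_count_space_finite UNIV_bool w_def y_def add.commute)
    also have "\<dots> = (\<integral>\<^sup>+x. ennreal (p x) * f x + ennreal (1 - p x) * f 0 \<partial>K)"
      by (rule nn_integral_add [symmetric]) auto
    finally show ?thesis .
  qed
  have "emeasure Q (space Q) = (\<integral>\<^sup>+x. 1 \<partial>Q)" by simp
  also have "\<dots> = 1"
    using p by (subst Q) (simp_all add: ennreal_plus [symmetric] K.emeasure_space_1 [simplified] del: ennreal_plus)
  finally have "real_distribution Q"
    by (intro real_distribution.intro prob_spaceI real_distribution_axioms.intro) (simp_all add: Q_def)
  with Q show thesis by (intro that)
qed

text \<open>The index is shifted by one so that the array starts with a single summand.\<close>

lemma power_one_minus_tendsto_exp:
  fixes c :: "nat \<Rightarrow> real"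
  assumes "c \<longlonglongrightarrow> L"
  shows "(\<lambda>m. (1 - c m / real (Suc m)) ^ Suc m) \<longlonglongrightarrow> exp (- L)"
proof -
  have small: "(\<lambda>m. c m / real (Suc m)) \<longlonglongrightarrow> 0"
    using tendsto_mult [OF assms LIMSEQ_inverse_real_of_nat] by (simp add: divide_inverse)
  have sm: "eventually (\<lambda>m. \<bar>c m / real (Suc m)\<bar> < 1 / 2) sequentially"
    using tendsto_rabs [OF small] by (rule order_tendstoD(2)) simp
  have "(\<lambda>m. real (Suc m) * ln (1 - c m / real (Suc m)) + c m) \<longlonglongrightarrow> 0"
  proof (rule Lim_null_comparison)
    show "eventually (\<lambda>m. norm (real (Suc m) * ln (1 - c m / real (Suc m)) + c m)
        \<le> 2 * (\<bar>c m\<bar> * \<bar>c m / real (Suc m)\<bar>)) sequentially"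
      using sm
    proof eventually_elim
      case (elim m)
      define u where "u = c m / real (Suc m)"
      have "\<bar>ln (1 + - u) - - u\<bar> \<le> 2 * (- u)\<^sup>2"
        by (rule abs_ln_one_plus_x_minus_x_bound) (use elim in \<open>simp add: u_def\<close>)
      then have "\<bar>ln (1 - u) + u\<bar> \<le> 2 * u\<^sup>2" by simp
      then have "real (Suc m) * \<bar>ln (1 - u) + u\<bar> \<le> real (Suc m) * (2 * u\<^sup>2)"
        by (rule mult_left_mono) simp
      moreover have "real (Suc m) * ln (1 - u) + c m = real (Suc m) * (ln (1 - u) + u)"
        by (simp add: u_def distrib_left)
      moreover have "real (Suc m) * (2 * u\<^sup>2) = 2 * (\<bar>c m\<bar> * \<bar>u\<bar>)"
      proof -
        have "c m = real (Suc m) * u" by (simp add: u_def)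
        then have "\<bar>c m\<bar> * \<bar>u\<bar> = real (Suc m) * u\<^sup>2"
          by (simp add: abs_mult power2_eq_square)
        then show ?thesis by simp
      qed
      ultimately show ?case
        unfolding u_def [symmetric] real_norm_def by (simp only: abs_mult abs_of_nat)
    qed
    have "(\<lambda>m. 2 * (\<bar>c m\<bar> * \<bar>c m / real (Suc m)\<bar>)) \<longlonglongrightarrow> 2 * (\<bar>L\<bar> * \<bar>0\<bar>)"
      by (intro tendsto_intros assms small)
    then show "(\<lambda>m. 2 * (\<bar>c m\<bar> * \<bar>c m / real (Suc m)\<bar>)) \<longlonglongrightarrow> 0" by simp
  qed
  from tendsto_diff [OF this assms]
  have "(\<lambda>m. exp (real (Suc m) * ln (1 - c m / real (Suc m)))) \<longlonglongrightarrow> exp (- L)"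
    by (intro tendsto_intros) simp
  moreover have "eventually (\<lambda>m. exp (real (Suc m) * ln (1 - c m / real (Suc m)))
      = (1 - c m / real (Suc m)) ^ Suc m) sequentially"
    using sm
  proof eventually_elim
    case (elim m)
    then have "0 < 1 - c m / real (Suc m)" by linarith
    then show ?case by (subst exp_of_nat_mult) simp
  qed
  ultimately show ?thesis by (rule Lim_transform_eventually)
qed

lemma one_minus_exp_le: "1 - exp (- y) \<le> (y :: real)"
  using exp_ge_add_one_self [of "- y"] by simp

text \<open>The approximation with \<open>m\<close> summands adds independent copies of a jump that is distributed as
\<open>K\<close>, kept with probability \<open>min 1 (a / (m x))\<close> and replaced by zero otherwise. One summand has
transform \<open>1 - c m / m\<close>, where \<open>c m\<close> is the integral of \<open>min m (a / x) * (1 - exp (- \<theta> x))\<close>.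
By dominated convergence \<open>c m\<close> tends to the exponent, and \<open>(1 - c m / m)\<^sup>m\<close> to the wanted
transform. The bound \<open>c m \<le> a \<theta>\<close> gives the linear bound of the continuity theorem through
Bernoulli's inequality.\<close>

lemma subordinator_law_exists_prob:
  fixes K :: "real measure" and a :: real
  assumes K: "real_distribution K" "AE x in K. 0 < x" and a: "0 \<le> a"
  obtains \<nu> where "real_distribution \<nu>" "AE x in \<nu>. 0 \<le> x"
    "\<And>\<theta>. \<theta> > 0 \<Longrightarrow>
      (LINT x|\<nu>. exp (- \<theta> * x)) = exp (- a * (LINT x|K. (1 - exp (- \<theta> * x)) / x))"
proof -
  interpret K: real_distribution K by fact
  note [measurable_cong] = K.M_is_borel
  define p where "p m x = max 0 (min 1 (a / (real (Suc m) * x)))" for m :: nat and x :: real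
  have [measurable]: "p m \<in> borel_measurable borel" for m
    unfolding p_def by measurable
  have p: "0 \<le> p m x" "p m x \<le> 1" for m x by (auto simp: p_def)
  define step where "step m = (SOME Q. real_distribution Q \<and>
    (\<forall>f. f \<in> borel_measurable borel \<longrightarrow>
      (\<integral>\<^sup>+x. f x \<partial>Q) = (\<integral>\<^sup>+x. ennreal (p m x) * f x + ennreal (1 - p m x) * f 0 \<partial>K)))" for m
  have "\<exists>Q. real_distribution Q \<and>
    (\<forall>f. f \<in> borel_measurable borel \<longrightarrow>
      (\<integral>\<^sup>+x. f x \<partial>Q) = (\<integral>\<^sup>+x. ennreal (p m x) * f x + ennreal (1 - p m x) * f 0 \<partial>K))" for m
    by (rule thinning_exists [OF K(1), of "p m"]) (use p in auto)
  from someI_ex [OF this] have step: "real_distribution (step m)"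
    and step_int: "\<And>f. f \<in> borel_measurable borel \<Longrightarrow>
      (\<integral>\<^sup>+x. f x \<partial>step m) = (\<integral>\<^sup>+x. ennreal (p m x) * f x + ennreal (1 - p m x) * f 0 \<partial>K)" for m
    unfolding step_def by blast+
  interpret step: real_distribution "step m" for m by (rule step)
  note [measurable_cong] = step.M_is_borel
  have step_pos: "AE x in step m. 0 \<le> x" for m
  proof -
    have "emeasure (step m) {..<0} = (\<integral>\<^sup>+x. indicator {..<0} x \<partial>step m)" by simp
    also have "\<dots> = (\<integral>\<^sup>+x. 0 \<partial>K)"
    proof (subst step_int)
      show "(\<integral>\<^sup>+x. ennreal (p m x) * indicator {..<0} x + ennreal (1 - p m x) * indicator {..<0} (0::real) \<partial>K)
          = (\<integral>\<^sup>+x. 0 \<partial>K)"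
      proof (rule nn_integral_cong_AE)
        show "AE x in K. ennreal (p m x) * indicator {..<0} x + ennreal (1 - p m x) * indicator {..<0} (0::real) = 0"
          using K(2) by eventually_elim simp
      qed
    qed simp
    finally have "emeasure (step m) {..<0} = 0" by simp
    then show ?thesis by (intro AE_I [where N = "{..<0}"]) auto
  qed
  define c where "c \<theta> m = (LINT x|K. real (Suc m) * p m x * (1 - exp (- \<theta> * x)))" for \<theta> m
  have p_le: "real (Suc m) * p m x * (1 - exp (- \<theta> * x)) \<le> a * \<theta>"
    and p_ge: "0 \<le> real (Suc m) * p m x * (1 - exp (- \<theta> * x))"
    if "0 < x" "0 < \<theta>" for m x \<theta>
  proof -
    have e: "0 \<le> 1 - exp (- \<theta> * x)" "1 - exp (- \<theta> * x) \<le> \<theta> * x"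
      using that one_minus_exp_le [of "\<theta> * x"] by auto
    have "p m x \<le> a / (real (Suc m) * x)"
      using a that by (simp add: p_def)
    then have "real (Suc m) * p m x \<le> real (Suc m) * (a / (real (Suc m) * x))"
      by (rule mult_left_mono) simp
    then have "real (Suc m) * p m x \<le> a / x"
      by (simp del: of_nat_Suc)
    then have "real (Suc m) * p m x * (1 - exp (- \<theta> * x)) \<le> a / x * (\<theta> * x)"
      using e a that p by (intro mult_mono) auto
    then show "real (Suc m) * p m x * (1 - exp (- \<theta> * x)) \<le> a * \<theta>" using that by simp
    show "0 \<le> real (Suc m) * p m x * (1 - exp (- \<theta> * x))"
      using e p by simp
  qed
  have step_laplace: "(LINT x|step m. exp (- \<theta> * x)) = 1 - c \<theta> m / real (Suc m)"
    if \<theta>: "\<theta> > 0" for \<theta> m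
  proof -
    have K_int: "integrable K (\<lambda>x. p m x * (1 - exp (- \<theta> * x)))"
    proof (rule K.integrable_const_bound [where B = 1])
      show "AE x in K. norm (p m x * (1 - exp (- \<theta> * x))) \<le> 1"
        using K(2)
      proof eventually_elim
        case (elim x)
        then have "p m x * (1 - exp (- \<theta> * x)) \<le> 1 * 1" "0 \<le> p m x * (1 - exp (- \<theta> * x))"
          using p \<theta> by (intro mult_mono mult_nonneg_nonneg; auto)+
        then show ?case by simp
      qed
    qed simp
    have "(LINT x|step m. exp (- \<theta> * x)) = enn2real (\<integral>\<^sup>+x. ennreal (exp (- \<theta> * x)) \<partial>step m)"
      by (rule integral_eq_nn_integral) auto
    also have "(\<integral>\<^sup>+x. ennreal (exp (- \<theta> * x)) \<partial>step m)
        = (\<integral>\<^sup>+x. ennreal (1 - p m x * (1 - exp (- \<theta> * x))) \<partial>K)"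
      using p by (subst step_int)
        (auto intro!: nn_integral_cong simp: ennreal_mult' [symmetric] ennreal_plus [symmetric] algebra_simps
          simp del: ennreal_plus)
    also have "enn2real \<dots> = (LINT x|K. 1 - p m x * (1 - exp (- \<theta> * x)))"
    proof (rule integral_eq_nn_integral [symmetric])
      show "AE x in K. 0 \<le> 1 - p m x * (1 - exp (- \<theta> * x))"
        using K(2)
      proof eventually_elim
        case (elim x)
        then have "p m x * (1 - exp (- \<theta> * x)) \<le> 1 * 1"
          using p \<theta> by (intro mult_mono) auto
        then show ?case by simp
      qed
    qed simp
    also have "\<dots> = 1 - c \<theta> m / real (Suc m)"
      using K_int K.prob_space by (simp add: c_def mult.assoc del: of_nat_Suc)
    finally show ?thesis .
  qed
  define L where "L \<theta> = exp (- a * (LINT x|K. (1 - exp (- \<theta> * x)) / x))" for \<theta>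
  have c_lim: "c \<theta> \<longlonglongrightarrow> a * (LINT x|K. (1 - exp (- \<theta> * x)) / x)" if \<theta>: "\<theta> > 0" for \<theta>
  proof -
    have "(\<lambda>m. c \<theta> m) \<longlonglongrightarrow> (LINT x|K. a * ((1 - exp (- \<theta> * x)) / x))"
      unfolding c_def
    proof (rule integral_dominated_convergence [where w = "\<lambda>_. a * \<theta>"])
      show "AE x in K. (\<lambda>m. real (Suc m) * p m x * (1 - exp (- \<theta> * x)))
          \<longlonglongrightarrow> a * ((1 - exp (- \<theta> * x)) / x)"
        using K(2)
      proof eventually_elim
        case (elim x)
        have "real (Suc m) * p m x * (1 - exp (- \<theta> * x)) = a * ((1 - exp (- \<theta> * x)) / x)"
          if "a / x \<le> real m" for m
        proof -
          have "a \<le> real (Suc m) * x" using that elim by (simp add: field_simps)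
          then have "p m x = a / (real (Suc m) * x)"
            using a elim by (simp add: p_def del: of_nat_Suc)
          then show ?thesis by (simp del: of_nat_Suc)
        qed
        then have "eventually (\<lambda>m. real (Suc m) * p m x * (1 - exp (- \<theta> * x))
            = a * ((1 - exp (- \<theta> * x)) / x)) sequentially"
          using eventually_ge_at_top [of "nat \<lceil>a / x\<rceil>"]
          by (auto elim!: eventually_mono simp: nat_ceiling_le_eq)
        then show ?case by (rule tendsto_eventually)
      qed
      show "AE x in K. norm (real (Suc m) * p m x * (1 - exp (- \<theta> * x))) \<le> a * \<theta>" for m
        using K(2)
      proof eventually_elim
        case (elim x)
        then show ?case using p_le [of x \<theta> m] p_ge [of x \<theta> m] \<theta> by (simp del: of_nat_Suc)
      qed
    qed auto
    then show ?thesis unfolding integral_mult_right_zero .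
  qed
  have c_bound: "c \<theta> m \<le> a * \<theta>" "0 \<le> c \<theta> m" if \<theta>: "\<theta> > 0" for \<theta> m
  proof -
    show "c \<theta> m \<le> a * \<theta>"
      unfolding c_def
    proof (rule K.integral_le_const)
      show "integrable K (\<lambda>x. real (Suc m) * p m x * (1 - exp (- \<theta> * x)))"
      proof (rule K.integrable_const_bound [where B = "a * \<theta>"])
        show "AE x in K. norm (real (Suc m) * p m x * (1 - exp (- \<theta> * x))) \<le> a * \<theta>"
          using K(2)
        proof eventually_elim
          case (elim x)
          then show ?case using p_le [of x \<theta> m] p_ge [of x \<theta> m] \<theta> by (simp del: of_nat_Suc)
        qed
      qed simp
      show "AE x in K. real (Suc m) * p m x * (1 - exp (- \<theta> * x)) \<le> a * \<theta>"
        using K(2) by eventually_elim (use p_le \<theta> in blast)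
    qed
    show "0 \<le> c \<theta> m"
      unfolding c_def
      by (rule integral_nonneg_AE) (use K(2) in eventually_elim, use p_ge \<theta> in blast)
  qed
  show thesis
  proof (rule laplace_continuity [of "\<lambda>m. iid_sum (step m) (Suc m)" L a])
    fix \<theta> :: real assume \<theta>: "\<theta> > 0"
    have sum_laplace: "(LINT x|iid_sum (step m) (Suc m). exp (- \<theta> * x))
        = (1 - c \<theta> m / real (Suc m)) ^ Suc m" for m
      using laplace_iid_sum [OF step step_pos \<theta>] step_laplace [OF \<theta>] by simp
    show "(\<lambda>m. LINT x|iid_sum (step m) (Suc m). exp (- \<theta> * x)) \<longlonglongrightarrow> L \<theta>"
      unfolding sum_laplace L_def using power_one_minus_tendsto_exp [OF c_lim [OF \<theta>]] by simp
    show "1 - (LINT x|iid_sum (step m) (Suc m). exp (- \<theta> * x)) \<le> a * \<theta>" for m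
    proof -
      have "0 \<le> (LINT x|step m. exp (- \<theta> * x))" by simp
      then have "-1 \<le> - (c \<theta> m / real (Suc m))"
        unfolding step_laplace [OF \<theta>] by linarith
      from Bernoulli_inequality [OF this, of "Suc m"]
      have "1 - c \<theta> m \<le> (1 - c \<theta> m / real (Suc m)) ^ Suc m" by (simp del: of_nat_Suc power_Suc)
      then show ?thesis
        unfolding sum_laplace using c_bound(1) [OF \<theta>, of m] by linarith
    qed
  qed (use real_distribution_iid_sum [OF step step_pos] iid_sum_nonneg [OF step step_pos] that
      in \<open>auto simp: L_def\<close>)
qed

text \<open>The law with Levy measure \<open>K(dx) / x\<close>. Its mean is the mass of \<open>K\<close>, which is why a finite \<open>K\<close>
leads to tight approximations.\<close>

theorem subordinator_law_exists:
  fixes K :: "real measure"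
  assumes K: "finite_borel_measure K" "AE x in K. 0 < x"
  obtains \<nu> where "real_distribution \<nu>" "AE x in \<nu>. 0 \<le> x"
    "\<And>\<theta>. \<theta> > 0 \<Longrightarrow>
      (LINT x|\<nu>. exp (- \<theta> * x)) = exp (- (LINT x|K. (1 - exp (- \<theta> * x)) / x))"
proof -
  interpret K: finite_borel_measure K by fact
  note [measurable_cong] = K.M_is_borel
  define a where "a = measure K (space K)"
  show thesis
  proof (cases "a = 0")
    case True
    then have "AE x in K. False"
      unfolding a_def K.emeasure_eq_measure
      by (intro AE_I [where N = "space K"]) (auto simp: K.emeasure_eq_measure)
    then have "AE x in K. (1 - exp (- \<theta> * x)) / x = 0" for \<theta>
      by eventually_elim simp
    then have "(LINT x|K. (1 - exp (- \<theta> * x)) / x) = 0" for \<theta>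
      by (rule integral_eq_zero_AE)
    then show thesis
      using that [of "return borel 0"]
      by (auto simp: real_distribution_def real_distribution_axioms_def prob_space_return
          AE_return integral_return)
  next
    case False
    then have a: "a > 0" by (simp add: a_def less_le)
    define K1 where "K1 = density K (\<lambda>_. ennreal (1 / a))"
    have "emeasure K1 (space K1) = ennreal (1 / a) * emeasure K (space K)"
      unfolding K1_def by (subst emeasure_density) (auto simp: nn_integral_cmult_indicator)
    also have "\<dots> = 1"
      using a by (simp add: K.emeasure_eq_measure a_def ennreal_mult' [symmetric])
    finally have K1: "real_distribution K1"
      by (intro real_distribution.intro prob_spaceI real_distribution_axioms.intro)
        (simp_all add: K1_def K.M_is_borel)
    have "AE x in K1. 0 < x"
      unfolding K1_def using K(2) by (subst AE_density) auto
    moreover have "(LINT x|K1. (1 - exp (- \<theta> * x)) / x) = (LINT x|K. (1 - exp (- \<theta> * x)) / x) / a" for \<theta>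
    proof -
      have "(LINT x|K1. (1 - exp (- \<theta> * x)) / x) = (LINT x|K. 1 / a * ((1 - exp (- \<theta> * x)) / x))"
        unfolding K1_def using a by (subst integral_density) auto
      then show ?thesis unfolding integral_mult_right_zero by simp
    qed
    moreover obtain \<nu> where "real_distribution \<nu>" "AE x in \<nu>. 0 \<le> x"
      "\<And>\<theta>. \<theta> > 0 \<Longrightarrow> (LINT x|\<nu>. exp (- \<theta> * x)) = exp (- a * (LINT x|K1. (1 - exp (- \<theta> * x)) / x))"
      using subordinator_law_exists_prob [OF K1 \<open>AE x in K1. 0 < x\<close> less_imp_le [OF a]] by blast
    ultimately show thesis
      using a by (intro that [of \<nu>]) simp_all
  qed
qed

section \<open>The branching mechanism and its tail integral\<close>

lemma compensated_exp_le_square: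
  fixes y :: real
  assumes "0 \<le> y"
  shows "exp (- y) - 1 + y \<le> y\<^sup>2"
proof -
  have "exp (- y) \<le> 1 / (1 + y)"
    using exp_ge_add_one_self [of y] assms by (simp add: exp_minus field_simps)
  also have "1 / (1 + y) \<le> 1 - y + y\<^sup>2"
    using assms by (simp add: field_simps power2_eq_square)
  finally show ?thesis by simp
qed

locale branching =
  fixes \<alpha> \<sigma> :: real and \<pi> :: "real measure"
  assumes admissible: "admissible \<alpha> \<sigma> \<pi>"
begin

abbreviation "\<psi> \<equiv> branching_mechanism \<alpha> \<sigma> \<pi>"

text \<open>The contribution of the jumps to the derivative of the branching mechanism.\<close>

definition jump_part :: "real \<Rightarrow> real" where
  "jump_part \<theta> = (LINT r|\<pi>. r * (1 - exp (- \<theta> * r)))"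

lemma alpha_nonneg: "0 \<le> \<alpha>" and sigma_nonneg: "0 \<le> \<sigma>"
  and sets_pi [measurable_cong]: "sets \<pi> = sets (restrict_space borel {0<..})"
  and min_integrable: "integrable \<pi> (\<lambda>r. min r (r\<^sup>2))"
  and psi_at_top: "filterlim \<psi> at_top at_top"
  using admissible by (auto simp: admissible_def)

lemma space_pi [simp]: "space \<pi> = {0<..}"
  using sets_eq_imp_space_eq [OF sets_pi] by (simp add: space_restrict_space)

lemma borel_measurable_pi [measurable (raw)]:
  "f \<in> borel_measurable borel \<Longrightarrow> f \<in> borel_measurable \<pi>"
  by (simp cong: measurable_cong_sets add: sets_pi measurable_restrict_space1)

text \<open>The measure \<open>\<pi>\<close> lives on the trace of the Borel sets on the half-line; this rule reduces joint
measurability to Borel functions on the line.\<close>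

lemma measurable_pair_pi:
  assumes "f \<in> borel_measurable (N \<Otimes>\<^sub>M borel)"
  shows "f \<in> borel_measurable (N \<Otimes>\<^sub>M \<pi>)"
proof -
  have "(\<lambda>z. (fst z, snd z)) \<in> measurable (N \<Otimes>\<^sub>M \<pi>) (N \<Otimes>\<^sub>M borel)"
    by (rule measurable_Pair [OF measurable_fst])
      (rule measurable_compose [OF measurable_snd], rule borel_measurable_pi, simp)
  from measurable_compose [OF this assms] show ?thesis by simp
qed

lemma AE_pi_pos: "AE r in \<pi>. 0 < r"
  by (rule AE_I2) simp

sublocale pi: sigma_finite_measure \<pi>
proof
  \<comment> \<open>The set where the integrable function is bounded below has finite measure.\<close>
  define A where "A n = {r \<in> space \<pi>. 1 / real (Suc n) \<le> min r (r\<^sup>2)}" for n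
  have [measurable]: "A n \<in> sets \<pi>" for n unfolding A_def by measurable
  have fin: "(\<integral>\<^sup>+r. ennreal (min r (r\<^sup>2)) \<partial>\<pi>) < \<infinity>"
  proof -
    have "(\<integral>\<^sup>+r. ennreal (min r (r\<^sup>2)) \<partial>\<pi>) = ennreal (LINT r|\<pi>. min r (r\<^sup>2))"
      by (rule nn_integral_eq_integral [OF min_integrable]) (rule AE_I2, simp)
    then show ?thesis by simp
  qed
  have "emeasure \<pi> (A n) \<noteq> \<infinity>" for n
  proof -
    have "emeasure \<pi> (A n) = (\<integral>\<^sup>+r. indicator (A n) r \<partial>\<pi>)" by simp
    also have "\<dots> \<le> (\<integral>\<^sup>+r. ennreal (real (Suc n)) * ennreal (min r (r\<^sup>2)) \<partial>\<pi>)"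
    proof (rule nn_integral_mono)
      fix r assume "r \<in> space \<pi>"
      show "indicator (A n) r \<le> ennreal (real (Suc n)) * ennreal (min r (r\<^sup>2))"
      proof (cases "r \<in> A n")
        case True
        then have "1 / real (Suc n) \<le> min r (r\<^sup>2)" by (simp only: A_def mem_Collect_eq)
        then have "1 \<le> real (Suc n) * min r (r\<^sup>2)"
          by (subst (asm) pos_divide_le_eq) (simp_all add: mult.commute)
        then show ?thesis using True \<open>r \<in> space \<pi>\<close>
          by (simp add: ennreal_mult [symmetric] del: of_nat_Suc)
      qed simp
    qed
    also have "\<dots> = ennreal (real (Suc n)) * (\<integral>\<^sup>+r. ennreal (min r (r\<^sup>2)) \<partial>\<pi>)"
      by (rule nn_integral_cmult) simp
    also have "\<dots> < \<infinity>" using fin by (simp add: ennreal_mult_less_top)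
    finally show ?thesis by simp
  qed
  moreover have "(\<Union>n. A n) = space \<pi>"
  proof (intro equalityI subsetI)
    fix r assume r: "r \<in> space \<pi>"
    then have "0 < min r (r\<^sup>2)" by simp
    then obtain n where "inverse (real (Suc n)) < min r (r\<^sup>2)"
      using reals_Archimedean by blast
    then have "r \<in> A n" using r by (simp add: A_def inverse_eq_divide)
    then show "r \<in> (\<Union>n. A n)" by blast
  qed (auto simp: A_def)
  ultimately show "\<exists>A. countable A \<and> A \<subseteq> sets \<pi> \<and> \<Union> A = space \<pi> \<and> (\<forall>a\<in>A. emeasure \<pi> a \<noteq> \<infinity>)"
    by (intro exI [of _ "range A"]) auto
qed

lemma compensated_kernel_nonneg: "0 \<le> exp (- \<theta> * r) - 1 + \<theta> * r" for \<theta> r :: real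
  using exp_ge_add_one_self [of "- \<theta> * r"] by simp

lemma compensated_kernel_le:
  fixes \<theta> r :: real
  assumes "0 \<le> \<theta>" "0 < r"
  shows "exp (- \<theta> * r) - 1 + \<theta> * r \<le> max \<theta> (\<theta>\<^sup>2) * min r (r\<^sup>2)"
proof -
  have "exp (- \<theta> * r) - 1 + \<theta> * r \<le> \<theta> * r" using assms by simp
  moreover have "exp (- \<theta> * r) - 1 + \<theta> * r \<le> \<theta>\<^sup>2 * r\<^sup>2"
    using compensated_exp_le_square [of "\<theta> * r"] assms by (simp add: power_mult_distrib)
  moreover have "\<theta> * r \<le> max \<theta> (\<theta>\<^sup>2) * r" "\<theta>\<^sup>2 * r\<^sup>2 \<le> max \<theta> (\<theta>\<^sup>2) * r\<^sup>2"
    using assms by (auto intro!: mult_right_mono)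
  ultimately show ?thesis
    by (auto simp only: min_def split: if_splits)
qed

lemma jump_kernel_le:
  fixes \<theta> r T :: real
  assumes "0 \<le> \<theta>" "\<theta> \<le> T" "0 < r"
  shows "r * (1 - exp (- \<theta> * r)) \<le> max 1 T * min r (r\<^sup>2)" "0 \<le> r * (1 - exp (- \<theta> * r))"
proof -
  have "1 - exp (- \<theta> * r) \<le> 1" "1 - exp (- \<theta> * r) \<le> \<theta> * r"
    using exp_ge_add_one_self [of "- \<theta> * r"] by auto
  then have "r * (1 - exp (- \<theta> * r)) \<le> r * 1" "r * (1 - exp (- \<theta> * r)) \<le> r * (\<theta> * r)"
    using assms by (auto intro!: mult_left_mono)
  moreover have "1 * r \<le> max 1 T * r" "\<theta> * r\<^sup>2 \<le> max 1 T * r\<^sup>2"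
    using assms by (auto intro!: mult_right_mono)
  ultimately show "r * (1 - exp (- \<theta> * r)) \<le> max 1 T * min r (r\<^sup>2)"
    by (simp add: min_def power2_eq_square mult_ac)
  show "0 \<le> r * (1 - exp (- \<theta> * r))" using assms by simp
qed

lemma compensated_integrable:
  assumes "0 \<le> \<theta>"
  shows "integrable \<pi> (\<lambda>r. exp (- \<theta> * r) - 1 + \<theta> * r)"
proof (rule Bochner_Integration.integrable_bound)
  show "integrable \<pi> (\<lambda>r. max \<theta> (\<theta>\<^sup>2) * min r (r\<^sup>2))" using min_integrable by simp
  show "AE r in \<pi>. norm (exp (- \<theta> * r) - 1 + \<theta> * r) \<le> norm (max \<theta> (\<theta>\<^sup>2) * min r (r\<^sup>2))"
  proof (rule AE_I2)
    fix r assume "r \<in> space \<pi>"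
    then show "norm (exp (- \<theta> * r) - 1 + \<theta> * r) \<le> norm (max \<theta> (\<theta>\<^sup>2) * min r (r\<^sup>2))"
      using compensated_kernel_le [OF assms, of r] compensated_kernel_nonneg [of \<theta> r]
      using assms by (simp add: abs_mult max_def)
  qed
qed simp

lemma jump_integrable:
  assumes "0 \<le> \<theta>"
  shows "integrable \<pi> (\<lambda>r. r * (1 - exp (- \<theta> * r)))"
proof (rule Bochner_Integration.integrable_bound)
  show "integrable \<pi> (\<lambda>r. max 1 \<theta> * min r (r\<^sup>2))" using min_integrable by simp
  show "AE r in \<pi>. norm (r * (1 - exp (- \<theta> * r))) \<le> norm (max 1 \<theta> * min r (r\<^sup>2))"
  proof (rule AE_I2)
    fix r assume "r \<in> space \<pi>"
    then show "norm (r * (1 - exp (- \<theta> * r))) \<le> norm (max 1 \<theta> * min r (r\<^sup>2))"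
      using jump_kernel_le [OF assms order_refl, of r] by simp
  qed
qed simp

lemma jump_part_nonneg: "0 \<le> \<theta> \<Longrightarrow> 0 \<le> jump_part \<theta>"
  unfolding jump_part_def by (rule integral_nonneg_AE) (auto intro!: AE_I2)

lemma jump_part_continuous: "continuous_on {0..T} jump_part"
proof (rule continuous_on_sequentiallyI)
  fix u :: "nat \<Rightarrow> real" and \<theta> assume u: "\<forall>n. u n \<in> {0..T}" "\<theta> \<in> {0..T}" "u \<longlonglongrightarrow> \<theta>"
  show "(\<lambda>n. jump_part (u n)) \<longlonglongrightarrow> jump_part \<theta>"
    unfolding jump_part_def
  proof (rule integral_dominated_convergence [where w = "\<lambda>r. max 1 T * min r (r\<^sup>2)"])
    show "AE r in \<pi>. (\<lambda>n. r * (1 - exp (- u n * r))) \<longlonglongrightarrow> r * (1 - exp (- \<theta> * r))"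
      by (intro AE_I2 tendsto_intros u(3))
    show "AE r in \<pi>. norm (r * (1 - exp (- u n * r))) \<le> max 1 T * min r (r\<^sup>2)" for n
    proof (rule AE_I2)
      fix r assume "r \<in> space \<pi>"
      then show "norm (r * (1 - exp (- u n * r))) \<le> max 1 T * min r (r\<^sup>2)"
        using jump_kernel_le [of "u n" T r] u(1) by simp
    qed
  qed (use min_integrable in auto)
qed

text \<open>By the mean value theorem the increment is \<open>(u - v) r (1 - exp (- z r))\<close> with \<open>z \<le> T\<close>. The bound
dominates the difference quotients when the integral over \<open>\<pi>\<close> is differentiated.\<close>

lemma compensated_kernel_diff_le:
  fixes u v r T :: real
  assumes "0 < u" "u \<le> T" "0 < v" "v \<le> T" "0 < r"
  shows "\<bar>(exp (- u * r) - 1 + u * r) - (exp (- v * r) - 1 + v * r)\<bar>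
    \<le> max 1 T * min r (r\<^sup>2) * \<bar>u - v\<bar>"
proof -
  have *: "\<bar>(exp (- u * r) - 1 + u * r) - (exp (- v * r) - 1 + v * r)\<bar>
      \<le> max 1 T * min r (r\<^sup>2) * \<bar>u - v\<bar>" if "0 < u" "u < v" "v \<le> T" for u v
  proof -
    have "\<exists>z. u < z \<and> z < v \<and> (exp (- v * r) - 1 + v * r) - (exp (- u * r) - 1 + u * r)
        = (v - u) * (r * (1 - exp (- z * r)))"
      by (rule MVT2 [OF that(2)]) (auto intro!: derivative_eq_intros simp: algebra_simps)
    then obtain z where z: "u < z" "z < v" "(exp (- v * r) - 1 + v * r) - (exp (- u * r) - 1 + u * r)
        = (v - u) * (r * (1 - exp (- z * r)))" by blast
    have "(v - u) * (r * (1 - exp (- z * r))) \<le> (v - u) * (max 1 T * min r (r\<^sup>2))"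
      using jump_kernel_le(1) [of z T r] z(1,2) that assms(5) by (intro mult_left_mono) auto
    moreover have "0 \<le> (v - u) * (r * (1 - exp (- z * r)))"
      using z(1,2) that assms(5) by simp
    ultimately have "\<bar>(exp (- u * r) - 1 + u * r) - (exp (- v * r) - 1 + v * r)\<bar>
        \<le> (v - u) * (max 1 T * min r (r\<^sup>2))"
      using z(3) by linarith
    then show ?thesis using that by (simp add: mult.commute)
  qed
  consider "u < v" | "u = v" | "v < u" by linarith
  then show ?thesis
    by cases (use *[of u v] *[of v u] assms in \<open>auto simp: abs_minus_commute\<close>)
qed

lemma psi_has_derivative:
  assumes \<theta>: "0 < \<theta>"
  shows "(\<psi> has_real_derivative \<alpha> + \<sigma>\<^sup>2 * \<theta> + jump_part \<theta>) (at \<theta>)"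
proof -
  define J where "J \<theta> = (LINT r|\<pi>. exp (- \<theta> * r) - 1 + \<theta> * r)" for \<theta>
  define S where "S = {0<..<\<theta> + 1}"
  have "(J has_real_derivative jump_part \<theta>) (at \<theta> within S)"
    unfolding has_field_derivative_iff tendsto_at_iff_sequentially comp_def
  proof (intro allI impI)
    fix u :: "nat \<Rightarrow> real" assume u: "\<forall>n. u n \<in> S - {\<theta>}" "u \<longlonglongrightarrow> \<theta>"
    have quot: "(J (u n) - J \<theta>) / (u n - \<theta>) =
        (LINT r|\<pi>. ((exp (- u n * r) - 1 + u n * r) - (exp (- \<theta> * r) - 1 + \<theta> * r)) / (u n - \<theta>))" for n
    proof -
      have "0 \<le> u n" using u(1) by (auto simp: S_def less_imp_le)
      then show ?thesis
        unfolding J_def using \<theta>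
        by (simp only: Bochner_Integration.integral_diff [OF compensated_integrable compensated_integrable, symmetric]
            integral_divide_zero less_imp_le)
    qed
    show "(\<lambda>n. (J (u n) - J \<theta>) / (u n - \<theta>)) \<longlonglongrightarrow> jump_part \<theta>"
      unfolding quot jump_part_def
    proof (rule integral_dominated_convergence [where w = "\<lambda>r. max 1 (\<theta> + 1) * min r (r\<^sup>2)"])
      show "AE r in \<pi>. (\<lambda>n. ((exp (- u n * r) - 1 + u n * r) - (exp (- \<theta> * r) - 1 + \<theta> * r)) / (u n - \<theta>))
          \<longlonglongrightarrow> r * (1 - exp (- \<theta> * r))"
      proof (rule AE_I2)
        fix r
        have "((\<lambda>t. exp (- t * r) - 1 + t * r) has_real_derivative r * (1 - exp (- \<theta> * r))) (at \<theta>)"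
          by (auto intro!: derivative_eq_intros simp: algebra_simps)
        then show "(\<lambda>n. ((exp (- u n * r) - 1 + u n * r) - (exp (- \<theta> * r) - 1 + \<theta> * r)) / (u n - \<theta>))
            \<longlonglongrightarrow> r * (1 - exp (- \<theta> * r))"
          using u unfolding has_field_derivative_iff tendsto_at_iff_sequentially comp_def by blast
      qed
      show "AE r in \<pi>. norm (((exp (- u n * r) - 1 + u n * r) - (exp (- \<theta> * r) - 1 + \<theta> * r)) / (u n - \<theta>))
          \<le> max 1 (\<theta> + 1) * min r (r\<^sup>2)" for n
      proof (rule AE_I2)
        fix r assume "r \<in> space \<pi>"
        moreover have "0 < u n" "u n \<le> \<theta> + 1" "u n \<noteq> \<theta>" using u(1) by (auto simp: S_def less_imp_le)
        ultimately show "norm (((exp (- u n * r) - 1 + u n * r) - (exp (- \<theta> * r) - 1 + \<theta> * r)) / (u n - \<theta>))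
            \<le> max 1 (\<theta> + 1) * min r (r\<^sup>2)"
          using compensated_kernel_diff_le [of "u n" "\<theta> + 1" \<theta> r] \<theta>
          unfolding real_norm_def abs_divide by (subst pos_divide_le_eq) auto
      qed
    qed (use min_integrable in auto)
  qed
  then have J: "(J has_real_derivative jump_part \<theta>) (at \<theta>)"
    by (subst (asm) at_within_open) (use \<theta> in \<open>auto simp: S_def\<close>)
  have "\<psi> = (\<lambda>t. \<alpha> * t + 1 / 2 * \<sigma>\<^sup>2 * t\<^sup>2 + J t)"
    by (simp add: fun_eq_iff branching_mechanism_def J_def)
  then show ?thesis
    by (auto intro!: derivative_eq_intros J)
qed

lemma deriv_psi: "0 < \<theta> \<Longrightarrow> deriv \<psi> \<theta> = \<alpha> + \<sigma>\<^sup>2 * \<theta> + jump_part \<theta>"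
  by (rule DERIV_imp_deriv) (rule psi_has_derivative)

lemma psi_continuous: "continuous_on {0<..} \<psi>"
  by (rule DERIV_continuous_on) (use psi_has_derivative in \<open>auto intro: has_field_derivative_at_within\<close>)

lemma psi_nonneg:
  assumes "0 \<le> \<theta>" shows "0 \<le> \<psi> \<theta>"
proof -
  have "0 \<le> (LINT r|\<pi>. exp (- \<theta> * r) - 1 + \<theta> * r)"
    by (rule integral_nonneg_AE) (rule AE_I2, rule compensated_kernel_nonneg)
  then show ?thesis using alpha_nonneg assms by (simp add: branching_mechanism_def)
qed

lemma psi_mono:
  assumes "0 < x" "x \<le> y" shows "\<psi> x \<le> \<psi> y"
proof (rule DERIV_nonneg_imp_nondecreasing [OF assms(2)])
  fix t assume "x \<le> t" "t \<le> y"
  then have "0 < t" using assms by simp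
  then show "\<exists>D. (\<psi> has_real_derivative D) (at t) \<and> 0 \<le> D"
    using psi_has_derivative [of t] jump_part_nonneg [of t] alpha_nonneg
    by (intro exI [of _ "\<alpha> + \<sigma>\<^sup>2 * t + jump_part t"]) simp
qed

text \<open>A zero at a positive argument forces \<open>\<alpha> = 0\<close>, \<open>\<sigma> = 0\<close> and \<open>\<pi> = 0\<close>, hence \<open>\<psi> = 0\<close>, which does
not tend to infinity.\<close>

lemma psi_pos:
  assumes \<theta>: "0 < \<theta>" shows "0 < \<psi> \<theta>"
proof (rule ccontr)
  assume "\<not> 0 < \<psi> \<theta>"
  moreover have J: "0 \<le> (LINT r|\<pi>. exp (- \<theta> * r) - 1 + \<theta> * r)"
    by (rule integral_nonneg_AE) (rule AE_I2, rule compensated_kernel_nonneg)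
  ultimately have "\<alpha> * \<theta> + 1 / 2 * \<sigma>\<^sup>2 * \<theta>\<^sup>2 + (LINT r|\<pi>. exp (- \<theta> * r) - 1 + \<theta> * r) \<le> 0"
    by (simp add: branching_mechanism_def)
  moreover have "0 \<le> \<alpha> * \<theta>" "0 \<le> 1 / 2 * \<sigma>\<^sup>2 * \<theta>\<^sup>2" using alpha_nonneg \<theta> by auto
  ultimately have z: "\<alpha> * \<theta> = 0" "1 / 2 * \<sigma>\<^sup>2 * \<theta>\<^sup>2 = 0"
    "(LINT r|\<pi>. exp (- \<theta> * r) - 1 + \<theta> * r) = 0"
    using J by linarith+
  have "AE r in \<pi>. exp (- \<theta> * r) - 1 + \<theta> * r = 0"
    using z(3) \<theta> compensated_kernel_nonneg
    by (subst (asm) integral_nonneg_eq_0_iff_AE [OF compensated_integrable]) simp_all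
  then have "AE r in \<pi>. False"
    using AE_pi_pos
  proof eventually_elim
    case (elim r)
    then show ?case using exp_minus_greater [of "\<theta> * r"] \<theta> by simp
  qed
  then have "AE r in \<pi>. exp (- t * r) - 1 + t * r = 0" for t
    by eventually_elim simp
  then have "(LINT r|\<pi>. exp (- t * r) - 1 + t * r) = 0" for t
    by (rule integral_eq_zero_AE)
  then have "\<psi> t = 0" for t
    using z \<theta> by (simp add: branching_mechanism_def)
  then have "\<psi> = (\<lambda>_. 0)" by auto
  with psi_at_top show False
    by (simp add: filterlim_at_top) (metis eventually_at_top_linorder not_one_le_zero order_refl)
qed

text \<open>A bound for the slope of the branching mechanism at the origin; it makes \<open>1 / \<psi>\<close> fail to be
integrable there, so that the tail integral is onto.\<close>

definition slope :: real where
  "slope = \<alpha> + 1 / 2 * \<sigma>\<^sup>2 + (LINT r|\<pi>. min r (r\<^sup>2))"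

lemma psi_le_slope:
  assumes "0 < \<theta>" "\<theta> \<le> 1" shows "\<psi> \<theta> \<le> slope * \<theta>"
proof -
  have sq: "\<theta>\<^sup>2 \<le> \<theta>" using assms by (simp add: power2_eq_square)
  have "(LINT r|\<pi>. exp (- \<theta> * r) - 1 + \<theta> * r) \<le> (LINT r|\<pi>. \<theta> * min r (r\<^sup>2))"
  proof (rule integral_mono)
    fix r assume "r \<in> space \<pi>"
    then show "exp (- \<theta> * r) - 1 + \<theta> * r \<le> \<theta> * min r (r\<^sup>2)"
      using compensated_kernel_le [of \<theta> r] assms sq by (simp add: max_def)
  qed (use assms compensated_integrable min_integrable in auto)
  moreover have "1 / 2 * \<sigma>\<^sup>2 * \<theta>\<^sup>2 \<le> 1 / 2 * \<sigma>\<^sup>2 * \<theta>"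
    using sq by (intro mult_left_mono) auto
  ultimately show ?thesis
    by (simp add: branching_mechanism_def slope_def algebra_simps)
qed

lemma inverse_psi_integrable_Icc:
  assumes "0 < x" shows "set_integrable lborel {x..y} (\<lambda>u. 1 / \<psi> u)"
proof (rule borel_integrable_atLeastAtMost')
  show "continuous_on {x..y} (\<lambda>u. 1 / \<psi> u)"
  proof (intro continuous_intros continuous_on_subset [OF psi_continuous] ballI)
    fix u assume "u \<in> {x..y}"
    then show "\<psi> u \<noteq> 0" using psi_pos [of u] assms by auto
  qed (use assms in auto)
qed

lemma inverse_psi_integrable:
  assumes "0 < x" shows "set_integrable lborel {x..} (\<lambda>u. 1 / \<psi> u)"
proof -
  obtain a where a: "0 < a" "set_integrable lborel {a..} (\<lambda>u. 1 / \<psi> u)"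
    using admissible by (auto simp: admissible_def)
  have "set_integrable lborel ({x..a} \<union> {a..}) (\<lambda>u. 1 / \<psi> u)"
    by (rule set_integrable_Un [OF inverse_psi_integrable_Icc [OF assms] a(2)]) auto
  then show ?thesis by (rule set_integrable_subset) auto
qed

lemma tail_integral_diff:
  assumes "0 < x" "x \<le> y"
  shows "tail_integral \<psi> x - tail_integral \<psi> y = (LINT u:{x..y}|lborel. 1 / \<psi> u)"
proof -
  have "(LINT u:({x..y} \<union> {y..})|lborel. 1 / \<psi> u) =
      (LINT u:{x..y}|lborel. 1 / \<psi> u) + (LINT u:{y..}|lborel. 1 / \<psi> u)"
  proof (rule set_integral_Un_AE)
    show "AE u in lborel. \<not> (u \<in> {x..y} \<and> u \<in> {y..})"
      using AE_lborel_singleton [of y] by eventually_elim auto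
  qed (use assms inverse_psi_integrable inverse_psi_integrable_Icc in auto)
  moreover have "{x..y} \<union> {y..} = {x..}" using assms by auto
  ultimately show ?thesis by (simp add: tail_integral_def)
qed

lemma tail_integral_strict_antimono:
  assumes "0 < x" "x < y" shows "tail_integral \<psi> y < tail_integral \<psi> x"
proof -
  have "0 < (y - x) * (1 / \<psi> y)" using assms psi_pos [of y] by simp
  also have "(y - x) * (1 / \<psi> y) = (LINT u:{x..y}|lborel. 1 / \<psi> y)"
    using assms by (simp add: set_lebesgue_integral_def)
  also have "\<dots> \<le> (LINT u:{x..y}|lborel. 1 / \<psi> u)"
  proof (rule set_integral_mono)
    fix u assume "u \<in> {x..y}"
    then show "1 / \<psi> y \<le> 1 / \<psi> u"
      using psi_mono [of u y] psi_pos [of u] assms by (intro divide_left_mono) auto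
  qed (use assms inverse_psi_integrable_Icc in \<open>auto intro!: borel_integrable_atLeastAtMost'\<close>)
  finally show ?thesis using tail_integral_diff [of x y] assms by simp
qed

lemma tail_integral_lipschitz:
  assumes "0 < a" "a \<le> x" "x \<le> y"
  shows "tail_integral \<psi> x - tail_integral \<psi> y \<le> (y - x) / \<psi> a"
proof -
  have "(LINT u:{x..y}|lborel. 1 / \<psi> u) \<le> (LINT u:{x..y}|lborel. 1 / \<psi> a)"
  proof (rule set_integral_mono)
    fix u assume "u \<in> {x..y}"
    then show "1 / \<psi> u \<le> 1 / \<psi> a"
      using psi_mono [of a u] psi_pos [of a] assms by (intro divide_left_mono) auto
  qed (use assms inverse_psi_integrable_Icc in \<open>auto intro!: borel_integrable_atLeastAtMost'\<close>)
  also have "\<dots> = (y - x) / \<psi> a"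
    using assms by (simp add: set_lebesgue_integral_def)
  finally show ?thesis using tail_integral_diff [of x y] assms by simp
qed

lemma tail_integral_continuous:
  assumes "0 < a" shows "continuous_on {a..} (tail_integral \<psi>)"
proof -
  have "(1 / \<psi> a)-lipschitz_on {a..} (tail_integral \<psi>)"
  proof (rule lipschitz_onI)
    show "dist (tail_integral \<psi> x) (tail_integral \<psi> y) \<le> 1 / \<psi> a * dist x y"
      if "x \<in> {a..}" "y \<in> {a..}" for x y
    proof -
      have *: "\<bar>tail_integral \<psi> x - tail_integral \<psi> y\<bar> \<le> (y - x) / \<psi> a" if "a \<le> x" "x \<le> y" for x y
        using tail_integral_lipschitz [OF assms that] tail_integral_strict_antimono [of x y] that assms
        by (cases "x = y") auto
      show ?thesis
        using *[of x y] *[of y x] that by (cases "x \<le> y") (auto simp: dist_real_def abs_minus_commute)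
    qed
    show "0 \<le> 1 / \<psi> a" using psi_pos [OF assms] by simp
  qed
  then show ?thesis by (rule lipschitz_on_continuous_on)
qed

lemma tail_integral_tendsto_0: "(\<lambda>n. tail_integral \<psi> (real (Suc n))) \<longlonglongrightarrow> 0"
proof -
  have "(\<lambda>n. LINT u|lborel. indicator {real (Suc n)..} u *\<^sub>R (1 / \<psi> u)) \<longlonglongrightarrow> (LINT u::real|lborel. (0::real))"
  proof (rule integral_dominated_convergence [where w = "\<lambda>u. indicator {1..} u *\<^sub>R (1 / \<psi> u)"])
    show "integrable lborel (\<lambda>u. indicator {1..} u *\<^sub>R (1 / \<psi> u))"
      using inverse_psi_integrable [of 1] by (simp add: set_integrable_def)
    show "(\<lambda>u. indicator {real (Suc n)..} u *\<^sub>R (1 / \<psi> u)) \<in> borel_measurable lborel" for n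
      using inverse_psi_integrable [of "real (Suc n)"] by (auto simp: set_integrable_def)
    show "AE u in lborel. (\<lambda>n. indicator {real (Suc n)..} u *\<^sub>R (1 / \<psi> u)) \<longlonglongrightarrow> 0"
    proof (rule AE_I2)
      fix u :: real
      have "eventually (\<lambda>n. indicator {real (Suc n)..} u *\<^sub>R (1 / \<psi> u) = 0) sequentially"
        using eventually_ge_at_top [of "nat \<lceil>u\<rceil>"]
        by eventually_elim (auto simp: indicator_def nat_ceiling_le_eq)
      then show "(\<lambda>n. indicator {real (Suc n)..} u *\<^sub>R (1 / \<psi> u)) \<longlonglongrightarrow> 0"
        by (rule tendsto_eventually)
    qed
    show "AE u in lborel. norm (indicator {real (Suc n)..} u *\<^sub>R (1 / \<psi> u))
        \<le> indicator {1..} u *\<^sub>R (1 / \<psi> u)" for n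
      using psi_pos by (intro AE_I2) (auto simp: indicator_def abs_of_pos psi_nonneg)
  qed simp
  then show ?thesis by (simp add: tail_integral_def set_lebesgue_integral_def)
qed

lemma tail_integral_ge_log:
  assumes "0 < x" "x \<le> 1"
  shows "- ln x \<le> slope * tail_integral \<psi> x"
proof -
  have slope: "0 < slope" using psi_le_slope [of 1] psi_pos [of 1] by simp
  have deriv: "(ln has_vector_derivative 1 / u) (at u within {x..1})" if "x \<le> u" for u
    using assms that
    by (auto intro!: derivative_eq_intros simp: has_real_derivative_iff_has_vector_derivative [symmetric])
  have "- ln x = (LINT u:{x..1}|lborel. 1 / u)"
    unfolding set_lebesgue_integral_def
    using assms(1)
    by (subst integral_FTC_atLeastAtMost [OF assms(2) deriv]) (auto intro!: continuous_intros)
  also have "\<dots> \<le> (LINT u:{x..1}|lborel. slope * (1 / \<psi> u))"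
  proof (rule set_integral_mono)
    fix u assume u: "u \<in> {x..1}"
    then show "1 / u \<le> slope * (1 / \<psi> u)"
      using psi_le_slope [of u] psi_pos [of u] assms by (auto simp: field_simps)
  next
    show "set_integrable lborel {x..1} (\<lambda>u. 1 / u)"
      using assms by (intro borel_integrable_atLeastAtMost' continuous_intros) auto
  next
    show "set_integrable lborel {x..1} (\<lambda>u. slope * (1 / \<psi> u))"
      by (rule set_integrable_mult_right) (rule inverse_psi_integrable_Icc [OF assms(1)])
  qed
  also have "\<dots> = slope * (tail_integral \<psi> x - tail_integral \<psi> 1)"
    unfolding set_integral_mult_right using tail_integral_diff [of x 1] assms by simp
  also have "\<dots> \<le> slope * tail_integral \<psi> x"
  proof -
    have "0 \<le> tail_integral \<psi> 1"
      unfolding tail_integral_def set_lebesgue_integral_def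
      by (rule integral_nonneg_AE) (auto intro!: AE_I2 simp: indicator_def psi_nonneg)
    then show ?thesis using slope by simp
  qed
  finally show ?thesis .
qed

text \<open>The tail integral is continuous and strictly decreasing, tends to zero at infinity and is at least
\<open>- ln x / slope\<close> near the origin, so \<open>q\<close> is attained exactly once.\<close>

lemma tail_integral_inv:
  assumes "0 < q"
  shows "0 < tail_integral_inv \<psi> q" "tail_integral \<psi> (tail_integral_inv \<psi> q) = q"
proof -
  have slope: "0 < slope" using psi_le_slope [of 1] psi_pos [of 1] by simp
  define x where "x = exp (- (slope * q))"
  have x: "0 < x" "x \<le> 1" using slope assms by (auto simp: x_def)
  have "q \<le> tail_integral \<psi> x"
    using tail_integral_ge_log [OF x] slope by (simp add: x_def)
  moreover obtain n where n: "tail_integral \<psi> (real (Suc n)) < q"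
    using order_tendstoD(2) [OF tail_integral_tendsto_0 assms] by (auto simp: eventually_sequentially)
  moreover have "x \<le> real (Suc n)" using x by simp
  moreover have "continuous_on {x..real (Suc n)} (tail_integral \<psi>)"
    by (rule continuous_on_subset [OF tail_integral_continuous [OF x(1)]]) auto
  ultimately obtain c where c: "x \<le> c" "tail_integral \<psi> c = q"
    using IVT2' [of "tail_integral \<psi>" "real (Suc n)" q x] by (auto simp del: of_nat_Suc)
  have "inj_on (tail_integral \<psi>) {0<..}"
    by (rule inj_onI) (metis greaterThan_iff linorder_neqE_linordered_idom order_less_irrefl
        tail_integral_strict_antimono)
  then have "tail_integral_inv \<psi> q = c"
    unfolding tail_integral_inv_def using the_inv_into_f_f [of _ "{0<..}" c] c x by auto
  then show "0 < tail_integral_inv \<psi> q" "tail_integral \<psi> (tail_integral_inv \<psi> q) = q"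
    using c x by auto
qed

lemma log_psi_increment:
  assumes c: "0 < c" and \<theta>: "0 \<le> \<theta>"
  shows "\<alpha> * (tail_integral \<psi> (\<theta> + c) - tail_integral \<psi> c) + ln (\<psi> (\<theta> + c) / \<psi> c)
    = (LINT s:{c..\<theta> + c}|lborel. (deriv \<psi> s - \<alpha>) / \<psi> s)"
proof -
  let ?I = "{c..\<theta> + c}"
  have cont: "continuous_on ?I (\<lambda>s. deriv \<psi> s / \<psi> s)"
  proof -
    have "continuous_on ?I (\<lambda>s. (\<alpha> + \<sigma>\<^sup>2 * s + jump_part s) / \<psi> s)"
    proof (intro continuous_intros ballI)
      show "continuous_on ?I jump_part"
        by (rule continuous_on_subset [OF jump_part_continuous [of "\<theta> + c"]]) (use c in auto)
      show "continuous_on ?I \<psi>"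
        by (rule continuous_on_subset [OF psi_continuous]) (use c in auto)
      show "\<psi> s \<noteq> 0" if "s \<in> ?I" for s using psi_pos [of s] that c by auto
    qed
    then show ?thesis using c by (subst continuous_on_cong [OF refl]) (auto simp: deriv_psi)
  qed
  have "(LINT s:?I|lborel. deriv \<psi> s / \<psi> s) = ln (\<psi> (\<theta> + c)) - ln (\<psi> c)"
    unfolding set_lebesgue_integral_def
  proof (rule integral_FTC_atLeastAtMost [OF _ _ cont])
    fix s assume "c \<le> s" "s \<le> \<theta> + c"
    then have s: "0 < s" using c by simp
    have "((\<lambda>s. ln (\<psi> s)) has_real_derivative deriv \<psi> s / \<psi> s) (at s)"
      using psi_has_derivative [OF s] psi_pos [OF s]
      by (auto intro!: derivative_eq_intros simp: deriv_psi [OF s])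
    then show "((\<lambda>s. ln (\<psi> s)) has_vector_derivative deriv \<psi> s / \<psi> s) (at s within ?I)"
      by (simp add: has_real_derivative_iff_has_vector_derivative has_vector_derivative_at_within)
  qed (use \<theta> in simp)
  moreover have "set_integrable lborel ?I (\<lambda>s. deriv \<psi> s / \<psi> s)"
    by (rule borel_integrable_atLeastAtMost' [OF cont])
  moreover note inverse_psi_integrable_Icc [OF c, of "\<theta> + c"] tail_integral_diff [of c "\<theta> + c"]
  moreover have "(LINT s:?I|lborel. \<alpha> * (1 / \<psi> s)) = \<alpha> * (LINT s:?I|lborel. 1 / \<psi> s)"
    by (rule set_integral_mult_right)
  moreover have "(LINT s:?I|lborel. (deriv \<psi> s - \<alpha>) / \<psi> s)
      = (LINT s:?I|lborel. deriv \<psi> s / \<psi> s - \<alpha> * (1 / \<psi> s))"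
    by (simp add: diff_divide_distrib)
  moreover have "ln (\<psi> (\<theta> + c) / \<psi> c) = ln (\<psi> (\<theta> + c)) - ln (\<psi> c)"
    using psi_pos [of c] psi_pos [of "\<theta> + c"] c \<theta> by (subst ln_div) auto
  ultimately show ?thesis
    using \<theta> c by (simp only: set_integral_diff set_integrable_mult_right) (simp add: algebra_simps)
qed

end

section \<open>A Volterra equation with a decreasing kernel\<close>

text \<open>The equation \<open>d W x + (k * W) x = x\<close> on the half-line, for an unknown increasing function that
vanishes on the negative half-line. The kernel is extended by zero so that the convolution is an
integral over the whole line.\<close>

locale volterra =
  fixes d :: real and k W :: "real \<Rightarrow> real"
  assumes d_pos: "0 < d"
    and k_measurable [measurable]: "k \<in> borel_measurable borel"
    and k_nonneg: "\<And>r. 0 \<le> k r"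
    and k_zero: "\<And>r. r \<le> 0 \<Longrightarrow> k r = 0"
    and k_antimono: "\<And>r s. 0 < r \<Longrightarrow> r \<le> s \<Longrightarrow> k s \<le> k r"
    and k_laplace: "integrable lborel (\<lambda>r. exp (- r) * k r)"
    and W_mono: "mono W"
    and W_zero: "\<And>x. x < 0 \<Longrightarrow> W x = 0"
    and conv_integrable: "\<And>x. integrable lborel (\<lambda>r. k r * W (x - r))"
    and equation: "\<And>x. d * W x + (LINT r|lborel. k r * W (x - r)) = max 0 x"
begin

lemma W_measurable [measurable]: "W \<in> borel_measurable borel"
  using W_mono by (rule borel_measurable_mono)

lemma W_increment:
  assumes "x \<le> y"
  shows "d * (W y - W x) = max 0 y - max 0 x - (LINT r|lborel. k r * (W (y - r) - W (x - r)))"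
proof -
  have "(LINT r|lborel. k r * (W (y - r) - W (x - r)))
      = (LINT r|lborel. k r * W (y - r)) - (LINT r|lborel. k r * W (x - r))"
    using conv_integrable by (simp only: right_diff_distrib Bochner_Integration.integral_diff)
  then show ?thesis using equation [of x] equation [of y] by (simp add: algebra_simps)
qed

text \<open>The convolution of a nonnegative kernel with an increasing function is increasing, so \<open>d W\<close> grows
no faster than the right-hand side of the equation.\<close>

lemma W_lipschitz:
  assumes "x \<le> y" shows "W y - W x \<le> (y - x) / d"
proof -
  have "0 \<le> (LINT r|lborel. k r * (W (y - r) - W (x - r)))"
    using assms by (intro integral_nonneg_AE AE_I2 mult_nonneg_nonneg k_nonneg)
      (simp add: monoD [OF W_mono])
  then have "d * (W y - W x) \<le> y - x"
    using W_increment [OF assms] assms by linarith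
  then show ?thesis using d_pos by (simp add: field_simps)
qed

lemma W_continuous: "continuous_on UNIV W"
proof -
  have "(1 / d)-lipschitz_on UNIV W"
  proof (rule lipschitz_onI)
    have *: "\<bar>W x - W y\<bar> \<le> 1 / d * \<bar>x - y\<bar>" if "x \<le> y" for x y
      using W_lipschitz [OF that] monoD [OF W_mono that] that by simp
    show "dist (W x) (W y) \<le> 1 / d * dist x y" for x y
      using *[of x y] *[of y x] by (cases "x \<le> y") (auto simp: dist_real_def abs_minus_commute)
  qed (use d_pos in simp)
  then show ?thesis by (rule lipschitz_on_continuous_on)
qed

definition D :: "real \<Rightarrow> real \<Rightarrow> real" where
  "D \<epsilon> x = (W (x + \<epsilon>) - W x) / \<epsilon>"

lemma D_measurable [measurable]: "D \<epsilon> \<in> borel_measurable borel"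
  unfolding D_def by measurable

lemma D_bounds:
  assumes "0 < \<epsilon>" shows "0 \<le> D \<epsilon> x" "D \<epsilon> x \<le> 1 / d"
  using W_lipschitz [of x "x + \<epsilon>"] monoD [OF W_mono, of x "x + \<epsilon>"] assms d_pos
  by (auto simp: D_def field_simps)

lemma D_zero: "0 < \<epsilon> \<Longrightarrow> x < - \<epsilon> \<Longrightarrow> D \<epsilon> x = 0"
  by (simp add: D_def W_zero)

lemma D_conv_integrable: "integrable lborel (\<lambda>r. k r * D \<epsilon> (x - r))"
proof -
  have "integrable lborel (\<lambda>r. (k r * W (x + \<epsilon> - r) - k r * W (x - r)) / \<epsilon>)"
    using conv_integrable by simp
  then show ?thesis by (simp add: D_def algebra_simps diff_divide_distrib)
qed

text \<open>The equation for difference quotients holds with right-hand side \<open>1\<close> on the half-line only: to the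
left of the origin the quotient with step \<open>\<epsilon>\<close> lives on a window of length \<open>\<epsilon>\<close>, where it need
not be small.\<close>

lemma D_equation:
  assumes "0 < \<epsilon>" "0 \<le> x"
  shows "d * D \<epsilon> x + (LINT r|lborel. k r * D \<epsilon> (x - r)) = 1"
proof -
  have "k r * D \<epsilon> (x - r) = k r * (W (x + \<epsilon> - r) - W (x - r)) / \<epsilon>" for r
    by (simp add: D_def algebra_simps)
  then have "(LINT r|lborel. k r * D \<epsilon> (x - r)) = (LINT r|lborel. k r * (W (x + \<epsilon> - r) - W (x - r))) / \<epsilon>"
    by (simp only: integral_divide_zero)
  moreover have "d * D \<epsilon> x = d * (W (x + \<epsilon>) - W x) / \<epsilon>" by (simp add: D_def)
  moreover have "d * (W (x + \<epsilon>) - W x) = \<epsilon> - (LINT r|lborel. k r * (W (x + \<epsilon> - r) - W (x - r)))"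
    using W_increment [of x "x + \<epsilon>"] assms by simp
  ultimately show ?thesis
    using assms by (simp only: add_divide_distrib [symmetric]) simp
qed

text \<open>The weight for which the convolution is a contraction by the factor \<open>1 / 2\<close> relative to \<open>d\<close>.\<close>

lemma laplace_weight_exists:
  obtains c where "1 \<le> c" "integrable lborel (\<lambda>r. exp (- c * r) * k r)"
    "(LINT r|lborel. exp (- c * r) * k r) \<le> d / 2"
proof -
  have le: "exp (- real (Suc n) * r) * k r \<le> exp (- r) * k r" for n r
  proof (cases "r \<le> 0")
    case False
    then have "r \<le> real (Suc n) * r" by (simp add: mult_le_cancel_right1)
    then show ?thesis using k_nonneg by (intro mult_right_mono) (auto simp del: of_nat_Suc)
  qed (simp add: k_zero)
  have int: "integrable lborel (\<lambda>r. exp (- real (Suc n) * r) * k r)" for n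
  proof (rule Bochner_Integration.integrable_bound [OF k_laplace])
    show "AE r in lborel. norm (exp (- real (Suc n) * r) * k r) \<le> norm (exp (- r) * k r)"
      using le k_nonneg by (intro AE_I2) (simp add: abs_mult del: of_nat_Suc)
  qed measurable
  have "(\<lambda>n. LINT r|lborel. exp (- real (Suc n) * r) * k r) \<longlonglongrightarrow> (LINT r::real|lborel. (0::real))"
  proof (rule integral_dominated_convergence [where w = "\<lambda>r. exp (- r) * k r"])
    show "AE r in lborel. (\<lambda>n. exp (- real (Suc n) * r) * k r) \<longlonglongrightarrow> 0"
    proof (rule AE_I2)
      fix r :: real
      show "(\<lambda>n. exp (- real (Suc n) * r) * k r) \<longlonglongrightarrow> 0"
      proof (cases "r \<le> 0")
        case False
        then have "(\<lambda>n. exp (- r) ^ Suc n * k r) \<longlonglongrightarrow> 0 * k r"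
          by (intro tendsto_mult tendsto_const LIMSEQ_Suc [OF LIMSEQ_power_zero]) simp
        moreover have "exp (- r) ^ Suc n = exp (- real (Suc n) * r)" for n
          by (subst exp_of_nat_mult [symmetric]) (simp add: algebra_simps)
        ultimately show ?thesis by simp
      qed (simp add: k_zero)
    qed
    show "AE r in lborel. norm (exp (- real (Suc n) * r) * k r) \<le> exp (- r) * k r" for n
      using le k_nonneg by (intro AE_I2) (simp add: abs_mult del: of_nat_Suc)
  qed (use k_laplace in auto)
  then have "eventually (\<lambda>n. (LINT r|lborel. exp (- real (Suc n) * r) * k r) < d / 2) sequentially"
    using d_pos by (intro order_tendstoD(2)) auto
  then obtain n where "(LINT r|lborel. exp (- real (Suc n) * r) * k r) < d / 2"
    by (auto simp: eventually_sequentially)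
  then show thesis using int [of n] by (intro that [of "real (Suc n)"]) auto
qed

definition k_mass :: "real \<Rightarrow> real" where
  "k_mass \<eta> = (LINT r|lborel. indicator {..\<eta>} r * k r)"

lemma k_mass_integrable: "integrable lborel (\<lambda>r. indicator {..\<eta>} r * k r)"
proof (rule Bochner_Integration.integrable_bound)
  show "integrable lborel (\<lambda>r. exp \<eta> * (exp (- r) * k r))" using k_laplace by simp
  show "AE r in lborel. norm (indicator {..\<eta>} r * k r) \<le> norm (exp \<eta> * (exp (- r) * k r))"
  proof (rule AE_I2)
    fix r
    have "k r \<le> exp (\<eta> - r) * k r" if "r \<le> \<eta>"
      using mult_right_mono [of 1 "exp (\<eta> - r)" "k r"] k_nonneg [of r] that by simp
    then show "norm (indicator {..\<eta>} r * k r) \<le> norm (exp \<eta> * (exp (- r) * k r))"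
      using k_nonneg [of r] by (auto simp: indicator_def abs_mult exp_diff exp_minus divide_inverse mult_ac)
  qed
qed measurable

lemma k_mass_nonneg: "0 \<le> k_mass \<eta>"
  unfolding k_mass_def using k_nonneg by (intro integral_nonneg_AE AE_I2) simp

lemma k_mass_mono: "\<eta> \<le> \<eta>' \<Longrightarrow> k_mass \<eta> \<le> k_mass \<eta>'"
  unfolding k_mass_def
  by (intro integral_mono k_mass_integrable) (auto simp: indicator_def k_nonneg)

lemma k_mass_tendsto_0: "(\<lambda>n. k_mass (inverse (real (Suc n)))) \<longlonglongrightarrow> 0"
proof -
  have "(\<lambda>n. LINT r|lborel. indicator {..inverse (real (Suc n))} r * k r) \<longlonglongrightarrow> (LINT r::real|lborel. (0::real))"
  proof (rule integral_dominated_convergence [where w = "\<lambda>r. indicator {..1} r * k r"])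
    show "AE r in lborel. (\<lambda>n. indicator {..inverse (real (Suc n))} r * k r) \<longlonglongrightarrow> 0"
    proof (rule AE_I2)
      fix r :: real
      show "(\<lambda>n. indicator {..inverse (real (Suc n))} r * k r) \<longlonglongrightarrow> 0"
      proof (cases "r \<le> 0")
        case False
        then have "eventually (\<lambda>n. inverse (real (Suc n)) < r) sequentially"
          by (intro order_tendstoD(2) [OF LIMSEQ_inverse_real_of_nat]) simp
        then have "eventually (\<lambda>n. indicator {..inverse (real (Suc n))} r * k r = 0) sequentially"
          by eventually_elim simp
        then show ?thesis by (rule tendsto_eventually)
      qed (simp add: k_zero)
    qed
    show "AE r in lborel. norm (indicator {..inverse (real (Suc n))} r * k r) \<le> indicator {..1} r * k r" for n
    proof (rule AE_I2)
      fix r :: real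
      have "inverse (real (Suc n)) \<le> 1" by (simp add: inverse_le_1_iff)
      then show "norm (indicator {..inverse (real (Suc n))} r * k r) \<le> indicator {..1} r * k r"
        using k_nonneg [of r] by (auto simp: indicator_def)
    qed
  qed (use k_mass_integrable in auto)
  then show ?thesis by (simp add: k_mass_def)
qed

text \<open>A decreasing kernel has at least as much mass next to the origin as in any other window of the same
length.\<close>

lemma k_mass_window:
  assumes "0 \<le> x"
  shows "integrable lborel (\<lambda>r. indicator {x<..x + \<eta>} r * k r)"
    and "(LINT r|lborel. indicator {x<..x + \<eta>} r * k r) \<le> k_mass \<eta>"
proof -
  show *: "integrable lborel (\<lambda>r. indicator {x<..x + \<eta>} r * k r)"
    by (rule Bochner_Integration.integrable_bound [OF k_mass_integrable [of "x + \<eta>"]])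
      (auto simp: indicator_def)
  have shift: "integrable lborel (\<lambda>r. indicator {x<..x + \<eta>} (x + 1 * r) * k (x + 1 * r))"
    by (rule lborel_integrable_real_affine [OF *]) simp
  have "(LINT r|lborel. indicator {x<..x + \<eta>} r * k r)
      = (LINT r|lborel. indicator {x<..x + \<eta>} (x + 1 * r) * k (x + 1 * r))"
    by (subst lborel_integral_real_affine [of 1 _ x]) auto
  also have "\<dots> \<le> (LINT r|lborel. indicator {..\<eta>} r * k r)"
  proof (rule integral_mono [OF shift k_mass_integrable])
    fix r :: real
    show "indicator {x<..x + \<eta>} (x + 1 * r) * k (x + 1 * r) \<le> indicator {..\<eta>} r * k r"
      using k_antimono [of r "x + r"] assms k_nonneg [of r] by (auto simp: indicator_def)
  qed
  finally show "(LINT r|lborel. indicator {x<..x + \<eta>} r * k r) \<le> k_mass \<eta>"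
    by (simp add: k_mass_def)
qed

text \<open>One application of the equation halves a bound on the difference of two quotients, at the cost of the
kernel mass of the boundary window.\<close>

lemma D_difference_step:
  assumes c: "integrable lborel (\<lambda>r. exp (- c * r) * k r)"
      "(LINT r|lborel. exp (- c * r) * k r) \<le> d / 2" "0 \<le> c"
    and \<epsilon>: "0 < \<epsilon>" "\<epsilon> \<le> \<eta>" and \<delta>: "0 < \<delta>" "\<delta> \<le> \<eta>"
    and B: "0 \<le> B" "\<And>x. 0 \<le> x \<Longrightarrow> \<bar>D \<epsilon> x - D \<delta> x\<bar> \<le> B * exp (c * x)"
    and x: "0 \<le> x"
  shows "\<bar>D \<epsilon> x - D \<delta> x\<bar> \<le> (B / 2 + k_mass \<eta> / d\<^sup>2) * exp (c * x)"
proof -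
  define E where "E x = D \<epsilon> x - D \<delta> x" for x
  have E_int: "integrable lborel (\<lambda>r. k r * E (x - r))" for x
    unfolding E_def right_diff_distrib using D_conv_integrable by simp
  have E_bound: "\<bar>E y\<bar> \<le> 1 / d" for y
    using D_bounds [OF \<epsilon>(1), of y] D_bounds [OF \<delta>(1), of y] by (simp add: E_def abs_le_iff)
  have E_zero: "E y = 0" if "y < - \<eta>" for y
    using D_zero [OF \<epsilon>(1), of y] D_zero [OF \<delta>(1), of y] \<epsilon> \<delta> that by (simp add: E_def)
  \<comment> \<open>Domination of the memory integral: the first term covers the half-line, where \<open>B\<close> applies, and
    the second the boundary window, where only the Lipschitz bound is available.\<close>
  define U where "U r = B * exp (c * x) * (exp (- c * r) * k r) + 1 / d * (indicator {x<..x + \<eta>} r * k r)" for r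
  have U_int: "integrable lborel U"
    unfolding U_def using c(1) k_mass_window(1) [OF x, of \<eta>] by simp
  have "d * \<bar>E x\<bar> = \<bar>LINT r|lborel. k r * E (x - r)\<bar>"
  proof -
    have "d * E x + (LINT r|lborel. k r * E (x - r)) = 0"
    proof -
      have "(LINT r|lborel. k r * E (x - r))
          = (LINT r|lborel. k r * D \<epsilon> (x - r)) - (LINT r|lborel. k r * D \<delta> (x - r))"
        unfolding E_def right_diff_distrib using D_conv_integrable by simp
      then show ?thesis
        using D_equation [OF \<epsilon>(1) x] D_equation [OF \<delta>(1) x] by (simp add: E_def right_diff_distrib)
    qed
    then have "d * E x = - (LINT r|lborel. k r * E (x - r))" by simp
    then have "\<bar>d * E x\<bar> = \<bar>LINT r|lborel. k r * E (x - r)\<bar>" by simp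
    then show ?thesis using d_pos by (simp add: abs_mult)
  qed
  also have "\<dots> \<le> (LINT r|lborel. \<bar>k r * E (x - r)\<bar>)"
    by (rule integral_abs_bound)
  also have "\<dots> \<le> (LINT r|lborel. U r)"
  proof (rule integral_mono)
    fix r :: real
    \<comment> \<open>The memory \<open>x - r\<close> falls in the half-line, in the boundary window, or to its left.\<close>
    consider "r \<le> x" | "x < r" "r \<le> x + \<eta>" | "x + \<eta> < r" by linarith
    then show "\<bar>k r * E (x - r)\<bar> \<le> U r"
    proof cases
      case 1
      then have "\<bar>E (x - r)\<bar> \<le> B * exp (c * (x - r))" using B(2) [of "x - r"] by (simp add: E_def)
      then have "k r * \<bar>E (x - r)\<bar> \<le> k r * (B * exp (c * (x - r)))"
        using k_nonneg by (rule mult_left_mono)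
      also have "\<dots> = B * exp (c * x) * (exp (- c * r) * k r)"
        by (simp add: right_diff_distrib exp_diff exp_minus divide_inverse)
      finally show ?thesis using 1 k_nonneg by (simp add: U_def abs_mult)
    next
      case 2
      have "k r * \<bar>E (x - r)\<bar> \<le> k r * (1 / d)"
        using E_bound k_nonneg by (rule mult_left_mono)
      moreover have "0 \<le> B * exp (c * x) * (exp (- c * r) * k r)" using B(1) k_nonneg by simp
      ultimately show ?thesis using 2 k_nonneg by (simp add: U_def abs_mult)
    next
      case 3
      then show ?thesis using E_zero [of "x - r"] B(1) k_nonneg by (simp add: U_def)
    qed
  qed (use E_int U_int in auto)
  also have "\<dots> = B * exp (c * x) * (LINT r|lborel. exp (- c * r) * k r)
      + 1 / d * (LINT r|lborel. indicator {x<..x + \<eta>} r * k r)"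
    unfolding U_def using c(1) k_mass_window(1) [OF x, of \<eta>]
    by (subst Bochner_Integration.integral_add) (simp_all only: integrable_mult_right integral_mult_right_zero)
  also have "\<dots> \<le> B * exp (c * x) * (d / 2) + 1 / d * k_mass \<eta>"
    using B(1) c(2) k_mass_window(2) [OF x, of \<eta>] d_pos by (intro add_mono mult_left_mono) auto
  also have "\<dots> \<le> B * exp (c * x) * (d / 2) + 1 / d * k_mass \<eta> * exp (c * x)"
  proof -
    have "1 \<le> exp (c * x)" using c(3) x by simp
    moreover have "0 \<le> 1 / d * k_mass \<eta>" using d_pos k_mass_nonneg by simp
    ultimately have "1 / d * k_mass \<eta> * 1 \<le> 1 / d * k_mass \<eta> * exp (c * x)"
      by (rule mult_left_mono)
    then show ?thesis by simp
  qed
  also have "\<dots> = d * ((B / 2 + k_mass \<eta> / d\<^sup>2) * exp (c * x))"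
    using d_pos by (simp add: field_simps power2_eq_square)
  finally show ?thesis using d_pos by (simp add: E_def)
qed

text \<open>Iterating the preceding estimate from the Lipschitz bound \<open>1 / d\<close> leaves only the geometric series
of boundary terms.\<close>

lemma D_uniformly_cauchy:
  obtains c where "0 \<le> c"
    "\<And>\<epsilon> \<delta> \<eta> x. 0 < \<epsilon> \<Longrightarrow> \<epsilon> \<le> \<eta> \<Longrightarrow> 0 < \<delta> \<Longrightarrow> \<delta> \<le> \<eta> \<Longrightarrow> 0 \<le> x \<Longrightarrow>
      \<bar>D \<epsilon> x - D \<delta> x\<bar> \<le> 2 * k_mass \<eta> / d\<^sup>2 * exp (c * x)"
proof -
  obtain c where c: "1 \<le> c" "integrable lborel (\<lambda>r. exp (- c * r) * k r)"
    "(LINT r|lborel. exp (- c * r) * k r) \<le> d / 2"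
    by (rule laplace_weight_exists)
  have "\<bar>D \<epsilon> x - D \<delta> x\<bar> \<le> 2 * k_mass \<eta> / d\<^sup>2 * exp (c * x)"
    if \<epsilon>: "0 < \<epsilon>" "\<epsilon> \<le> \<eta>" and \<delta>: "0 < \<delta>" "\<delta> \<le> \<eta>" and x: "0 \<le> x" for \<epsilon> \<delta> \<eta> x
  proof -
    define A where "A = k_mass \<eta> / d\<^sup>2"
    have A: "0 \<le> A" using k_mass_nonneg by (simp add: A_def)
    have iter: "\<bar>D \<epsilon> x - D \<delta> x\<bar> \<le> (1 / d * (1 / 2) ^ n + 2 * A) * exp (c * x)" if "0 \<le> x" for n x
      using that
    proof (induction n arbitrary: x)
      case 0
      have "\<bar>D \<epsilon> x - D \<delta> x\<bar> \<le> 1 / d"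
        using D_bounds [OF \<epsilon>(1), of x] D_bounds [OF \<delta>(1), of x] by (simp add: abs_le_iff)
      also have "\<dots> \<le> 1 / d + 2 * A" using A by simp
      also have "\<dots> \<le> (1 / d + 2 * A) * exp (c * x)"
      proof -
        have "1 \<le> exp (c * x)" using c(1) 0 by simp
        moreover have "0 \<le> 1 / d + 2 * A" using A d_pos by simp
        ultimately show ?thesis using mult_left_mono by fastforce
      qed
      finally show ?case by simp
    next
      case (Suc n)
      have "\<bar>D \<epsilon> x - D \<delta> x\<bar> \<le> ((1 / d * (1 / 2) ^ n + 2 * A) / 2 + k_mass \<eta> / d\<^sup>2) * exp (c * x)"
        by (rule D_difference_step [OF c(2,3) _ \<epsilon> \<delta>]) (use c(1) A d_pos Suc in auto)
      also have "(1 / d * (1 / 2) ^ n + 2 * A) / 2 + k_mass \<eta> / d\<^sup>2 = 1 / d * (1 / 2) ^ Suc n + 2 * A"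
        unfolding A_def [symmetric] by (simp add: field_simps)
      finally show ?case .
    qed
    have "(\<lambda>n. (1 / d * (1 / 2) ^ n + 2 * A) * exp (c * x)) \<longlonglongrightarrow> (1 / d * 0 + 2 * A) * exp (c * x)"
      by (intro tendsto_intros LIMSEQ_power_zero) simp
    then have "\<bar>D \<epsilon> x - D \<delta> x\<bar> \<le> (1 / d * 0 + 2 * A) * exp (c * x)"
      by (rule LIMSEQ_le_const) (use iter x in auto)
    then show ?thesis by (simp add: A_def)
  qed
  then show thesis using c(1) by (intro that [of c]) auto
qed

text \<open>The quotients converge locally uniformly on the closed half-line, so their limit \<open>w\<close> is continuous
there. The right derivative is then \<open>w\<close> by definition. A left difference quotient at \<open>x\<close> is a
forward quotient at the nearby point \<open>y\<close>, which is close to \<open>w y\<close> uniformly in \<open>y\<close>, hence to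
\<open>w x\<close>.\<close>

theorem solution_differentiable:
  obtains w where "\<And>x. 0 < x \<Longrightarrow> (W has_real_derivative w x) (at x)"
    "\<And>x. 0 \<le> x \<Longrightarrow> (\<lambda>n. D (inverse (real (Suc n))) x) \<longlonglongrightarrow> w x"
proof -
  obtain c where c: "0 \<le> c" and cauchy: "\<And>\<epsilon> \<delta> \<eta> x. 0 < \<epsilon> \<Longrightarrow> \<epsilon> \<le> \<eta> \<Longrightarrow> 0 < \<delta> \<Longrightarrow> \<delta> \<le> \<eta> \<Longrightarrow> 0 \<le> x \<Longrightarrow>
      \<bar>D \<epsilon> x - D \<delta> x\<bar> \<le> 2 * k_mass \<eta> / d\<^sup>2 * exp (c * x)"
    by (rule D_uniformly_cauchy) blast
  define e where "e n = inverse (real (Suc n))" for n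
  have e: "0 < e n" for n by (simp add: e_def)
  have e_lim: "e \<longlonglongrightarrow> 0" unfolding e_def by (rule LIMSEQ_inverse_real_of_nat)
  define R where "R \<eta> x = 2 * k_mass \<eta> / d\<^sup>2 * exp (c * x)" for \<eta> x
  have R_lim: "(\<lambda>n. R (e n) x) \<longlonglongrightarrow> 0" for x
  proof -
    have "(\<lambda>n. 2 * k_mass (e n) / d\<^sup>2 * exp (c * x)) \<longlonglongrightarrow> 2 * 0 / d\<^sup>2 * exp (c * x)"
      unfolding e_def by (intro tendsto_intros k_mass_tendsto_0) (use d_pos in simp)
    then show ?thesis by (simp add: R_def)
  qed
  have R_mono: "R \<eta> x \<le> R \<eta>' x'" if "\<eta> \<le> \<eta>'" "x \<le> x'" for \<eta> \<eta>' x x'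
    unfolding R_def using that k_mass_mono [OF that(1)] k_mass_nonneg c
    by (intro mult_mono divide_right_mono) (auto intro: mult_left_mono)
  have "Cauchy (\<lambda>n. D (e n) x)" if x: "0 \<le> x" for x
  proof (rule metric_CauchyI)
    fix r :: real assume "0 < r"
    then obtain N where N: "R (e N) x < r"
      using eventually_happens' [OF sequentially_bot order_tendstoD(2) [OF R_lim]] by blast
    have "dist (D (e m) x) (D (e n) x) < r" if "N \<le> m" "N \<le> n" for m n
    proof -
      have "e m \<le> e N" "e n \<le> e N" using that by (auto simp: e_def)
      then show ?thesis
        using cauchy [OF e _ e _ x, of m "e N" n] N by (simp add: dist_real_def R_def)
    qed
    then show "\<exists>M. \<forall>m\<ge>M. \<forall>n\<ge>M. dist (D (e m) x) (D (e n) x) < r" by blast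
  qed
  then have "\<exists>l. (\<lambda>n. D (e n) x) \<longlonglongrightarrow> l" if "0 \<le> x" for x
    using that by (simp add: Cauchy_convergent_iff convergent_def)
  then obtain w where w: "\<And>x. 0 \<le> x \<Longrightarrow> (\<lambda>n. D (e n) x) \<longlonglongrightarrow> w x" by metis
  have close: "\<bar>D \<epsilon> x - w x\<bar> \<le> R \<epsilon> x" if "0 < \<epsilon>" "0 \<le> x" for \<epsilon> x
  proof -
    have lim: "(\<lambda>n. \<bar>D \<epsilon> x - D (e n) x\<bar>) \<longlonglongrightarrow> \<bar>D \<epsilon> x - w x\<bar>"
      by (intro tendsto_intros w that)
    have "eventually (\<lambda>n. e n < \<epsilon>) sequentially"
      using that by (intro order_tendstoD(2) [OF e_lim])
    then have "eventually (\<lambda>n. \<bar>D \<epsilon> x - D (e n) x\<bar> \<le> R \<epsilon> x) sequentially"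
      by eventually_elim (use cauchy [OF that(1) order_refl e _ that(2)] in \<open>simp add: R_def\<close>)
    then show ?thesis by (rule tendsto_upperbound [OF lim]) simp
  qed
  have w_cont: "continuous_on {0..T} w" for T
  proof (rule uniform_limit_theorem)
    show "uniform_limit {0..T} (\<lambda>n x. D (e n) x) w sequentially"
    proof (rule uniform_limitI)
      fix r :: real assume "0 < r"
      then have "eventually (\<lambda>n. R (e n) T < r) sequentially"
        by (rule order_tendstoD(2) [OF R_lim])
      then show "\<forall>\<^sub>F n in sequentially. \<forall>x\<in>{0..T}. dist (D (e n) x) (w x) < r"
      proof eventually_elim
        case (elim n)
        show ?case
        proof
          fix x assume x: "x \<in> {0..T}"
          then have "\<bar>D (e n) x - w x\<bar> \<le> R (e n) x" using close [OF e, of x n] by simp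
          also have "\<dots> \<le> R (e n) T" using x by (intro R_mono) auto
          finally show "dist (D (e n) x) (w x) < r" using elim by (simp add: dist_real_def)
        qed
      qed
    qed
    show "\<forall>\<^sub>F n in sequentially. continuous_on {0..T} (D (e n))"
    proof (intro always_eventually allI)
      fix n
      have "continuous_on {0..T} (\<lambda>x. W (x + e n))" "continuous_on {0..T} W"
        by (rule continuous_on_compose2 [OF W_continuous], auto intro!: continuous_intros)
          (rule continuous_on_subset [OF W_continuous], simp)
      then show "continuous_on {0..T} (D (e n))"
        unfolding D_def using e [of n] by (intro continuous_intros) auto
    qed
  qed simp
  have "(W has_real_derivative w x) (at x)" if x: "0 < x" for x
  proof -
    have w_isCont: "(w \<longlongrightarrow> w x) (at x)"
    proof -
      have "continuous (at x) w"
        by (rule continuous_on_interior [OF w_cont [of "x + 1"]]) (use x in \<open>simp add: interior_atLeastAtMost_real\<close>)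
      then show ?thesis by (simp add: isCont_def)
    qed
    have R_small: "((\<lambda>y. R \<bar>y - x\<bar> x) \<longlongrightarrow> 0) (at x)"
    proof (rule tendstoI)
      fix r :: real assume "0 < r"
      then obtain N where N: "R (e N) x < r"
        using eventually_happens' [OF sequentially_bot order_tendstoD(2) [OF R_lim]] by blast
      have "\<bar>R \<bar>y - x\<bar> x\<bar> < r" if "dist y x < e N" for y
      proof -
        have "R \<bar>y - x\<bar> x \<le> R (e N) x" using that by (intro R_mono) (auto simp: dist_real_def)
        moreover have "0 \<le> R \<bar>y - x\<bar> x" using k_mass_nonneg by (simp add: R_def)
        ultimately show ?thesis using N by simp
      qed
      then show "\<forall>\<^sub>F y in at x. dist (R \<bar>y - x\<bar> x) 0 < r"
        using e [of N] by (auto simp: eventually_at)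
    qed
    have bound: "norm ((W y - W x) / (y - x) - w x) \<le> R \<bar>y - x\<bar> x + \<bar>w y - w x\<bar>"
      if "0 < y" "y \<noteq> x" for y
    proof (cases "x < y")
      case True
      then have "(W y - W x) / (y - x) = D \<bar>y - x\<bar> x" by (simp add: D_def)
      then show ?thesis using close [of "\<bar>y - x\<bar>" x] True x by simp
    next
      case False
      then have "(W y - W x) / (y - x) = D \<bar>y - x\<bar> y"
        using that(2) by (simp add: D_def field_simps)
      moreover have "\<bar>D \<bar>y - x\<bar> y - w y\<bar> \<le> R \<bar>y - x\<bar> y"
        using that by (intro close) auto
      moreover have "R \<bar>y - x\<bar> y \<le> R \<bar>y - x\<bar> x" using False by (intro R_mono) auto
      ultimately show ?thesis by simp linarith
    qed
    have "((\<lambda>y. (W y - W x) / (y - x) - w x) \<longlongrightarrow> 0) (at x)"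
    proof (rule Lim_null_comparison)
      have "((\<lambda>y. R \<bar>y - x\<bar> x + \<bar>w y - w x\<bar>) \<longlongrightarrow> 0 + \<bar>w x - w x\<bar>) (at x)"
        by (intro tendsto_intros R_small w_isCont)
      then show "((\<lambda>y. R \<bar>y - x\<bar> x + \<bar>w y - w x\<bar>) \<longlongrightarrow> 0) (at x)" by simp
      show "\<forall>\<^sub>F y in at x. norm ((W y - W x) / (y - x) - w x) \<le> R \<bar>y - x\<bar> x + \<bar>w y - w x\<bar>"
        unfolding eventually_at
        by (intro exI [of _ x] conjI x ballI impI bound) (auto simp: dist_real_def)
    qed
    then show ?thesis
      unfolding has_field_derivative_iff by (simp add: LIM_zero_iff)
  qed
  with w show thesis unfolding e_def by (intro that)
qed

text \<open>The limit is extended by zero to the negative half-line, where the quotients vanish eventually. So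
it is a limit on the whole line, which makes it measurable and allows two-sided Laplace integrals.\<close>

corollary solution_derivative:
  obtains g where "g \<in> borel_measurable borel" "\<And>x. 0 \<le> g x"
    "\<And>x. 0 < x \<Longrightarrow> (W has_real_derivative g x) (at x)"
    "\<And>x. (\<lambda>n. D (inverse (real (Suc n))) x) \<longlonglongrightarrow> g x" "\<And>x. x < 0 \<Longrightarrow> g x = 0"
proof -
  obtain w where w: "\<And>x. 0 < x \<Longrightarrow> (W has_real_derivative w x) (at x)"
    "\<And>x. 0 \<le> x \<Longrightarrow> (\<lambda>n. D (inverse (real (Suc n))) x) \<longlonglongrightarrow> w x"
    using solution_differentiable by blast
  define g where "g x = (if 0 \<le> x then w x else 0)" for x
  have lim: "(\<lambda>n. D (inverse (real (Suc n))) x) \<longlonglongrightarrow> g x" for x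
  proof (cases "0 \<le> x")
    case False
    then have "eventually (\<lambda>n. inverse (real (Suc n)) < - x) sequentially"
      by (intro order_tendstoD(2) [OF LIMSEQ_inverse_real_of_nat]) simp
    then have "eventually (\<lambda>n. D (inverse (real (Suc n))) x = g x) sequentially"
      by eventually_elim (use False in \<open>simp add: g_def D_zero del: of_nat_Suc\<close>)
    then show ?thesis by (rule tendsto_eventually)
  qed (simp add: g_def w del: of_nat_Suc)
  show thesis
  proof (rule that)
    show "g \<in> borel_measurable borel"
      by (rule borel_measurable_LIMSEQ_real [OF lim]) simp
    show "0 \<le> g x" for x
      by (rule LIMSEQ_le_const [OF lim]) (use D_bounds(1) in \<open>simp del: of_nat_Suc\<close>)
    show "(W has_real_derivative g x) (at x)" if "0 < x" for x
      using w(1) [OF that] that by (simp add: g_def)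
    show "g x = 0" if "x < 0" for x
      using that by (simp add: g_def)
  qed (rule lim)
qed

end

section \<open>Laplace transforms of the scale function\<close>

text \<open>The antiderivative is \<open>exp (- \<theta> r) ((r - s) / \<theta> + 1 / \<theta>\<^sup>2)\<close>.\<close>

lemma nn_integral_laplace_excess:
  fixes \<theta> s :: real
  assumes "0 < \<theta>" "0 < s"
  shows "(\<integral>\<^sup>+r. ennreal (exp (- \<theta> * r)) * ennreal (s - r) * indicator {0<..} r \<partial>lborel)
    = ennreal ((exp (- \<theta> * s) - 1 + \<theta> * s) / \<theta>\<^sup>2)"
proof -
  define F where "F r = exp (- \<theta> * r) * ((r - s) / \<theta> + 1 / \<theta>\<^sup>2)" for r
  have "AE r in lborel. ennreal (exp (- \<theta> * r)) * ennreal (s - r) * indicator {0<..} r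
      = ennreal (exp (- \<theta> * r) * (s - r)) * indicator {0..s} r"
    using AE_lborel_singleton [of 0]
    by eventually_elim (auto simp: indicator_def ennreal_mult' ennreal_neg)
  then have "(\<integral>\<^sup>+r. ennreal (exp (- \<theta> * r)) * ennreal (s - r) * indicator {0<..} r \<partial>lborel)
      = (\<integral>\<^sup>+r. ennreal (exp (- \<theta> * r) * (s - r)) * indicator {0..s} r \<partial>lborel)"
    by (rule nn_integral_cong_AE)
  also have "\<dots> = ennreal (F s - F 0)"
  proof (rule nn_integral_FTC_Icc)
    fix r assume "r \<in> {0..s}"
    show "(F has_real_derivative exp (- \<theta> * r) * (s - r)) (at r)"
      unfolding F_def using assms
      by (auto intro!: derivative_eq_intros simp: field_simps power2_eq_square)
  qed (use assms in auto)
  also have "F s - F 0 = (exp (- \<theta> * s) - 1 + \<theta> * s) / \<theta>\<^sup>2"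
    using assms by (simp add: F_def field_simps power2_eq_square)
  finally show ?thesis .
qed

lemma nn_integral_exp_Ici:
  fixes \<theta> :: real
  assumes "0 < \<theta>"
  shows "(\<integral>\<^sup>+x. ennreal (exp (- \<theta> * x)) * indicator {a..} x \<partial>lborel) = ennreal (exp (- \<theta> * a) / \<theta>)"
proof -
  have "((\<lambda>x. - exp (- (\<theta> * x)) / \<theta>) \<longlongrightarrow> - 0 / \<theta>) at_top"
  proof (intro tendsto_intros filterlim_compose [OF exp_at_bot])
    show "filterlim (\<lambda>x. - (\<theta> * x)) at_bot at_top"
      using assms by (simp add: filterlim_uminus_at_bot filterlim_tendsto_pos_mult_at_top [OF tendsto_const] filterlim_ident)
  qed (use assms in auto)
  then have "(\<integral>\<^sup>+x. ennreal (exp (- \<theta> * x)) * indicator {a..} x \<partial>lborel)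
      = ennreal (0 - (- exp (- (\<theta> * a)) / \<theta>))"
    using assms by (intro nn_integral_FTC_atLeast) (auto intro!: derivative_eq_intros)
  then show ?thesis by simp
qed

lemma nn_integral_exp_times_id:
  fixes \<theta> :: real
  assumes "0 < \<theta>"
  shows "(\<integral>\<^sup>+x. ennreal (exp (- \<theta> * x)) * ennreal x * indicator {0..} x \<partial>lborel) = ennreal (1 / \<theta>\<^sup>2)"
proof -
  define g where "g x = ennreal (x ^ 1 * exp (- x)) * indicator {0..} x" for x :: real
  have [measurable]: "g \<in> borel_measurable borel" unfolding g_def by measurable
  have "(\<integral>\<^sup>+x. ennreal (exp (- \<theta> * x)) * ennreal x * indicator {0..} x \<partial>lborel)
      = (\<integral>\<^sup>+x. ennreal (x ^ 1 * exp (- (\<theta> * x))) * indicator {0..} x \<partial>lborel)"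
    by (intro nn_integral_cong) (auto simp: indicator_def ennreal_mult' [symmetric] mult.commute)
  also have "\<dots> = (\<integral>\<^sup>+x. ennreal (1 / \<theta>) * g (0 + \<theta> * x) \<partial>lborel)"
    unfolding g_def using assms
    by (intro nn_integral_cong) (auto simp: indicator_def ennreal_mult' [symmetric] zero_le_mult_iff)
  also have "\<dots> = ennreal (1 / \<theta>) * ennreal (1 / \<theta>) * (ennreal \<theta> * (\<integral>\<^sup>+x. g (0 + \<theta> * x) \<partial>lborel))"
  proof -
    have "ennreal (1 / \<theta>) * ennreal \<theta> = 1"
      using assms by (simp add: ennreal_mult' [symmetric])
    then have "ennreal (1 / \<theta>) * (ennreal \<theta> * I) = I" for I
      by (simp add: mult.assoc [symmetric])
    then show ?thesis by (subst nn_integral_cmult) (auto simp: mult.assoc)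
  qed
  also have "ennreal \<theta> * (\<integral>\<^sup>+x. g (0 + \<theta> * x) \<partial>lborel) = (\<integral>\<^sup>+x. g x \<partial>lborel)"
    using nn_integral_real_affine [of g \<theta> 0] assms by simp
  also have "\<dots> = 1"
    unfolding g_def by (subst nn_intergal_power_times_exp_Ici) simp
  also have "ennreal (1 / \<theta>) * ennreal (1 / \<theta>) * 1 = ennreal (1 / \<theta>\<^sup>2)"
    using assms by (simp add: ennreal_mult' [symmetric] power2_eq_square)
  finally show ?thesis .
qed

lemma AE_lborel_exists_between:
  fixes a b :: real
  assumes "AE x in lborel. P x" "a < b"
  obtains x where "a < x" "x < b" "P x"
proof (rule ccontr)
  assume no: "\<not> thesis"
  obtain N where N: "{x \<in> space lborel. \<not> P x} \<subseteq> N" "emeasure lborel N = 0" "N \<in> sets lborel"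
    using assms(1) by (rule AE_E)
  have "{a<..<b} \<subseteq> N"
  proof (rule subsetI, rule ccontr)
    fix x assume "x \<in> {a<..<b}" "x \<notin> N"
    moreover from this have "P x" using N(1) by auto
    ultimately show False using no that by auto
  qed
  then have "emeasure lborel {a<..<b} \<le> emeasure lborel N" using N(3) by (rule emeasure_mono)
  then show False using N(2) assms(2) by simp
qed

lemma exp_difference_quotient:
  "(\<lambda>n. (exp (\<theta> * inverse (real (Suc n))) - 1) / inverse (real (Suc n))) \<longlonglongrightarrow> (\<theta> :: real)"
proof -
  have "((\<lambda>e. exp (\<theta> * e)) has_real_derivative \<theta>) (at 0)"
    by (auto intro!: derivative_eq_intros)
  then have "\<forall>X. (\<forall>i. X i \<in> UNIV - {0}) \<longrightarrow> X \<longlonglongrightarrow> 0 \<longrightarrow> (\<lambda>n. (exp (\<theta> * X n) - exp (\<theta> * 0)) / (X n - 0)) \<longlonglongrightarrow> \<theta>"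
    unfolding has_field_derivative_iff tendsto_at_iff_sequentially comp_def .
  from this [rule_format, of "\<lambda>n. inverse (real (Suc n))"] LIMSEQ_inverse_real_of_nat
  show ?thesis by (simp del: of_nat_Suc)
qed

text \<open>Since the scale function vanishes to the left of the origin, its Laplace integrals are written over
the whole line, where they behave well under translations.\<close>

locale branching_scale = branching +
  fixes W :: "real \<Rightarrow> real"
  assumes scale: "scale_function \<psi> W"
begin

lemma W_nonneg: "0 \<le> W x"
  using scale by (cases "x < 0") (auto simp: scale_function_def)

lemma W_negative: "x < 0 \<Longrightarrow> W x = 0"
  using scale by (simp add: scale_function_def)

lemma W_mono: "mono W"
proof (rule monoI)
  fix x y :: real assume "x \<le> y"
  show "W x \<le> W y"
  proof (cases "x < 0")
    case True
    then show ?thesis using W_nonneg by (simp add: W_negative)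
  next
    case False
    then have "strict_mono_on {0..} W" "x \<in> {0..}" "y \<in> {0..}"
      using scale \<open>x \<le> y\<close> by (auto simp: scale_function_def)
    then show ?thesis using \<open>x \<le> y\<close> by (auto simp: strict_mono_on_leD)
  qed
qed

lemma W_measurable [measurable]: "W \<in> borel_measurable borel"
  using W_mono by (rule borel_measurable_mono)

lemma nn_laplace_W:
  assumes \<theta>: "0 < \<theta>"
  shows "(\<integral>\<^sup>+x. ennreal (exp (- \<theta> * x)) * ennreal (W x) \<partial>lborel) = ennreal (1 / \<psi> \<theta>)"
proof -
  have eq: "(LINT x|lborel. indicator {0..} x * (exp (- \<theta> * x) * W x)) = 1 / \<psi> \<theta>"
    using scale \<theta> by (auto simp: scale_function_def set_lebesgue_integral_def)
  have drop: "indicator {0..} x * (exp (- \<theta> * x) * W x) = exp (- \<theta> * x) * W x" for x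
    by (auto simp: indicator_def W_negative)
  have "integrable lborel (\<lambda>x. exp (- \<theta> * x) * W x)"
    using eq psi_pos [OF \<theta>] not_integrable_integral_eq unfolding drop by fastforce
  then have "(\<integral>\<^sup>+x. ennreal (exp (- \<theta> * x) * W x) \<partial>lborel) = ennreal (1 / \<psi> \<theta>)"
    using eq unfolding drop by (subst nn_integral_eq_integral) (auto intro!: AE_I2 simp: W_nonneg)
  then show ?thesis by (simp add: ennreal_mult' W_nonneg)
qed

lemma nn_laplace_W_shift:
  assumes \<theta>: "0 < \<theta>"
  shows "(\<integral>\<^sup>+x. ennreal (exp (- \<theta> * x)) * ennreal (W (x - r)) \<partial>lborel) = ennreal (exp (- \<theta> * r) / \<psi> \<theta>)"
proof -
  have "(\<integral>\<^sup>+x. ennreal (exp (- \<theta> * x)) * ennreal (W (x - r)) \<partial>lborel)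
      = (\<integral>\<^sup>+x. ennreal (exp (- \<theta> * (r + 1 * x))) * ennreal (W (r + 1 * x - r)) \<partial>lborel)"
    by (subst nn_integral_real_affine [where c = 1 and t = r]) auto
  also have "\<dots> = (\<integral>\<^sup>+x. ennreal (exp (- \<theta> * r)) * (ennreal (exp (- \<theta> * x)) * ennreal (W x)) \<partial>lborel)"
    by (intro nn_integral_cong)
      (simp add: ennreal_mult' [symmetric] exp_add [symmetric] algebra_simps mult.assoc [symmetric])
  also have "\<dots> = ennreal (exp (- \<theta> * r)) * ennreal (1 / \<psi> \<theta>)"
    by (subst nn_integral_cmult) (auto simp: nn_laplace_W [OF \<theta>, simplified])
  also have "\<dots> = ennreal (exp (- \<theta> * r) / \<psi> \<theta>)"
    by (simp add: ennreal_mult' [symmetric])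
  finally show ?thesis .
qed

lemma nn_laplace_W_increment:
  assumes \<theta>: "0 < \<theta>" and r: "0 \<le> r"
  shows "(\<integral>\<^sup>+x. ennreal (exp (- \<theta> * x)) * ennreal (W x - W (x - r)) \<partial>lborel)
    = ennreal ((1 - exp (- \<theta> * r)) / \<psi> \<theta>)"
proof -
  have "(\<integral>\<^sup>+x. ennreal (exp (- \<theta> * x)) * ennreal (W x - W (x - r)) \<partial>lborel)
      = (\<integral>\<^sup>+x. ennreal (exp (- \<theta> * x)) * ennreal (W x) - ennreal (exp (- \<theta> * x)) * ennreal (W (x - r)) \<partial>lborel)"
    by (intro nn_integral_cong)
      (simp add: ennreal_mult' [symmetric] ennreal_minus W_nonneg right_diff_distrib)
  also have "\<dots> = ennreal (1 / \<psi> \<theta>) - ennreal (exp (- \<theta> * r) / \<psi> \<theta>)"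
  proof (subst nn_integral_diff)
    show "AE x in lborel. ennreal (exp (- \<theta> * x)) * ennreal (W (x - r)) \<le> ennreal (exp (- \<theta> * x)) * ennreal (W x)"
      using r monoD [OF W_mono] by (intro AE_I2 mult_left_mono ennreal_leI) auto
  qed (simp_all only: nn_laplace_W [OF \<theta>] nn_laplace_W_shift [OF \<theta>], auto)
  also have "\<dots> = ennreal ((1 - exp (- \<theta> * r)) / \<psi> \<theta>)"
    using psi_pos [OF \<theta>] by (subst ennreal_minus) (auto simp: diff_divide_distrib)
  finally show ?thesis .
qed

text \<open>The function \<open>\<alpha> + \<integral> max 0 (s - r) \<pi>(ds)\<close>; the positive part is implicit in the embedding into
the extended nonnegative reals. It is the kernel of the Volterra equation, with transform
\<open>\<psi> \<theta> / \<theta>\<^sup>2 - \<sigma>\<^sup>2 / 2\<close>.\<close>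

definition memory :: "real \<Rightarrow> ennreal" where
  "memory r = ennreal \<alpha> + (\<integral>\<^sup>+s. ennreal (s - r) \<partial>\<pi>)"

lemma memory_measurable [measurable]: "memory \<in> borel_measurable borel"
proof -
  have "(\<lambda>r. \<integral>\<^sup>+s. ennreal (s - r) \<partial>\<pi>) \<in> borel_measurable borel"
    by (rule pi.borel_measurable_nn_integral, rule measurable_pair_pi) measurable
  then show ?thesis unfolding memory_def by measurable
qed

lemma memory_antimono: "r \<le> s \<Longrightarrow> memory s \<le> memory r"
  unfolding memory_def by (intro add_left_mono nn_integral_mono ennreal_leI) simp

lemma memory_finite:
  assumes r: "0 < r" shows "memory r < \<infinity>"
proof -
  have "(\<integral>\<^sup>+s. ennreal (s - r) \<partial>\<pi>) \<le> (\<integral>\<^sup>+s. ennreal (max 1 (1 / r) * min s (s\<^sup>2)) \<partial>\<pi>)"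
  proof (intro nn_integral_mono ennreal_leI)
    fix s assume "s \<in> space \<pi>"
    then have s: "0 < s" by simp
    show "s - r \<le> max 1 (1 / r) * min s (s\<^sup>2)"
    proof (cases "r \<le> s")
      case True
      have "s \<le> 1 / r * s\<^sup>2" using True r s by (simp add: power2_eq_square pos_le_divide_eq)
      also have "\<dots> \<le> max 1 (1 / r) * s\<^sup>2" by (rule mult_right_mono) auto
      finally have "s \<le> max 1 (1 / r) * s\<^sup>2" .
      moreover have "1 * s \<le> max 1 (1 / r) * s" using s by (intro mult_right_mono) auto
      ultimately have "s \<le> max 1 (1 / r) * min s (s\<^sup>2)"
        by (auto simp only: min_def mult_1_left split: if_splits)
      then show ?thesis using r by simp
    next
      case False
      moreover have "0 \<le> max 1 (1 / r) * min s (s\<^sup>2)" using s by simp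
      ultimately show ?thesis by simp
    qed
  qed
  also have "\<dots> = ennreal (LINT s|\<pi>. max 1 (1 / r) * min s (s\<^sup>2))"
    by (rule nn_integral_eq_integral) (use min_integrable in \<open>auto intro!: AE_I2\<close>)
  also have "\<dots> < \<infinity>" by simp
  finally show ?thesis by (simp add: memory_def)
qed

lemma nn_laplace_memory:
  assumes \<theta>: "0 < \<theta>"
  shows "(\<integral>\<^sup>+r. ennreal (exp (- \<theta> * r)) * memory r * indicator {0<..} r \<partial>lborel)
    = ennreal (\<psi> \<theta> / \<theta>\<^sup>2 - \<sigma>\<^sup>2 / 2)"
proof -
  define J where "J = (LINT s|\<pi>. exp (- \<theta> * s) - 1 + \<theta> * s)"
  have J: "0 \<le> J"
    unfolding J_def by (rule integral_nonneg_AE) (rule AE_I2, rule compensated_kernel_nonneg)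
  have "(\<integral>\<^sup>+r. ennreal (exp (- \<theta> * r)) * memory r * indicator {0<..} r \<partial>lborel)
      = (\<integral>\<^sup>+r. ennreal \<alpha> * (ennreal (exp (- \<theta> * r)) * indicator {0<..} r) +
          (\<integral>\<^sup>+s. ennreal (exp (- \<theta> * r)) * ennreal (s - r) * indicator {0<..} r \<partial>\<pi>) \<partial>lborel)"
    by (intro nn_integral_cong)
      (simp add: memory_def distrib_left distrib_right nn_integral_cmult nn_integral_multc mult_ac)
  also have "\<dots> = ennreal \<alpha> * (\<integral>\<^sup>+r. ennreal (exp (- \<theta> * r)) * indicator {0<..} r \<partial>lborel) +
      (\<integral>\<^sup>+r. \<integral>\<^sup>+s. ennreal (exp (- \<theta> * r)) * ennreal (s - r) * indicator {0<..} r \<partial>\<pi> \<partial>lborel)"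
    by (subst nn_integral_add) (auto simp: nn_integral_cmult
        intro!: pi.borel_measurable_nn_integral measurable_pair_pi)
  also have "(\<integral>\<^sup>+r. ennreal (exp (- \<theta> * r)) * indicator {0<..} r \<partial>lborel) = ennreal (1 / \<theta>)"
  proof -
    have "(\<integral>\<^sup>+r. ennreal (exp (- \<theta> * r)) * indicator {0<..} r \<partial>lborel)
        = (\<integral>\<^sup>+r. ennreal (exp (- \<theta> * r)) * indicator {0..} r \<partial>lborel)"
      by (rule nn_integral_cong_AE)
        (use AE_lborel_singleton [of 0] in eventually_elim, auto simp: indicator_def)
    then show ?thesis using nn_integral_exp_Ici [OF \<theta>, of 0] by simp
  qed
  also have "(\<integral>\<^sup>+r. \<integral>\<^sup>+s. ennreal (exp (- \<theta> * r)) * ennreal (s - r) * indicator {0<..} r \<partial>\<pi> \<partial>lborel)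
      = (\<integral>\<^sup>+s. \<integral>\<^sup>+r. ennreal (exp (- \<theta> * r)) * ennreal (s - r) * indicator {0<..} r \<partial>lborel \<partial>\<pi>)"
  proof -
    interpret P: pair_sigma_finite lborel \<pi> ..
    show ?thesis by (rule P.Fubini' [symmetric], rule measurable_pair_pi) measurable
  qed
  also have "\<dots> = (\<integral>\<^sup>+s. ennreal ((exp (- \<theta> * s) - 1 + \<theta> * s) / \<theta>\<^sup>2) \<partial>\<pi>)"
    by (rule nn_integral_cong) (use nn_integral_laplace_excess [OF \<theta>] in simp)
  also have "\<dots> = ennreal (J / \<theta>\<^sup>2)"
    unfolding J_def integral_divide_zero [symmetric]
  proof (rule nn_integral_eq_integral)
    show "integrable \<pi> (\<lambda>s. (exp (- \<theta> * s) - 1 + \<theta> * s) / \<theta>\<^sup>2)"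
      using compensated_integrable [of \<theta>] \<theta> by simp
    show "AE s in \<pi>. 0 \<le> (exp (- \<theta> * s) - 1 + \<theta> * s) / \<theta>\<^sup>2"
      by (rule AE_I2) (rule divide_nonneg_nonneg [OF compensated_kernel_nonneg], simp)
  qed
  also have "ennreal \<alpha> * ennreal (1 / \<theta>) + ennreal (J / \<theta>\<^sup>2) = ennreal (\<alpha> * (1 / \<theta>) + J / \<theta>\<^sup>2)"
    using alpha_nonneg \<theta> J by (simp add: ennreal_mult' [symmetric] ennreal_plus [symmetric] del: ennreal_plus)
  also have "\<alpha> * (1 / \<theta>) + J / \<theta>\<^sup>2 = \<psi> \<theta> / \<theta>\<^sup>2 - \<sigma>\<^sup>2 / 2"
  proof -
    have "\<psi> \<theta> = \<alpha> * \<theta> + 1 / 2 * \<sigma>\<^sup>2 * \<theta>\<^sup>2 + J" by (simp only: branching_mechanism_def J_def)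
    then show ?thesis using \<theta> by (simp add: field_simps power2_eq_square)
  qed
  finally show ?thesis .
qed

definition memory_convolution :: "real \<Rightarrow> ennreal" where
  "memory_convolution x = (\<integral>\<^sup>+r. ennreal (W (x - r)) * memory r * indicator {0<..} r \<partial>lborel)"

lemma memory_convolution_measurable [measurable]: "memory_convolution \<in> borel_measurable borel"
  unfolding memory_convolution_def by measurable

lemma memory_convolution_mono: "x \<le> y \<Longrightarrow> memory_convolution x \<le> memory_convolution y"
  unfolding memory_convolution_def
  by (intro nn_integral_mono mult_right_mono ennreal_leI monoD [OF W_mono]) auto

lemma memory_convolution_zero: "x \<le> 0 \<Longrightarrow> memory_convolution x = 0"
  unfolding memory_convolution_def by (intro nn_integral_zero' AE_I2) (auto simp: indicator_def W_negative)

lemma nn_laplace_memory_convolution: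
  assumes \<theta>: "0 < \<theta>"
  shows "(\<integral>\<^sup>+x. ennreal (exp (- \<theta> * x)) * memory_convolution x \<partial>lborel)
    = ennreal (1 / \<psi> \<theta>) * ennreal (\<psi> \<theta> / \<theta>\<^sup>2 - \<sigma>\<^sup>2 / 2)"
proof -
  have "(\<integral>\<^sup>+x. ennreal (exp (- \<theta> * x)) * memory_convolution x \<partial>lborel)
      = (\<integral>\<^sup>+x. \<integral>\<^sup>+r. ennreal (exp (- \<theta> * x)) * ennreal (W (x - r)) * (memory r * indicator {0<..} r) \<partial>lborel \<partial>lborel)"
    unfolding memory_convolution_def by (intro nn_integral_cong) (simp add: nn_integral_cmult [symmetric] mult.assoc)
  also have "\<dots> = (\<integral>\<^sup>+r. \<integral>\<^sup>+x. ennreal (exp (- \<theta> * x)) * ennreal (W (x - r)) * (memory r * indicator {0<..} r) \<partial>lborel \<partial>lborel)"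
    by (rule lborel_pair.Fubini' [symmetric]) measurable
  also have "\<dots> = (\<integral>\<^sup>+r. ennreal (exp (- \<theta> * r) / \<psi> \<theta>) * (memory r * indicator {0<..} r) \<partial>lborel)"
    by (rule nn_integral_cong) (subst nn_integral_multc, measurable, simp only: nn_laplace_W_shift [OF \<theta>])
  also have "\<dots> = (\<integral>\<^sup>+r. ennreal (1 / \<psi> \<theta>) * (ennreal (exp (- \<theta> * r)) * memory r * indicator {0<..} r) \<partial>lborel)"
  proof (rule nn_integral_cong)
    fix r :: real
    have "ennreal (exp (- \<theta> * r) / \<psi> \<theta>) = ennreal (1 / \<psi> \<theta>) * ennreal (exp (- \<theta> * r))"
      using psi_pos [OF \<theta>] by (simp add: ennreal_mult' [symmetric])
    then show "ennreal (exp (- \<theta> * r) / \<psi> \<theta>) * (memory r * indicator {0<..} r)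
        = ennreal (1 / \<psi> \<theta>) * (ennreal (exp (- \<theta> * r)) * memory r * indicator {0<..} r)"
      by (simp only: mult.assoc)
  qed
  also have "\<dots> = ennreal (1 / \<psi> \<theta>) * ennreal (\<psi> \<theta> / \<theta>\<^sup>2 - \<sigma>\<^sup>2 / 2)"
    by (subst nn_integral_cmult) (measurable, simp only: nn_laplace_memory [OF \<theta>])
  finally show ?thesis .
qed

lemma psi_ge_gaussian:
  assumes "0 < \<theta>" shows "\<sigma>\<^sup>2 / 2 * \<theta>\<^sup>2 \<le> \<psi> \<theta>"
proof -
  have "0 \<le> (LINT s|\<pi>. exp (- \<theta> * s) - 1 + \<theta> * s)"
    by (rule integral_nonneg_AE) (rule AE_I2, rule compensated_kernel_nonneg)
  then show ?thesis using alpha_nonneg assms by (simp add: branching_mechanism_def)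
qed

text \<open>Both sides have the transform \<open>1 / \<theta>\<^sup>2\<close>, so they agree almost everywhere on the half-line. The
left-hand side is increasing and the right-hand side is continuous, which upgrades this to every
point.\<close>

lemma renewal_equation:
  assumes "0 \<le> x"
  shows "ennreal (\<sigma>\<^sup>2 / 2 * W x) + memory_convolution x = ennreal x"
proof -
  define f where "f x = ennreal (\<sigma>\<^sup>2 / 2 * W x) + memory_convolution x" for x
  have [measurable]: "f \<in> borel_measurable borel" unfolding f_def by measurable
  have f_mono: "f x \<le> f y" if "x \<le> y" for x y
    unfolding f_def using that monoD [OF W_mono that]
    by (intro add_mono ennreal_leI mult_left_mono memory_convolution_mono) auto
  have AE: "AE x in lborel. 0 \<le> x \<longrightarrow> f x = ennreal x"
  proof (rule nn_laplace_transform_unique)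
    fix \<theta> :: real assume \<theta>: "0 < \<theta>"
    show "(\<integral>\<^sup>+x. ennreal (exp (- \<theta> * x)) * ennreal x * indicator {0..} x \<partial>lborel) < \<infinity>"
      unfolding nn_integral_exp_times_id [OF \<theta>] by simp
    have "(\<integral>\<^sup>+x. ennreal (exp (- \<theta> * x)) * f x * indicator {0..} x \<partial>lborel)
        = (\<integral>\<^sup>+x. ennreal (\<sigma>\<^sup>2 / 2) * (ennreal (exp (- \<theta> * x)) * ennreal (W x))
            + ennreal (exp (- \<theta> * x)) * memory_convolution x \<partial>lborel)"
    proof (rule nn_integral_cong)
      fix x :: real
      show "ennreal (exp (- \<theta> * x)) * f x * indicator {0..} x
          = ennreal (\<sigma>\<^sup>2 / 2) * (ennreal (exp (- \<theta> * x)) * ennreal (W x))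
            + ennreal (exp (- \<theta> * x)) * memory_convolution x"
        by (cases "x < 0")
          (auto simp: f_def W_negative memory_convolution_zero ennreal_mult' [symmetric] W_nonneg distrib_left
            mult.commute mult.left_commute)
    qed
    also have "\<dots> = ennreal (\<sigma>\<^sup>2 / 2) * ennreal (1 / \<psi> \<theta>)
        + ennreal (1 / \<psi> \<theta>) * ennreal (\<psi> \<theta> / \<theta>\<^sup>2 - \<sigma>\<^sup>2 / 2)"
      by (subst nn_integral_add, measurable, subst nn_integral_cmult, measurable)
        (simp only: nn_laplace_W [OF \<theta>] nn_laplace_memory_convolution [OF \<theta>])
    also have "\<dots> = ennreal (\<sigma>\<^sup>2 / 2 * (1 / \<psi> \<theta>) + 1 / \<psi> \<theta> * (\<psi> \<theta> / \<theta>\<^sup>2 - \<sigma>\<^sup>2 / 2))"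
    proof -
      have "0 \<le> \<psi> \<theta> / \<theta>\<^sup>2 - \<sigma>\<^sup>2 / 2"
        using psi_ge_gaussian [OF \<theta>] \<theta> by (simp add: field_simps)
      then show ?thesis
        using psi_pos [OF \<theta>]
        by (simp add: ennreal_mult [symmetric] ennreal_plus [symmetric] del: ennreal_plus)
    qed
    also have "\<sigma>\<^sup>2 / 2 * (1 / \<psi> \<theta>) + 1 / \<psi> \<theta> * (\<psi> \<theta> / \<theta>\<^sup>2 - \<sigma>\<^sup>2 / 2) = 1 / \<theta>\<^sup>2"
      using psi_pos [OF \<theta>] \<theta> by (simp add: field_simps)
    finally show "(\<integral>\<^sup>+x. ennreal (exp (- \<theta> * x)) * f x * indicator {0..} x \<partial>lborel)
        = (\<integral>\<^sup>+x. ennreal (exp (- \<theta> * x)) * ennreal x * indicator {0..} x \<partial>lborel)"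
      using nn_integral_exp_times_id [OF \<theta>] by simp
  qed measurable
  have le: "f x \<le> ennreal y" if xy: "x < y" for y
  proof -
    obtain z where "x < z" "z < y" "0 \<le> z \<longrightarrow> f z = ennreal z"
      using AE_lborel_exists_between [OF AE xy] by blast
    then have "f x \<le> ennreal z" using f_mono [of x z] assms by simp
    also have "\<dots> \<le> ennreal y" using \<open>z < y\<close> by (intro ennreal_leI) simp
    finally show ?thesis .
  qed
  have ge: "ennreal y \<le> f x" if y: "0 \<le> y" and yx: "y < x" for y
  proof -
    obtain z where "y < z" "z < x" "0 \<le> z \<longrightarrow> f z = ennreal z"
      using AE_lborel_exists_between [OF AE yx] by blast
    then have "ennreal z \<le> f x" using f_mono [of z x] y by simp
    moreover have "ennreal y \<le> ennreal z" using \<open>y < z\<close> by (intro ennreal_leI) simp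
    ultimately show ?thesis by (rule order_trans [rotated])
  qed
  have "f x \<le> ennreal (x + 1)" by (rule le) simp
  also have "\<dots> < \<infinity>" by simp
  finally obtain v where v: "f x = ennreal v" "0 \<le> v" by (cases "f x") auto
  have "v \<le> x"
    by (rule dense_ge) (use le v assms in \<open>auto simp: ennreal_le_iff\<close>)
  moreover have "x \<le> v"
  proof (rule dense_le)
    fix y assume "y < x"
    then show "y \<le> v" using ge [of y] v by (cases "0 \<le> y") (auto simp: ennreal_le_iff)
  qed
  ultimately show ?thesis using v unfolding f_def by simp
qed

definition memory_kernel :: "real \<Rightarrow> real" where
  "memory_kernel r = enn2real (memory r) * indicator {0<..} r"

lemma memory_kernel_measurable [measurable]: "memory_kernel \<in> borel_measurable borel"
  unfolding memory_kernel_def by measurable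

lemma memory_kernel_nonneg: "0 \<le> memory_kernel r"
  by (simp add: memory_kernel_def)

lemma ennreal_memory_kernel: "ennreal (memory_kernel r) = memory r * indicator {0<..} r"
  using memory_finite [of r] by (auto simp: memory_kernel_def indicator_def)

lemma memory_convolution_eq_kernel:
  "memory_convolution x = (\<integral>\<^sup>+r. ennreal (memory_kernel r * W (x - r)) \<partial>lborel)"
  unfolding memory_convolution_def
  by (intro nn_integral_cong)
    (simp add: ennreal_mult memory_kernel_nonneg W_nonneg ennreal_memory_kernel mult_ac)

lemma memory_convolution_finite: "memory_convolution x < \<infinity>"
proof (cases "0 \<le> x")
  case True
  have "memory_convolution x \<le> ennreal (\<sigma>\<^sup>2 / 2 * W x) + memory_convolution x" by simp
  also have "\<dots> = ennreal x" by (rule renewal_equation [OF True])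
  also have "\<dots> < \<infinity>" by simp
  finally show ?thesis .
qed (simp add: memory_convolution_zero)

lemma volterra_equation:
  assumes "0 < \<sigma>"
  shows "volterra (\<sigma>\<^sup>2 / 2) memory_kernel W"
proof
  show "memory_kernel s \<le> memory_kernel r" if "0 < r" "r \<le> s" for r s
    using memory_antimono [OF that(2)] memory_finite [OF that(1)] that
    by (auto simp: memory_kernel_def intro!: enn2real_mono)
  show "integrable lborel (\<lambda>r. exp (- r) * memory_kernel r)"
  proof (rule integrableI_nonneg)
    have "(\<integral>\<^sup>+r. ennreal (exp (- r) * memory_kernel r) \<partial>lborel)
        = (\<integral>\<^sup>+r. ennreal (exp (- 1 * r)) * memory r * indicator {0<..} r \<partial>lborel)"
      by (intro nn_integral_cong) (simp add: ennreal_mult' ennreal_memory_kernel mult.assoc)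
    then show "(\<integral>\<^sup>+r. ennreal (exp (- r) * memory_kernel r) \<partial>lborel) < \<infinity>"
      using nn_laplace_memory [of 1] by simp
  qed (auto simp: memory_kernel_nonneg)
  show int: "integrable lborel (\<lambda>r. memory_kernel r * W (x - r))" for x
    by (rule integrableI_nonneg)
      (use memory_convolution_finite [of x] in \<open>auto simp: memory_convolution_eq_kernel memory_kernel_nonneg W_nonneg\<close>)
  show "\<sigma>\<^sup>2 / 2 * W x + (LINT r|lborel. memory_kernel r * W (x - r)) = max 0 x" for x
  proof -
    define I where "I = (LINT r|lborel. memory_kernel r * W (x - r))"
    have I: "0 \<le> I" "memory_convolution x = ennreal I"
      unfolding I_def memory_convolution_eq_kernel
      by (auto intro!: integral_nonneg_AE nn_integral_eq_integral int AE_I2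
          simp: memory_kernel_nonneg W_nonneg)
    have "\<sigma>\<^sup>2 / 2 * W x + I = max 0 x"
    proof (cases "0 \<le> x")
      case True
      have "ennreal (\<sigma>\<^sup>2 / 2 * W x + I) = ennreal x"
        using renewal_equation [OF True] I W_nonneg [of x] by (simp add: ennreal_plus)
      then show ?thesis
        by (subst (asm) ennreal_inj) (use True I(1) W_nonneg [of x] in auto)
    next
      case False
      then show ?thesis using I memory_convolution_zero [of x] by (simp add: W_negative)
    qed
    then show ?thesis by (simp add: I_def)
  qed
qed (use assms in \<open>auto simp: memory_kernel_nonneg W_mono W_negative, simp add: memory_kernel_def\<close>)

lemma W_shift_integral:
  assumes \<theta>: "0 < \<theta>"
  shows "integrable lborel (\<lambda>x. exp (- \<theta> * x) * W (x - r))"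
    and "(LINT x|lborel. exp (- \<theta> * x) * W (x - r)) = exp (- \<theta> * r) / \<psi> \<theta>"
proof -
  have nn: "(\<integral>\<^sup>+x. ennreal (exp (- \<theta> * x) * W (x - r)) \<partial>lborel) = ennreal (exp (- \<theta> * r) / \<psi> \<theta>)"
    using nn_laplace_W_shift [OF \<theta>, of r] by (simp add: ennreal_mult' W_nonneg)
  show "integrable lborel (\<lambda>x. exp (- \<theta> * x) * W (x - r))"
    by (rule integrableI_nonneg) (use nn in \<open>auto simp: W_nonneg\<close>)
  show "(LINT x|lborel. exp (- \<theta> * x) * W (x - r)) = exp (- \<theta> * r) / \<psi> \<theta>"
    by (rule integral_eq_nn_integral [THEN trans]) (use nn psi_pos [OF \<theta>] in \<open>auto simp: W_nonneg\<close>)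
qed

text \<open>The transform of the derivative is the limit of the transforms of the difference quotients, which
are \<open>(exp (\<theta> \<epsilon>) - 1) / (\<epsilon> \<psi> \<theta>)\<close> by translation. The Lipschitz bound dominates the quotients.\<close>

lemma W_derivative:
  assumes \<sigma>: "0 < \<sigma>"
  obtains g where "g \<in> borel_measurable borel" "\<And>x. 0 \<le> g x"
    "\<And>x. 0 < x \<Longrightarrow> (W has_real_derivative g x) (at x)"
    "\<And>\<theta>. 0 < \<theta> \<Longrightarrow> (\<integral>\<^sup>+x. ennreal (exp (- \<theta> * x)) * ennreal (g x) * indicator {0<..} x \<partial>lborel)
      = ennreal (\<theta> / \<psi> \<theta>)"
proof -
  interpret volterra "\<sigma>\<^sup>2 / 2" memory_kernel W by (rule volterra_equation [OF \<sigma>])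
  obtain g where g [measurable]: "g \<in> borel_measurable borel" and g_nonneg: "\<And>x. 0 \<le> g x"
    and deriv: "\<And>x. 0 < x \<Longrightarrow> (W has_real_derivative g x) (at x)"
    and lim: "\<And>x. (\<lambda>n. D (inverse (real (Suc n))) x) \<longlonglongrightarrow> g x"
    and g_neg: "\<And>x. x < 0 \<Longrightarrow> g x = 0"
    using solution_derivative by blast
  have "(\<integral>\<^sup>+x. ennreal (exp (- \<theta> * x)) * ennreal (g x) * indicator {0<..} x \<partial>lborel)
      = ennreal (\<theta> / \<psi> \<theta>)" if \<theta>: "0 < \<theta>" for \<theta>
  proof -
    \<comment> \<open>The quotients with step at most one vanish to the left of \<open>- 1\<close>.\<close>
    define b where "b x = 1 / (\<sigma>\<^sup>2 / 2) * (exp (- \<theta> * x) * indicator {- 1..} x)" for x :: real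
    have b_int: "integrable lborel b"
    proof -
      have "integrable lborel (\<lambda>x. exp (- \<theta> * x) * indicator {- 1..} x)"
      proof (rule integrableI_nonneg)
        have "(\<integral>\<^sup>+x. ennreal (exp (- \<theta> * x) * indicator {- 1..} x) \<partial>lborel)
            = (\<integral>\<^sup>+x. ennreal (exp (- \<theta> * x)) * indicator {- 1..} x \<partial>lborel)"
          by (intro nn_integral_cong) (auto simp: indicator_def)
        then show "(\<integral>\<^sup>+x. ennreal (exp (- \<theta> * x) * indicator {- 1..} x) \<partial>lborel) < \<infinity>"
          using nn_integral_exp_Ici [OF \<theta>, of "-1"] by simp
      qed auto
      then show ?thesis unfolding b_def by (rule integrable_mult_right)
    qed
    have bound: "norm (exp (- \<theta> * x) * D (inverse (real (Suc n))) x) \<le> b x" for n x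
    proof (cases "x < - 1")
      case True
      have "inverse (real (Suc n)) \<le> 1" by (simp add: inverse_le_1_iff)
      then have "D (inverse (real (Suc n))) x = 0" using True by (intro D_zero) auto
      then show ?thesis by (simp add: b_def)
    next
      case False
      have "D (inverse (real (Suc n))) x \<le> 1 / (\<sigma>\<^sup>2 / 2)" "0 \<le> D (inverse (real (Suc n))) x"
        using D_bounds [of "inverse (real (Suc n))" x] by auto
      then have "exp (- \<theta> * x) * D (inverse (real (Suc n))) x \<le> exp (- \<theta> * x) * (1 / (\<sigma>\<^sup>2 / 2))"
        by (intro mult_left_mono) auto
      then show ?thesis
        using False \<open>0 \<le> D (inverse (real (Suc n))) x\<close>
        by (simp add: b_def abs_mult mult.commute del: of_nat_Suc)
    qed
    have conv: "(\<lambda>n. LINT x|lborel. exp (- \<theta> * x) * D (inverse (real (Suc n))) x)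
        \<longlonglongrightarrow> (LINT x|lborel. exp (- \<theta> * x) * g x)"
      and g_int: "integrable lborel (\<lambda>x. exp (- \<theta> * x) * g x)"
    proof -
      have AE1: "AE x in lborel. (\<lambda>n. exp (- \<theta> * x) * D (inverse (real (Suc n))) x)
          \<longlonglongrightarrow> exp (- \<theta> * x) * g x"
        by (intro AE_I2 tendsto_mult tendsto_const lim)
      have AE2: "AE x in lborel. norm (exp (- \<theta> * x) * D (inverse (real (Suc n))) x) \<le> b x" for n
        by (intro AE_I2 bound)
      show "(\<lambda>n. LINT x|lborel. exp (- \<theta> * x) * D (inverse (real (Suc n))) x)
          \<longlonglongrightarrow> (LINT x|lborel. exp (- \<theta> * x) * g x)"
        by (rule integral_dominated_convergence [OF _ _ b_int AE1 AE2]) measurable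
      show "integrable lborel (\<lambda>x. exp (- \<theta> * x) * g x)"
        by (rule integrable_dominated_convergence [OF _ _ b_int AE1 AE2]) measurable
    qed
    have D_int: "(LINT x|lborel. exp (- \<theta> * x) * D e x) = (exp (\<theta> * e) - 1) / e / \<psi> \<theta>" for e
    proof -
      have "(LINT x|lborel. exp (- \<theta> * x) * D e x)
          = (LINT x|lborel. (exp (- \<theta> * x) * W (x - (- e)) - exp (- \<theta> * x) * W (x - 0)) / e)"
        by (simp add: D_def right_diff_distrib diff_divide_distrib)
      also have "\<dots> = ((LINT x|lborel. exp (- \<theta> * x) * W (x - (- e))) - (LINT x|lborel. exp (- \<theta> * x) * W (x - 0))) / e"
        by (simp only: integral_divide_zero Bochner_Integration.integral_diff [OF W_shift_integral(1) [OF \<theta>] W_shift_integral(1) [OF \<theta>]])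
      also have "\<dots> = (exp (\<theta> * e) / \<psi> \<theta> - 1 / \<psi> \<theta>) / e"
        by (simp only: W_shift_integral(2) [OF \<theta>]) simp
      also have "\<dots> = (exp (\<theta> * e) - 1) / e / \<psi> \<theta>"
        by (simp add: diff_divide_distrib [symmetric] mult.commute)
      finally show ?thesis .
    qed
    have "(\<lambda>n. LINT x|lborel. exp (- \<theta> * x) * D (inverse (real (Suc n))) x) \<longlonglongrightarrow> \<theta> / \<psi> \<theta>"
      unfolding D_int using psi_pos [OF \<theta>] by (intro tendsto_divide exp_difference_quotient tendsto_const) simp
    with conv have "(LINT x|lborel. exp (- \<theta> * x) * g x) = \<theta> / \<psi> \<theta>"
      by (rule LIMSEQ_unique)
    then have "(\<integral>\<^sup>+x. ennreal (exp (- \<theta> * x) * g x) \<partial>lborel) = ennreal (\<theta> / \<psi> \<theta>)"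
      using g_int g_nonneg by (subst nn_integral_eq_integral) (auto intro!: AE_I2)
    moreover have "(\<integral>\<^sup>+x. ennreal (exp (- \<theta> * x)) * ennreal (g x) * indicator {0<..} x \<partial>lborel)
        = (\<integral>\<^sup>+x. ennreal (exp (- \<theta> * x) * g x) \<partial>lborel)"
    proof (rule nn_integral_cong_AE)
      show "AE x in lborel. ennreal (exp (- \<theta> * x)) * ennreal (g x) * indicator {0<..} x
          = ennreal (exp (- \<theta> * x) * g x)"
        using AE_lborel_singleton [of 0]
      proof eventually_elim
        case (elim x)
        then show ?case
          using g_neg [of x] by (cases "0 < x") (auto simp: ennreal_mult' g_nonneg)
      qed
    qed
    ultimately show ?thesis by simp
  qed
  with g g_nonneg deriv show thesis by (rule that)
qed

end

section \<open>The Levy density\<close>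

lemma nn_integral_exp_Icc:
  fixes x \<theta> :: real
  assumes "0 < x" "0 \<le> \<theta>"
  shows "(\<integral>\<^sup>+s. ennreal (exp (- s * x)) * indicator {0..\<theta>} s \<partial>lborel) = ennreal ((1 - exp (- \<theta> * x)) / x)"
proof -
  have "(\<integral>\<^sup>+s. ennreal (exp (- s * x)) * indicator {0..\<theta>} s \<partial>lborel)
      = ennreal (- exp (- \<theta> * x) / x - - exp (- 0 * x) / x)"
  proof (rule nn_integral_FTC_Icc)
    fix s assume "s \<in> {0..\<theta>}"
    show "((\<lambda>s. - exp (- s * x) / x) has_real_derivative exp (- s * x)) (at s)"
      using assms by (auto intro!: derivative_eq_intros)
  qed (use assms in auto)
  also have "- exp (- \<theta> * x) / x - - exp (- 0 * x) / x = (1 - exp (- \<theta> * x)) / x"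
    by (simp add: diff_divide_distrib)
  finally show ?thesis .
qed

lemma min_le_exp:
  fixes x :: real
  assumes "0 \<le> x" shows "min 1 x \<le> 2 * (1 - exp (- x))"
proof -
  have "exp (- x) \<le> 1 / (1 + x)"
    using exp_ge_add_one_self [of x] assms by (simp add: exp_minus field_simps)
  then have "2 * (x / (1 + x)) \<le> 2 * (1 - exp (- x))"
    using assms by (simp add: field_simps)
  moreover have "min 1 x \<le> 2 * (x / (1 + x))"
  proof (cases "x \<le> 1")
    case True
    then have "x * (1 + x) \<le> x * 2" using assms by (intro mult_left_mono) auto
    then show ?thesis using True assms by (simp add: pos_le_divide_eq)
  qed (use assms in \<open>simp add: pos_le_divide_eq\<close>)
  ultimately show ?thesis by linarith
qed

context branching_scale
begin

lemma W_increment_nonneg: "0 < r \<Longrightarrow> 0 \<le> (W x - W (x - r)) * r"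
  using monoD [OF W_mono, of "x - r" x] by simp

lemma levy_density_nonneg:
  assumes x: "0 < x" shows "0 \<le> levy_density \<sigma> \<pi> W c x"
proof -
  have "0 \<le> (LINT r|\<pi>. (W x - W (x - r)) * r)"
    by (rule integral_nonneg_AE) (rule AE_I2, rule W_increment_nonneg, simp)
  moreover have "0 \<le> \<sigma>\<^sup>2 * deriv W x"
  proof (cases "\<sigma> = 0")
    case False
    then have "0 < \<sigma>" using sigma_nonneg by simp
    then show ?thesis
    proof (rule W_derivative)
      fix g assume "\<And>x. 0 \<le> g x" "\<And>x. 0 < x \<Longrightarrow> (W has_real_derivative g x) (at x)"
      then show ?thesis using DERIV_imp_deriv [of W "g x" x] x by simp
    qed
  qed simp
  ultimately show ?thesis by (simp add: levy_density_def)
qed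

lemma nn_laplace_jump_density:
  assumes \<theta>: "0 < \<theta>"
  shows "(\<integral>\<^sup>+x. ennreal (exp (- \<theta> * x)) * (\<integral>\<^sup>+r. ennreal ((W x - W (x - r)) * r) \<partial>\<pi>) \<partial>lborel)
    = ennreal (jump_part \<theta> / \<psi> \<theta>)"
proof -
  interpret P: pair_sigma_finite lborel \<pi> ..
  have "(\<integral>\<^sup>+x. ennreal (exp (- \<theta> * x)) * (\<integral>\<^sup>+r. ennreal ((W x - W (x - r)) * r) \<partial>\<pi>) \<partial>lborel)
      = (\<integral>\<^sup>+x. \<integral>\<^sup>+r. ennreal (exp (- \<theta> * x)) * ennreal ((W x - W (x - r)) * r) \<partial>\<pi> \<partial>lborel)"
    by (intro nn_integral_cong) (simp add: nn_integral_cmult)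
  also have "\<dots> = (\<integral>\<^sup>+r. \<integral>\<^sup>+x. ennreal (exp (- \<theta> * x)) * ennreal ((W x - W (x - r)) * r) \<partial>lborel \<partial>\<pi>)"
    by (rule P.Fubini' [symmetric], rule measurable_pair_pi) measurable
  also have "\<dots> = (\<integral>\<^sup>+r. ennreal (r * (1 - exp (- \<theta> * r)) / \<psi> \<theta>) \<partial>\<pi>)"
  proof (rule nn_integral_cong)
    fix r assume "r \<in> space \<pi>"
    then have r: "0 < r" by simp
    have "(\<integral>\<^sup>+x. ennreal (exp (- \<theta> * x)) * ennreal ((W x - W (x - r)) * r) \<partial>lborel)
        = (\<integral>\<^sup>+x. ennreal r * (ennreal (exp (- \<theta> * x)) * ennreal (W x - W (x - r))) \<partial>lborel)"
      using r monoD [OF W_mono] by (intro nn_integral_cong) (simp add: ennreal_mult mult_ac)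
    also have "\<dots> = ennreal r * ennreal ((1 - exp (- \<theta> * r)) / \<psi> \<theta>)"
      using nn_laplace_W_increment [OF \<theta>, of r] r by (subst nn_integral_cmult) simp_all
    also have "\<dots> = ennreal (r * (1 - exp (- \<theta> * r)) / \<psi> \<theta>)"
      using r by (simp add: ennreal_mult' [symmetric])
    finally show "(\<integral>\<^sup>+x. ennreal (exp (- \<theta> * x)) * ennreal ((W x - W (x - r)) * r) \<partial>lborel)
        = ennreal (r * (1 - exp (- \<theta> * r)) / \<psi> \<theta>)" .
  qed
  also have "\<dots> = ennreal (LINT r|\<pi>. r * (1 - exp (- \<theta> * r)) / \<psi> \<theta>)"
  proof (rule nn_integral_eq_integral)
    show "integrable \<pi> (\<lambda>r. r * (1 - exp (- \<theta> * r)) / \<psi> \<theta>)"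
      using jump_integrable [of \<theta>] \<theta> by simp
    show "AE r in \<pi>. 0 \<le> r * (1 - exp (- \<theta> * r)) / \<psi> \<theta>"
      using \<theta> psi_pos [OF \<theta>] by (intro AE_I2) simp
  qed
  finally show ?thesis by (simp add: jump_part_def)
qed

text \<open>The Bochner integral over \<open>\<pi>\<close> has the default value zero where it diverges. This happens on a null
set only, because the Laplace transform of the extended integral is finite.\<close>

lemma jump_density_AE:
  "AE x in lborel. ennreal (LINT r|\<pi>. (W x - W (x - r)) * r)
    = (\<integral>\<^sup>+r. ennreal ((W x - W (x - r)) * r) \<partial>\<pi>)"
proof -
  have [measurable]: "(\<lambda>x. \<integral>\<^sup>+r. ennreal ((W x - W (x - r)) * r) \<partial>\<pi>) \<in> borel_measurable borel"
    by (rule pi.borel_measurable_nn_integral, rule measurable_pair_pi) measurable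
  have "AE x in lborel. ennreal (exp (- 1 * x)) * (\<integral>\<^sup>+r. ennreal ((W x - W (x - r)) * r) \<partial>\<pi>) \<noteq> \<infinity>"
    using nn_laplace_jump_density [of 1] by (intro nn_integral_PInf_AE) simp_all
  then show ?thesis
  proof eventually_elim
    case (elim x)
    then have fin: "(\<integral>\<^sup>+r. ennreal ((W x - W (x - r)) * r) \<partial>\<pi>) < \<infinity>"
      by (auto simp: ennreal_mult_eq_top_iff less_top)
    have "AE r in \<pi>. 0 \<le> (W x - W (x - r)) * r"
      by (rule AE_I2) (rule W_increment_nonneg, simp)
    then show ?case
      using fin by (subst nn_integral_eq_integral) (auto intro!: integrableI_nonneg)
  qed
qed

text \<open>The function \<open>v\<close> for which the Levy measure is \<open>v x / x dx\<close>, extended by zero to the rest of the line.\<close>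

definition levy_mass :: "real \<Rightarrow> real \<Rightarrow> ennreal" where
  "levy_mass c x = ennreal (levy_density \<sigma> \<pi> W c x) * indicator {0<..} x"

text \<open>Up to the factor \<open>exp (- c x)\<close>, the density is on the half-line a measurable version of \<open>\<sigma>\<^sup>2 W'\<close> plus the integral of
the increments of \<open>W\<close>. The transforms of the two terms are \<open>\<sigma>\<^sup>2 \<theta> / \<psi> \<theta>\<close> and
\<open>jump_part \<theta> / \<psi> \<theta>\<close>, with sum \<open>(\<psi>' \<theta> - \<alpha>) / \<psi> \<theta>\<close>. If \<open>\<sigma> = 0\<close>, the first term is
zero whatever the derivative of \<open>W\<close> is.\<close>

lemma
  shows levy_mass_measurable [measurable]: "levy_mass c \<in> borel_measurable borel"
    and nn_laplace_levy_density: "0 < s + c \<Longrightarrow>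
      (\<integral>\<^sup>+x. ennreal (exp (- s * x)) * levy_mass c x \<partial>lborel)
        = ennreal ((deriv \<psi> (s + c) - \<alpha>) / \<psi> (s + c))"
proof -
  define U where "U x = (LINT r|\<pi>. (W x - W (x - r)) * r)" for x
  have [measurable]: "U \<in> borel_measurable borel"
    unfolding U_def
    by (rule pi.borel_measurable_lebesgue_integral, rule measurable_pair_pi) measurable
  have U_nonneg: "0 \<le> U x" for x
    unfolding U_def by (rule integral_nonneg_AE) (rule AE_I2, rule W_increment_nonneg, simp)
  have "\<exists>g. g \<in> borel_measurable borel \<and> (\<forall>x. 0 \<le> g x) \<and> (\<forall>x>0. \<sigma>\<^sup>2 * deriv W x = g x) \<and>
    (\<forall>\<theta>>0. (\<integral>\<^sup>+x. ennreal (exp (- \<theta> * x)) * ennreal (g x) * indicator {0<..} x \<partial>lborel)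
      = ennreal (\<sigma>\<^sup>2 * \<theta> / \<psi> \<theta>))"
  proof (cases "\<sigma> = 0")
    case True
    then show ?thesis by (intro exI [of _ "\<lambda>_. 0"]) simp
  next
    case False
    then have "0 < \<sigma>" using sigma_nonneg by simp
    then obtain g where [measurable]: "g \<in> borel_measurable borel" and g: "\<And>x. 0 \<le> g x"
      "\<And>x. 0 < x \<Longrightarrow> (W has_real_derivative g x) (at x)"
      "\<And>\<theta>. 0 < \<theta> \<Longrightarrow> (\<integral>\<^sup>+x. ennreal (exp (- \<theta> * x)) * ennreal (g x) * indicator {0<..} x \<partial>lborel)
        = ennreal (\<theta> / \<psi> \<theta>)"
      using W_derivative [OF \<open>0 < \<sigma>\<close>] by blast
    show ?thesis
    proof (intro exI [of _ "\<lambda>x. \<sigma>\<^sup>2 * g x"] conjI allI impI)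
      show "\<sigma>\<^sup>2 * deriv W x = \<sigma>\<^sup>2 * g x" if "0 < x" for x
        using DERIV_imp_deriv [OF g(2) [OF that]] by simp
      fix \<theta> :: real assume \<theta>: "0 < \<theta>"
      have "(\<integral>\<^sup>+x. ennreal (exp (- \<theta> * x)) * ennreal (\<sigma>\<^sup>2 * g x) * indicator {0<..} x \<partial>lborel)
          = (\<integral>\<^sup>+x. ennreal (\<sigma>\<^sup>2) * (ennreal (exp (- \<theta> * x)) * ennreal (g x) * indicator {0<..} x) \<partial>lborel)"
        by (intro nn_integral_cong) (simp add: ennreal_mult g(1) mult_ac)
      also have "\<dots> = ennreal (\<sigma>\<^sup>2) * ennreal (\<theta> / \<psi> \<theta>)"
        by (subst nn_integral_cmult) (measurable, simp only: g(3) [OF \<theta>])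
      also have "\<dots> = ennreal (\<sigma>\<^sup>2 * \<theta> / \<psi> \<theta>)" by (simp add: ennreal_mult' [symmetric])
      finally show "(\<integral>\<^sup>+x. ennreal (exp (- \<theta> * x)) * ennreal (\<sigma>\<^sup>2 * g x) * indicator {0<..} x \<partial>lborel)
          = ennreal (\<sigma>\<^sup>2 * \<theta> / \<psi> \<theta>)" .
    qed (use g(1) in auto)
  qed
  then obtain g where [measurable]: "g \<in> borel_measurable borel" and g_nonneg: "\<And>x. 0 \<le> g x"
    and g_deriv: "\<And>x. 0 < x \<Longrightarrow> \<sigma>\<^sup>2 * deriv W x = g x"
    and g_laplace: "\<And>\<theta>. 0 < \<theta> \<Longrightarrow>
      (\<integral>\<^sup>+x. ennreal (exp (- \<theta> * x)) * ennreal (g x) * indicator {0<..} x \<partial>lborel) = ennreal (\<sigma>\<^sup>2 * \<theta> / \<psi> \<theta>)"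
    by blast
  have eq: "levy_mass c x = ennreal (exp (- c * x)) * (ennreal (g x) + ennreal (U x)) * indicator {0<..} x" for x
    by (cases "0 < x")
      (auto simp: levy_mass_def levy_density_def U_def [symmetric] g_deriv ennreal_mult' ennreal_plus
        g_nonneg U_nonneg)
  show "levy_mass c \<in> borel_measurable borel"
    unfolding eq by measurable
  assume sc: "0 < s + c"
  \<comment> \<open>The tilt \<open>exp (- c x)\<close> of the density shifts the argument of the transform.\<close>
  define \<theta> where "\<theta> = s + c"
  have \<theta>: "0 < \<theta>" using sc by (simp add: \<theta>_def)
  have "(\<integral>\<^sup>+x. ennreal (exp (- s * x)) * levy_mass c x \<partial>lborel)
      = (\<integral>\<^sup>+x. ennreal (exp (- \<theta> * x)) * ennreal (g x) * indicator {0<..} x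
          + ennreal (exp (- \<theta> * x)) * (\<integral>\<^sup>+r. ennreal ((W x - W (x - r)) * r) \<partial>\<pi>) \<partial>lborel)"
  proof (rule nn_integral_cong_AE)
    show "AE x in lborel. ennreal (exp (- s * x)) * levy_mass c x
        = ennreal (exp (- \<theta> * x)) * ennreal (g x) * indicator {0<..} x
          + ennreal (exp (- \<theta> * x)) * (\<integral>\<^sup>+r. ennreal ((W x - W (x - r)) * r) \<partial>\<pi>)"
      using jump_density_AE AE_lborel_singleton [of 0]
    proof eventually_elim
      case (elim x)
      have e: "ennreal (exp (- s * x)) * (ennreal (exp (- c * x)) * y) = ennreal (exp (- \<theta> * x)) * y" for y
      proof -
        have "exp (- s * x) * exp (- c * x) = exp (- \<theta> * x)"
          by (simp add: mult_exp_exp \<theta>_def algebra_simps)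
        then have "ennreal (exp (- s * x)) * ennreal (exp (- c * x)) = ennreal (exp (- \<theta> * x))"
          by (simp only: ennreal_mult' [symmetric] exp_ge_zero)
        then show ?thesis by (simp only: mult.assoc [symmetric])
      qed
      show ?case
      proof (cases "0 < x")
        case True
        then show ?thesis
          using elim(1) by (simp only: eq e U_def mult.assoc) (simp add: distrib_left)
      next
        case False
        then have "x < 0" using elim(2) by simp
        have "(\<integral>\<^sup>+r. ennreal ((W x - W (x - r)) * r) \<partial>\<pi>) = (\<integral>\<^sup>+r. 0 \<partial>\<pi>)"
          using \<open>x < 0\<close> by (intro nn_integral_cong) (simp add: W_negative)
        then show ?thesis using \<open>x < 0\<close> by (simp add: levy_mass_def)
      qed
    qed
  qed
  also have "\<dots> = ennreal (\<sigma>\<^sup>2 * \<theta> / \<psi> \<theta>) + ennreal (jump_part \<theta> / \<psi> \<theta>)"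
  proof (subst nn_integral_add)
    show "(\<lambda>x. ennreal (exp (- \<theta> * x)) * (\<integral>\<^sup>+r. ennreal ((W x - W (x - r)) * r) \<partial>\<pi>)) \<in> borel_measurable lborel"
      by (intro borel_measurable_times_ennreal pi.borel_measurable_nn_integral measurable_pair_pi) measurable
  qed (measurable, simp only: g_laplace [OF \<theta>] nn_laplace_jump_density [OF \<theta>])
  also have "\<dots> = ennreal ((deriv \<psi> \<theta> - \<alpha>) / \<psi> \<theta>)"
    using \<theta> psi_pos [OF \<theta>] jump_part_nonneg [of \<theta>] deriv_psi [OF \<theta>]
    by (simp add: ennreal_plus [symmetric] add_divide_distrib del: ennreal_plus)
  finally show "(\<integral>\<^sup>+x. ennreal (exp (- s * x)) * levy_mass c x \<partial>lborel)
      = ennreal ((deriv \<psi> (s + c) - \<alpha>) / \<psi> (s + c))"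
    by (simp add: \<theta>_def)
qed

lemma exponent_integrand_nonneg:
  assumes "0 < s" shows "0 \<le> (deriv \<psi> s - \<alpha>) / \<psi> s"
  using assms psi_pos [OF assms] jump_part_nonneg [of s] by (simp add: deriv_psi)

text \<open>The Laplace exponent of the limit variable, in its integral form.\<close>

definition exponent :: "real \<Rightarrow> real \<Rightarrow> real" where
  "exponent c \<theta> = (LINT s:{c..\<theta> + c}|lborel. (deriv \<psi> s - \<alpha>) / \<psi> s)"

lemma exponent_integrand_integrable:
  assumes c: "0 < c"
  shows "integrable lborel (\<lambda>s. indicator {c..T} s * ((deriv \<psi> s - \<alpha>) / \<psi> s))"
proof -
  have "continuous_on {c..T} (\<lambda>s. (\<sigma>\<^sup>2 * s + jump_part s) / \<psi> s)"
  proof (intro continuous_intros ballI)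
    show "continuous_on {c..T} jump_part"
      by (rule continuous_on_subset [OF jump_part_continuous [of T]]) (use c in auto)
    show "continuous_on {c..T} \<psi>"
      by (rule continuous_on_subset [OF psi_continuous]) (use c in auto)
    show "\<psi> s \<noteq> 0" if "s \<in> {c..T}" for s using psi_pos [of s] that c by auto
  qed
  then have "continuous_on {c..T} (\<lambda>s. (deriv \<psi> s - \<alpha>) / \<psi> s)"
    using c by (subst continuous_on_cong [OF refl]) (auto simp: deriv_psi)
  then have "set_integrable lborel {c..T} (\<lambda>s. (deriv \<psi> s - \<alpha>) / \<psi> s)"
    by (rule borel_integrable_atLeastAtMost')
  then show ?thesis by (simp add: set_integrable_def)
qed

lemma nn_integral_exponent:
  assumes c: "0 < c"
  shows "(\<integral>\<^sup>+s. ennreal (indicator {c..\<theta> + c} s * ((deriv \<psi> s - \<alpha>) / \<psi> s)) \<partial>lborel)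
    = ennreal (exponent c \<theta>)"
proof -
  have "(\<integral>\<^sup>+s. ennreal (indicator {c..\<theta> + c} s * ((deriv \<psi> s - \<alpha>) / \<psi> s)) \<partial>lborel)
      = ennreal (LINT s|lborel. indicator {c..\<theta> + c} s * ((deriv \<psi> s - \<alpha>) / \<psi> s))"
  proof (rule nn_integral_eq_integral [OF exponent_integrand_integrable [OF c]], rule AE_I2)
    show "0 \<le> indicator {c..\<theta> + c} s * ((deriv \<psi> s - \<alpha>) / \<psi> s)" for s
      using exponent_integrand_nonneg [of s] c by (auto simp: indicator_def)
  qed
  then show ?thesis by (simp add: exponent_def set_lebesgue_integral_def)
qed

lemma exponent_nonneg:
  assumes "0 < c" shows "0 \<le> exponent c \<theta>"
  unfolding exponent_def set_lebesgue_integral_def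
proof (rule integral_nonneg_AE, rule AE_I2)
  show "0 \<le> indicator {c..\<theta> + c} s *\<^sub>R ((deriv \<psi> s - \<alpha>) / \<psi> s)" for s
    using exponent_integrand_nonneg [of s] assms by (auto simp: indicator_def)
qed

text \<open>\<open>(1 - exp (- \<theta> x)) / x\<close> is the integral of \<open>exp (- s x)\<close> over \<open>0 \<le> s \<le> \<theta>\<close>; exchanging the
integrals gives the transform of the density at \<open>s + c\<close>.\<close>

theorem nn_levy_khintchine:
  assumes c: "0 < c" and \<theta>: "0 \<le> \<theta>"
  shows "(\<integral>\<^sup>+x. ennreal ((1 - exp (- \<theta> * x)) / x) * levy_mass c x \<partial>lborel) = ennreal (exponent c \<theta>)"
proof -
  define f where "f s = ennreal (indicator {c..\<theta> + c} s * ((deriv \<psi> s - \<alpha>) / \<psi> s))" for s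
  have [measurable]: "f \<in> borel_measurable borel"
    unfolding f_def using exponent_integrand_integrable [OF c, of "\<theta> + c"] by measurable
  have "(\<integral>\<^sup>+x. ennreal ((1 - exp (- \<theta> * x)) / x) * levy_mass c x \<partial>lborel)
      = (\<integral>\<^sup>+x. \<integral>\<^sup>+s. ennreal (exp (- s * x)) * indicator {0..\<theta>} s * levy_mass c x \<partial>lborel \<partial>lborel)"
  proof (rule nn_integral_cong)
    fix x :: real
    show "ennreal ((1 - exp (- \<theta> * x)) / x) * levy_mass c x
        = (\<integral>\<^sup>+s. ennreal (exp (- s * x)) * indicator {0..\<theta>} s * levy_mass c x \<partial>lborel)"
    proof (cases "0 < x")
      case True
      then show ?thesis
        by (subst nn_integral_multc) (measurable, simp only: nn_integral_exp_Icc [OF True \<theta>])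
    qed (simp add: levy_mass_def)
  qed
  also have "\<dots> = (\<integral>\<^sup>+s. \<integral>\<^sup>+x. ennreal (exp (- s * x)) * indicator {0..\<theta>} s * levy_mass c x \<partial>lborel \<partial>lborel)"
    by (rule lborel_pair.Fubini' [symmetric]) measurable
  also have "\<dots> = (\<integral>\<^sup>+s. f (c + 1 * s) \<partial>lborel)"
  proof (rule nn_integral_cong)
    fix s :: real
    have "(\<integral>\<^sup>+x. ennreal (exp (- s * x)) * indicator {0..\<theta>} s * levy_mass c x \<partial>lborel)
        = (\<integral>\<^sup>+x. indicator {0..\<theta>} s * (ennreal (exp (- s * x)) * levy_mass c x) \<partial>lborel)"
      by (intro nn_integral_cong) (simp add: mult_ac)
    also have "\<dots> = indicator {0..\<theta>} s * (\<integral>\<^sup>+x. ennreal (exp (- s * x)) * levy_mass c x \<partial>lborel)"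
      by (rule nn_integral_cmult) measurable
    also have "\<dots> = f (c + 1 * s)"
      using nn_laplace_levy_density [of s c] c by (auto simp: f_def indicator_def add.commute)
    finally show "(\<integral>\<^sup>+x. ennreal (exp (- s * x)) * indicator {0..\<theta>} s * levy_mass c x \<partial>lborel)
        = f (c + 1 * s)" .
  qed
  also have "\<dots> = (\<integral>\<^sup>+s. f s \<partial>lborel)"
    using nn_integral_real_affine [of f 1 c] by simp
  also have "\<dots> = ennreal (exponent c \<theta>)"
    unfolding f_def by (rule nn_integral_exponent [OF c])
  finally show ?thesis .
qed

lemma exponent_eq_log:
  assumes "0 < c" "0 \<le> \<theta>"
  shows "exponent c \<theta> = \<alpha> * (tail_integral \<psi> (\<theta> + c) - tail_integral \<psi> c) + ln (\<psi> (\<theta> + c) / \<psi> c)"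
  using log_psi_increment [OF assms] by (simp add: exponent_def)

text \<open>The integrability condition on the Levy measure follows from finiteness of the exponent at
\<open>\<theta> = 1\<close>, as \<open>min 1 x \<le> 2 (1 - exp (- x))\<close>.\<close>

lemma levy_khintchine_exponent:
  assumes c: "0 < c" and l: "\<And>\<theta>. 0 < \<theta> \<Longrightarrow> l \<theta> = exponent c \<theta>"
  shows "levy_khintchine l 0 (levy_density \<sigma> \<pi> W c)"
proof -
  define v where "v = levy_density \<sigma> \<pi> W c"
  have v: "0 \<le> v x" if "0 < x" for x
    using levy_density_nonneg [OF that] by (simp add: v_def)
  have mass: "levy_mass c x = ennreal (indicator {0<..} x * v x)" for x
    by (auto simp: levy_mass_def v_def indicator_def)
  have [measurable]: "(\<lambda>x. indicator {0<..} x * v x) \<in> borel_measurable borel"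
  proof -
    have "(\<lambda>x. indicator {0<..} x * v x) = (\<lambda>x. enn2real (levy_mass c x))"
      using v by (auto simp: mass fun_eq_iff indicator_def)
    then show ?thesis by simp
  qed
  define g where "g \<theta> x = (1 - exp (- \<theta> * x)) / x * (indicator {0<..} x * v x)" for \<theta> x
  have g_meas [measurable]: "g \<theta> \<in> borel_measurable borel" for \<theta>
    unfolding g_def by measurable
  have g_nonneg: "0 \<le> g \<theta> x" if "0 < \<theta>" for \<theta> x
    using v [of x] that by (auto simp: g_def indicator_def)
  have g_nn: "(\<integral>\<^sup>+x. ennreal (g \<theta> x) \<partial>lborel) = ennreal (exponent c \<theta>)" if "0 < \<theta>" for \<theta>
  proof -
    have "ennreal (g \<theta> x) = ennreal ((1 - exp (- \<theta> * x)) / x) * levy_mass c x" for x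
      unfolding g_def mass by (rule ennreal_mult'') (use v [of x] in \<open>simp add: indicator_def\<close>)
    then show ?thesis using nn_levy_khintchine [OF c, of \<theta>] that by simp
  qed
  have g_int: "integrable lborel (g \<theta>)" if "0 < \<theta>" for \<theta>
    by (rule integrableI_nonneg) (use g_nn [OF that] g_nonneg [OF that] in auto)
  have g_eq: "indicator {0<..} x *\<^sub>R ((1 - exp (- \<theta> * x)) * (v x / x)) = g \<theta> x" for x \<theta>
    by (simp add: g_def)
  have "exponent c \<theta> = (LINT x:{0<..}|lborel. (1 - exp (- \<theta> * x)) * (v x / x))" if "0 < \<theta>" for \<theta>
  proof -
    have "ennreal (exponent c \<theta>) = ennreal (LINT x|lborel. g \<theta> x)"
      using nn_integral_eq_integral [OF g_int [OF that]] g_nonneg [OF that] g_nn [OF that] by simp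
    then have "exponent c \<theta> = (LINT x|lborel. g \<theta> x)"
      using exponent_nonneg [OF c] g_nonneg [OF that] by (simp add: ennreal_inj integral_nonneg_AE)
    then show ?thesis unfolding set_lebesgue_integral_def g_eq .
  qed
  moreover have "set_integrable lborel {0<..} (\<lambda>x. min 1 x * (v x / x))"
    unfolding set_integrable_def
  proof (rule Bochner_Integration.integrable_bound)
    show "integrable lborel (\<lambda>x. 2 * g 1 x)" using g_int [of 1] by simp
    have "(\<lambda>x. indicator {0<..} x *\<^sub>R (min 1 x * (v x / x))) = (\<lambda>x. min 1 x / x * (indicator {0<..} x * v x))"
      by (simp add: fun_eq_iff)
    then show "(\<lambda>x. indicator {0<..} x *\<^sub>R (min 1 x * (v x / x))) \<in> borel_measurable lborel"
      by simp
    show "AE x in lborel. norm (indicator {0<..} x *\<^sub>R (min 1 x * (v x / x))) \<le> norm (2 * g 1 x)"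
    proof (rule AE_I2)
      fix x :: real
      show "norm (indicator {0<..} x *\<^sub>R (min 1 x * (v x / x))) \<le> norm (2 * g 1 x)"
      proof (cases "0 < x")
        case True
        then have "min 1 x * (v x / x) \<le> 2 * (1 - exp (- x)) * (v x / x)"
          using v [OF True] min_le_exp [OF less_imp_le [OF True]] by (intro mult_right_mono) auto
        then have "min 1 x * (v x / x) \<le> 2 * ((1 - exp (- x)) * (v x / x))"
          by (simp only: mult.assoc)
        also have "2 * ((1 - exp (- x)) * (v x / x)) = 2 * g 1 x"
          using True by (simp add: g_def)
        finally have "min 1 x * (v x / x) \<le> 2 * g 1 x" .
        moreover have "0 \<le> min 1 x * (v x / x)" using True v [OF True] by simp
        ultimately show ?thesis using True by simp
      qed simp
    qed
  qed
  ultimately show ?thesis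
    using v l by (simp add: levy_khintchine_def v_def)
qed

text \<open>The measure \<open>levy_mass c x dx\<close> has finite total mass, its Laplace transform at zero, because the
tilt \<open>c\<close> is positive.\<close>

lemma exponent_root_exists:
  fixes n :: nat
  assumes c: "0 < c" and n: "1 \<le> n"
  obtains \<nu> where "real_distribution \<nu>" "AE x in \<nu>. 0 \<le> x"
    "\<And>\<theta>. 0 < \<theta> \<Longrightarrow> (LINT x|\<nu>. exp (- \<theta> * x)) ^ n = exp (- exponent c \<theta>)"
proof -
  define K where "K = density lborel (\<lambda>x. ennreal (1 / real n) * levy_mass c x)"
  have K: "finite_borel_measure K"
  proof -
    have "emeasure K (space K) = (\<integral>\<^sup>+x. ennreal (1 / real n) * levy_mass c x \<partial>lborel)"
      unfolding K_def by (subst emeasure_density) auto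
    also have "\<dots> = ennreal (1 / real n) * (\<integral>\<^sup>+x. ennreal (exp (- 0 * x)) * levy_mass c x \<partial>lborel)"
      by (subst nn_integral_cmult) auto
    also have "\<dots> < \<infinity>"
      by (subst nn_laplace_levy_density) (use c in \<open>auto simp: ennreal_mult_less_top\<close>)
    finally show ?thesis
      by (auto simp: finite_borel_measure_def finite_borel_measure_axioms_def K_def intro!: finite_measureI)
  qed
  have K_pos: "AE x in K. 0 < x"
    unfolding K_def by (subst AE_density, measurable) (simp add: levy_mass_def indicator_def)
  have K_int: "(LINT x|K. (1 - exp (- \<theta> * x)) / x) = exponent c \<theta> / real n" if "0 < \<theta>" for \<theta>
  proof -
    have meas: "(\<lambda>x. (1 - exp (- \<theta> * x)) / x) \<in> borel_measurable K"
      unfolding K_def by simp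
    have "(\<integral>\<^sup>+x. ennreal ((1 - exp (- \<theta> * x)) / x) \<partial>K)
        = (\<integral>\<^sup>+x. ennreal (1 / real n) * (ennreal ((1 - exp (- \<theta> * x)) / x) * levy_mass c x) \<partial>lborel)"
      unfolding K_def by (subst nn_integral_density) (auto intro!: nn_integral_cong simp: mult_ac)
    also have "\<dots> = ennreal (1 / real n) * ennreal (exponent c \<theta>)"
      using nn_levy_khintchine [OF c, of \<theta>] that by (subst nn_integral_cmult) auto
    also have "\<dots> = ennreal (exponent c \<theta> / real n)"
      by (simp add: ennreal_mult' [symmetric])
    finally have nn: "(\<integral>\<^sup>+x. ennreal ((1 - exp (- \<theta> * x)) / x) \<partial>K) = ennreal (exponent c \<theta> / real n)" .
    have "AE x in K. 0 \<le> (1 - exp (- \<theta> * x)) / x"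
      using K_pos by eventually_elim (use that in simp)
    then have "(LINT x|K. (1 - exp (- \<theta> * x)) / x) = enn2real (\<integral>\<^sup>+x. ennreal ((1 - exp (- \<theta> * x)) / x) \<partial>K)"
      by (rule integral_eq_nn_integral [OF meas])
    then show ?thesis unfolding nn using exponent_nonneg [OF c] by simp
  qed
  show thesis
  proof (rule subordinator_law_exists [OF K K_pos])
    fix \<nu> assume \<nu>: "real_distribution \<nu>" "AE x in \<nu>. 0 \<le> x"
      "\<And>\<theta>. \<theta> > 0 \<Longrightarrow> (LINT x|\<nu>. exp (- \<theta> * x)) = exp (- (LINT x|K. (1 - exp (- \<theta> * x)) / x))"
    have "(LINT x|\<nu>. exp (- \<theta> * x)) ^ n = exp (- exponent c \<theta>)" if "0 < \<theta>" for \<theta>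
      unfolding \<nu>(3) [OF that] K_int [OF that] using n by (simp add: exp_of_nat_mult [symmetric])
    with \<nu>(1,2) show thesis by (rule that)
  qed
qed

theorem infinitely_divisible_exponent:
  assumes c: "0 < c" and \<mu>: "real_distribution \<mu>" "AE x in \<mu>. 0 \<le> x"
    and laplace: "\<And>\<theta>. 0 < \<theta> \<Longrightarrow> (LINT x|\<mu>. exp (- \<theta> * x)) = exp (- exponent c \<theta>)"
  shows "infinitely_divisible \<mu>"
  unfolding infinitely_divisible_def
proof (intro conjI allI impI \<mu>(1))
  fix n :: nat assume n: "1 \<le> n"
  obtain \<nu> where \<nu>: "real_distribution \<nu>" "AE x in \<nu>. 0 \<le> x"
    and root: "\<And>\<theta>. 0 < \<theta> \<Longrightarrow> (LINT x|\<nu>. exp (- \<theta> * x)) ^ n = exp (- exponent c \<theta>)"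
    using exponent_root_exists [OF c n] by blast
  have sum: "real_distribution (iid_sum \<nu> n)" by (rule real_distribution_iid_sum [OF \<nu>])
  have "\<mu> = iid_sum \<nu> n"
  proof (rule finite_measure_eqI_laplace)
    show "finite_borel_measure \<mu>" "finite_borel_measure (iid_sum \<nu> n)"
      by (rule real_distribution.finite_borel_measure_M, fact)+
    fix k :: nat
    show "(LINT x|\<mu>. exp (- real k * x)) = (LINT x|iid_sum \<nu> n. exp (- real k * x))"
    proof (cases "k = 0")
      case True
      have "prob_space \<mu>" "prob_space (iid_sum \<nu> n)"
        using \<mu>(1) sum by (auto simp: real_distribution_def)
      then show ?thesis using True by (simp add: prob_space.prob_space)
    next
      case False
      then have "0 < real k" by simp
      then show ?thesis by (simp only: laplace laplace_iid_sum [OF \<nu>] root)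
    qed
  qed (use \<mu>(2) iid_sum_nonneg [OF \<nu>] in auto)
  then show "\<exists>\<nu>. real_distribution \<nu> \<and> \<mu> = distr (Pi\<^sub>M {..<n} (\<lambda>_. \<nu>)) borel (\<lambda>x. \<Sum>i<n. x i)"
    using \<nu>(1) by (auto simp: iid_sum_def)
qed

end

section \<open>The law of the limit variable\<close>

theorem proposition4p7:
  fixes \<alpha> \<sigma> q :: real and \<pi> :: "real measure" and W \<psi> \<phi> \<phi>inv :: "real \<Rightarrow> real"
    and M :: "'a measure" and V :: "'a \<Rightarrow> real"
  defines "\<psi> \<equiv> branching_mechanism \<alpha> \<sigma> \<pi>"
  defines "\<phi> \<equiv> tail_integral \<psi>"
  defines "\<phi>inv \<equiv> tail_integral_inv \<psi>"
  assumes "admissible \<alpha> \<sigma> \<pi>"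
    and "scale_function \<psi> W"
    and "q > 0"
    and "prob_space M"
    and "V \<in> borel_measurable M"
    and "AE \<omega> in M. 0 \<le> V \<omega>"
    and "\<And>\<theta>. \<theta> > 0 \<Longrightarrow>
      (LINT \<omega>|M. exp (- \<theta> * V \<omega>)) =
        exp (- \<alpha> * (\<phi> (\<theta> + \<phi>inv q) - q)) * (\<psi> (\<phi>inv q) / \<psi> (\<theta> + \<phi>inv q))"
  shows "infinitely_divisible (distr M borel V) \<and>
    (\<forall>\<theta>>0. laplace_exponent M V \<theta> =
      (LINT s:{\<phi>inv q..\<theta> + \<phi>inv q}|lborel. (deriv \<psi> s - \<alpha>) / \<psi> s)) \<and>
    levy_khintchine (laplace_exponent M V) 0 (levy_density \<sigma> \<pi> W (\<phi>inv q))"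
proof -
  interpret branching_scale \<alpha> \<sigma> \<pi> W
    using assms(4,5) unfolding \<psi>_def by unfold_locales
  interpret M: prob_space M by fact
  define c where "c = \<phi>inv q"
  have c: "0 < c" and \<phi>_c: "tail_integral \<psi> c = q"
    using tail_integral_inv [OF \<open>q > 0\<close>] by (simp_all add: c_def \<phi>inv_def \<psi>_def)
  have transform: "(LINT \<omega>|M. exp (- \<theta> * V \<omega>)) = exp (- exponent c \<theta>)" if \<theta>: "0 < \<theta>" for \<theta>
  proof -
    have pos: "0 < \<psi> c" "0 < \<psi> (\<theta> + c)" using psi_pos c \<theta> by (simp_all add: \<psi>_def)
    have "exponent c \<theta> = \<alpha> * (\<phi> (\<theta> + c) - q) + ln (\<psi> (\<theta> + c) / \<psi> c)"
      using exponent_eq_log [OF c, of \<theta>] \<theta> \<phi>_c by (simp add: \<phi>_def \<psi>_def)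
    then have "exp (- exponent c \<theta>) = exp (- \<alpha> * (\<phi> (\<theta> + c) - q)) * exp (- ln (\<psi> (\<theta> + c) / \<psi> c))"
      by (simp add: exp_add [symmetric])
    also have "exp (- ln (\<psi> (\<theta> + c) / \<psi> c)) = \<psi> c / \<psi> (\<theta> + c)"
      using pos by (simp add: exp_minus)
    finally show ?thesis using assms(10) [OF \<theta>] by (simp only: c_def)
  qed
  have l: "laplace_exponent M V \<theta> = exponent c \<theta>" if "0 < \<theta>" for \<theta>
    unfolding laplace_exponent_def transform [OF that] by simp
  have "infinitely_divisible (distr M borel V)"
  proof (rule infinitely_divisible_exponent [OF c])
    show "real_distribution (distr M borel V)"
      using assms(8) by (rule M.real_distribution_distr)
    show "AE x in distr M borel V. 0 \<le> x"
      using assms(8,9) by (subst AE_distr_iff) auto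
    show "(LINT x|distr M borel V. exp (- \<theta> * x)) = exp (- exponent c \<theta>)" if "0 < \<theta>" for \<theta>
      using assms(8) transform [OF that] by (subst integral_distr) auto
  qed
  moreover have "levy_khintchine (laplace_exponent M V) 0 (levy_density \<sigma> \<pi> W c)"
    by (rule levy_khintchine_exponent [OF c l])
  ultimately show ?thesis
    using l by (simp add: c_def exponent_def \<psi>_def)
qed

end
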